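(* Let $1\le\lambda\le n$ and let $(F_{\rm in},\mathcal L_{\rm in})$ be a $\lambda$-good face-laminar pair. Then there exists a weight function $w_{\rm out}\in\mathcal W^{\log_2 n+1}$ such that the face $F_{\rm out}=\mathrm{Min}(F_{\rm in},w_{\rm out})$ satisfies: (i') each $S\in\mathcal L_{\rm in}$ with $|S|\le2\lambda$ is $F_{\rm out}$-contractible; (ii') the $(F_{\rm out},\mathcal L_{\rm in},2\lambda)$-contraction of $G$ contains no $F_{\rm out}$-respecting alternating circuit of node-weight at most $2\lambda$.
   Context: $G=(V,E)$ is a fixed undirected simple graph with $n$ vertices ($n$ sufficiently large; $\log_2 n$ assumed integral, otherwise $\lceil\log_2 n\rceil$). For $S\subseteq V$, $\delta(S)$ (resp. $E(S)$) denotes edges with exactly one (resp. both) endpoints in $S$; $\mathbf 1_X$ indicator vectors; $x(\delta(S))=\sum_{e\in\delta(S)}x_e$. $\mathrm{PM}=\{x\in\mathbb{R}^E:x(\delta(v))=1\ \forall v,\ x(\delta(S))\ge1\ \forall S\subseteq V\text{ odd},\ x\ge0\}$; a face is a nonempty subset obtained by setting some of these inequalities to equality; a perfect matching is in $F$ if its indicator vector is. $\mathrm{supp}(F)=\{e:\exists x\in F,x_e>0\}$; $\mathrm{tight}(F)=\{S\subseteq V:|S|\text{ odd},x(\delta(S))=1\ \forall x\in F\}$; $\mathrm{Min}(F,w)=\arg\min\{\langle w,x\rangle:x\in F\}$. Fix a numbering $E=\{e_1,\dots,e_{|E|}\}$; $\mathcal W=\{w_k:k=2,\dots,n^{20}\}$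 with $w_k(e_j)=(4n^2+1)^j\bmod k$; for $w:E\to\mathbb{Z}$, $w'\in\mathcal W$, $w\circ w'=n^{21}w+w'$; $\mathcal W^k$ is the set of all $(\cdots(w_1\circ w_2)\circ\cdots)\circ w_k$, $w_i\in\mathcal W$. Laminar family: no two members $S,T$ cross ($S\cap T,S\setminus T,T\setminus S$ all nonempty); maximal laminar subset of $\mathcal S$: laminar subfamily to which no other member of $\mathcal S$ can be added keeping laminarity; all laminar families contain all singletons. A face-laminar pair $(F,\mathcal L)$: face $F$, laminar $\mathcal L\subseteq\mathrm{tight}(F)$. $S\in\mathrm{tight}(F)$ is $F$-contractible if for each $e\in\delta(S)$ no two perfect matchings in $F$ contain $e$ and differ on $E(S)$. For $1\le\mu\le2n$, the $(F,\mathcal L,\mu)$-contraction $H$ is the node-weighted multigraph with nodes the maximal sets of cardinality $\le\mu$ in $\mathcal L$ (node-weight = cardinality) and edges the edges $e\in\mathrm{supp}(F)\setminus\bigcup_{T\in\mathcal L,|T|>\mu}\delta(T)$ not inside a single node, joining the nodes containing their endpoints; edges of $H$ are identified with their preimages in $E$. A cyclic walk $C=(e_0,\dots,e_{k-1})$ of even length has $\chi_C=\sum_i(-1)^i\mathbf 1_{e_i}$; it is an alternating circuit if $\chi_C\ne0$; its node-weight is the sum of node-weights of visited vertices with multiplicity. For a face $F'\subseteq F$, an alternating circuit $C$ in $H$ respects $F'$ if (viewing $\chi_C$ in $\mathbb{Z}^E$) $\{e:(\chi_C)_e\ne0\}\subseteq\mathrm{supp}(F')$ and $\langle\chi_C,\mathbf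 1_{\delta(S)}\rangle=0$ for all $S\in\mathrm{tight}(F')$ that are unions of node-sets of $H$. $(F,\mathcal L)$ is $\mu$-good if $\mathcal L$ is a maximal laminar subset of $\mathrm{tight}(F)$, (i) every $S\in\mathcal L$ with $|S|\le\mu$ is $F$-contractible, and (ii) the $(F,\mathcal L,\mu)$-contraction has no alternating circuit of node-weight at most $\mu$. *)

theory Defs
  imports Complex_Main "HOL-Library.Indicator_Function"
begin

definition simple_graph :: "'v set \<Rightarrow> 'v set set \<Rightarrow> bool" where
  "simple_graph V E \<longleftrightarrow> finite V \<and> (\<forall>e\<in>E. e \<subseteq> V \<and> card e = 2)"

definition cut :: "'v set set \<Rightarrow> 'v set \<Rightarrow> 'v set set" where
  "cut E S = {e \<in> E. card (e \<inter> S) = 1}"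

definition edges_inside :: "'v set set \<Rightarrow> 'v set \<Rightarrow> 'v set set" where
  "edges_inside E S = {e \<in> E. e \<subseteq> S}"

text \<open>A vector indexed by \<^term>\<open>E\<close> is a function on all vertex sets that vanishes outside \<^term>\<open>E\<close>.\<close>

definition PM :: "'v set \<Rightarrow> 'v set set \<Rightarrow> ('v set \<Rightarrow> real) set" where
  "PM V E = {x. (\<forall>e. e \<notin> E \<longrightarrow> x e = 0) \<and>
                (\<forall>v\<in>V. (\<Sum>e\<in>cut E {v}. x e) = 1) \<and>
                (\<forall>S\<subseteq>V. odd (card S) \<longrightarrow> (\<Sum>e\<in>cut E S. x e) \<ge> 1) \<and>
                (\<forall>e\<in>E. x e \<ge> 0)}"

definition is_face :: "'v set \<Rightarrow> 'v set set \<Rightarrow> ('v set \<Rightarrow> real) set \<Rightarrow> bool" where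
  "is_face V E F \<longleftrightarrow> F \<noteq> {} \<and>
     (\<exists>A \<S>. A \<subseteq> E \<and> \<S> \<subseteq> {S. S \<subseteq> V \<and> odd (card S)} \<and>
        F = {x \<in> PM V E. (\<forall>e\<in>A. x e = 0) \<and> (\<forall>S\<in>\<S>. (\<Sum>e\<in>cut E S. x e) = 1)})"

definition perfect_matching :: "'v set \<Rightarrow> 'v set set \<Rightarrow> 'v set set \<Rightarrow> bool" where
  "perfect_matching V E M \<longleftrightarrow> M \<subseteq> E \<and> (\<forall>v\<in>V. \<exists>!e. e \<in> M \<and> v \<in> e)"

definition matching_in_face ::
  "'v set \<Rightarrow> 'v set set \<Rightarrow> ('v set \<Rightarrow> real) set \<Rightarrow> 'v set set \<Rightarrow> bool" where
  "matching_in_face V E F M \<longleftrightarrow> perfect_matching V E M \<and> indicator M \<in> F"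

definition supp :: "'v set set \<Rightarrow> ('v set \<Rightarrow> real) set \<Rightarrow> 'v set set" where
  "supp E F = {e \<in> E. \<exists>x\<in>F. x e > 0}"

definition tight :: "'v set \<Rightarrow> 'v set set \<Rightarrow> ('v set \<Rightarrow> real) set \<Rightarrow> 'v set set" where
  "tight V E F = {S. S \<subseteq> V \<and> odd (card S) \<and> (\<forall>x\<in>F. (\<Sum>e\<in>cut E S. x e) = 1)}"

definition Min_face ::
  "'v set set \<Rightarrow> ('v set \<Rightarrow> real) set \<Rightarrow> ('v set \<Rightarrow> int) \<Rightarrow> ('v set \<Rightarrow> real) set" where
  "Min_face E F w = {x. is_arg_min (\<lambda>x. \<Sum>e\<in>E. of_int (w e) * x e) (\<lambda>x. x \<in> F) x}"

definition base_weight :: "nat \<Rightarrow> ('v set \<Rightarrow> nat) \<Rightarrow> nat \<Rightarrow> 'v set \<Rightarrow> int" where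
  "base_weight n num k = (\<lambda>e. (4 * int n ^ 2 + 1) ^ num e mod int k)"

definition weights :: "nat \<Rightarrow> ('v set \<Rightarrow> nat) \<Rightarrow> ('v set \<Rightarrow> int) set" where
  "weights n num = base_weight n num ` {2..n ^ 20}"

definition weight_comp :: "nat \<Rightarrow> ('v set \<Rightarrow> int) \<Rightarrow> ('v set \<Rightarrow> int) \<Rightarrow> 'v set \<Rightarrow> int" where
  "weight_comp n w w' = (\<lambda>e. int n ^ 21 * w e + w' e)"

definition weights_pow :: "nat \<Rightarrow> ('v set \<Rightarrow> nat) \<Rightarrow> nat \<Rightarrow> ('v set \<Rightarrow> int) set" where
  "weights_pow n num k =
     {foldl (weight_comp n) w ws | w ws.
        w \<in> weights n num \<and> set ws \<subseteq> weights n num \<and> Suc (length ws) = k}"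

definition crossing :: "'v set \<Rightarrow> 'v set \<Rightarrow> bool" where
  "crossing S T \<longleftrightarrow> S \<inter> T \<noteq> {} \<and> S - T \<noteq> {} \<and> T - S \<noteq> {}"

definition laminar :: "'v set \<Rightarrow> 'v set set \<Rightarrow> bool" where
  "laminar V L \<longleftrightarrow> L \<subseteq> Pow V \<and> (\<forall>v\<in>V. {v} \<in> L) \<and> (\<forall>S\<in>L. \<forall>T\<in>L. \<not> crossing S T)"

definition maximal_laminar_subset :: "'v set \<Rightarrow> 'v set set \<Rightarrow> 'v set set \<Rightarrow> bool" where
  "maximal_laminar_subset V \<S> L \<longleftrightarrow> laminar V L \<and> L \<subseteq> \<S> \<and>
     (\<forall>S \<in> \<S> - L. \<not> laminar V (insert S L))"

definition face_laminar_pair ::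
  "'v set \<Rightarrow> 'v set set \<Rightarrow> ('v set \<Rightarrow> real) set \<Rightarrow> 'v set set \<Rightarrow> bool" where
  "face_laminar_pair V E F L \<longleftrightarrow> is_face V E F \<and> laminar V L \<and> L \<subseteq> tight V E F"

definition contractible ::
  "'v set \<Rightarrow> 'v set set \<Rightarrow> ('v set \<Rightarrow> real) set \<Rightarrow> 'v set \<Rightarrow> bool" where
  "contractible V E F S \<longleftrightarrow> S \<in> tight V E F \<and>
     (\<forall>e\<in>cut E S. \<not> (\<exists>M\<^sub>1 M\<^sub>2. matching_in_face V E F M\<^sub>1 \<and> matching_in_face V E F M\<^sub>2 \<and>
        e \<in> M\<^sub>1 \<and> e \<in> M\<^sub>2 \<and> M\<^sub>1 \<inter> edges_inside E S \<noteq> M\<^sub>2 \<inter> edges_inside E S))"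

record ('a, 'e) weighted_multigraph =
  nodes :: "'a set"
  edges :: "'e set"
  ends :: "'e \<Rightarrow> 'a set"
  node_weight :: "'a \<Rightarrow> nat"

text \<open>A cyclic walk is given by its list \<^term>\<open>es\<close> of edges and its list \<^term>\<open>vs\<close> of visited
  nodes; \<^term>\<open>es ! i\<close> joins \<^term>\<open>vs ! i\<close> to its cyclic successor.\<close>

definition cyclic_walk ::
  "('a, 'e) weighted_multigraph \<Rightarrow> 'a list \<Rightarrow> 'e list \<Rightarrow> bool" where
  "cyclic_walk H vs es \<longleftrightarrow> length vs = length es \<and> set vs \<subseteq> nodes H \<and> set es \<subseteq> edges H \<and>
     (\<forall>i<length es. ends H (es ! i) = {vs ! i, vs ! (Suc i mod length es)})"

definition alt_vec :: "'e list \<Rightarrow> 'e \<Rightarrow> int" where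
  "alt_vec es = (\<lambda>e. \<Sum>i<length es. (-1) ^ i * indicator {es ! i} e)"

definition alternating_circuit ::
  "('a, 'e) weighted_multigraph \<Rightarrow> 'a list \<Rightarrow> 'e list \<Rightarrow> bool" where
  "alternating_circuit H vs es \<longleftrightarrow>
     cyclic_walk H vs es \<and> even (length es) \<and> alt_vec es \<noteq> (\<lambda>e. 0)"

definition walk_weight :: "('a, 'e) weighted_multigraph \<Rightarrow> 'a list \<Rightarrow> nat" where
  "walk_weight H vs = (\<Sum>v\<leftarrow>vs. node_weight H v)"

definition contraction_nodes :: "'v set set \<Rightarrow> nat \<Rightarrow> 'v set set" where
  "contraction_nodes L \<mu> =
     {S \<in> L. card S \<le> \<mu> \<and> \<not> (\<exists>T\<in>L. card T \<le> \<mu> \<and> S \<subset> T)}"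

definition contraction ::
  "'v set set \<Rightarrow> ('v set \<Rightarrow> real) set \<Rightarrow> 'v set set \<Rightarrow> nat \<Rightarrow>
     ('v set, 'v set) weighted_multigraph" where
  "contraction E F L \<mu> =
     \<lparr>nodes = contraction_nodes L \<mu>,
      edges = {e \<in> supp E F - \<Union> {cut E T | T. T \<in> L \<and> card T > \<mu>}.
                 \<not> (\<exists>S\<in>contraction_nodes L \<mu>. e \<subseteq> S)},
      ends = (\<lambda>e. {S \<in> contraction_nodes L \<mu>. e \<inter> S \<noteq> {}}),
      node_weight = card\<rparr>"

definition respects_face ::
  "'v set \<Rightarrow> 'v set set \<Rightarrow> ('v set, 'v set) weighted_multigraph \<Rightarrow> ('v set \<Rightarrow> real) set \<Rightarrow>
     'v set list \<Rightarrow> bool" where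
  "respects_face V E H F' es \<longleftrightarrow>
     {e. alt_vec es e \<noteq> 0} \<subseteq> supp E F' \<and>
     (\<forall>S \<in> tight V E F'. (\<exists>\<N>\<subseteq>nodes H. S = \<Union>\<N>) \<longrightarrow>
        (\<Sum>e\<in>E. alt_vec es e * indicator (cut E S) e) = 0)"

definition good ::
  "'v set \<Rightarrow> 'v set set \<Rightarrow> nat \<Rightarrow> ('v set \<Rightarrow> real) set \<Rightarrow> 'v set set \<Rightarrow> bool" where
  "good V E \<mu> F L \<longleftrightarrow> face_laminar_pair V E F L \<and>
     maximal_laminar_subset V (tight V E F) L \<and>
     (\<forall>S\<in>L. card S \<le> \<mu> \<longrightarrow> contractible V E F S) \<and>
     \<not> (\<exists>vs es. alternating_circuit (contraction E F L \<mu>) vs es \<and>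
               walk_weight (contraction E F L \<mu>) vs \<le> \<mu>)"

end

theory Submission
  imports Defs
begin

text \<open>
  Perfect matchings lie in every face (Edmonds), so faces can be handled through their matchings, and minimising
  successively over the components of a composed weight function minimises lexicographically.

  The weight functions are residues of a single power sequence. As the least common multiple of \<open>1, \<dots>, t\<close> is at least
  \<open>2 ^ (t - 1)\<close>, some modulus up to \<open>n ^ 20\<close> gives nonzero weight to any \<open>n ^ 17\<close> prescribed small nonzero vectors.
  If there is no alternating circuit of node-weight at most \<open>l\<close>, there are few of node-weight at most \<open>2 * l\<close>: such a
  circuit is cut by at most eight edges into pieces of weight at most \<open>l / 2\<close> or single nodes, and two circuits with the
  same cutting edges have equal alternating vectors, since corresponding pieces close up to a circuit of weight at most \<open>l\<close>.

  The sets of the laminar family with size in \<open>(l, 2 * l]\<close> contained in one of them form a chain. One weight function makes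
  the interval between consecutive members of such chains contractible, because two matchings that differ there differ
  by a circuit of the contraction of weight at most \<open>2 * l\<close>. Each further weight function doubles the length of the
  contractible intervals: the matching inside an interval is determined by its edges at the two ends and in the middle.
  Once all sets of size at most \<open>2 * l\<close> are contractible, a last weight function separates the lifts of the
  circuits of the coarser contraction. By uncrossing, the lift of a respecting circuit is orthogonal to
  all tight cuts of the minimising face, so that it has weight zero, a contradiction.
\<close>

section \<open>Isolating weight functions\<close>

text \<open>The obstacle is that a circuit of a contraction says nothing about the edges inside the
  contracted nodes, whereas minimality of a weight speaks about vectors on all of \<open>E\<close>.
  A circuit is therefore completed inside the nodes by matchings, and contractibility of the nodes
  makes the result independent of the chosen matchings. Hence the contraction with parameter
  \<open>2 * l\<close> can be treated only after its nodes have become contractible. The bound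
  \<open>n ^ 17\<close> covers both families that must be isolated: circuits coded by at most eight
  darts, at most \<open>2304 * n ^ 16\<close> of them, and difference vectors coded by three sets
  and four edges, at most \<open>(n ^ 3) ^ 3 * (n ^ 2) ^ 4\<close>. The number of weight functions
  is met exactly: tight sets are odd, so a chain has at most n / 2 members, and log n - 1 doublings
  fit between the first and the last weight function. Contradictions always have the same form: a
  vector of nonzero weight that minimality forces to have weight zero.\<close>

text \<open>The numbers \<open>(n + 1) * (n choose r)\<close> are the denominators of Leibniz's
  harmonic triangle, in which 1/((n+1) C(n,r+1)) = 1/(n C(n-1,r)) - 1/((n+1) C(n,r)). Multiplied by
  \<open>Q\<close>, both terms on the right are integers by induction, hence so is their
  difference.\<close>

lemma leibniz_triangle_dvd:
  fixes Q t :: nat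
  assumes dvd: "\<And>j. 1 \<le> j \<Longrightarrow> j \<le> t \<Longrightarrow> j dvd Q"
  shows "n < t \<Longrightarrow> r \<le> n \<Longrightarrow> (n + 1) * (n choose r) dvd Q"
proof (induction r arbitrary: n)
  case 0
  then show ?case using dvd[of "n + 1"] by simp
next
  case (Suc r)
  then obtain m where m: "n = Suc m" by (cases n) auto
  define c d where "c = n choose r" and "d = n choose Suc r"
  have pos: "c > 0" "d > 0" using Suc.prems by (auto simp: c_def d_def)
  have e1: "n * (m choose r) = Suc r * d"
    using Suc_times_binomial[of r m] by (simp add: d_def m)
  have e2: "Suc r * d = (n - r) * c"
    using binomial_absorb_comp[of n r] Suc_times_binomial[of r m] by (simp add: c_def d_def m)
  have d1: "Suc r * d dvd Q" using Suc.IH[of m] Suc.prems e1 by (simp add: m)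
  have d2: "(n + 1) * c dvd Q" using Suc.IH[of n] Suc.prems by (simp add: c_def)
  obtain a b where a: "Q = Suc r * d * a" and b: "Q = (n + 1) * c * b" using d1 d2 by (metis dvdE)
  \<comment> \<open>The quotient sought is \<open>a - b\<close>. It is formed in the integers, and
    the equation is scaled by \<open>Suc r\<close> so that \<open>e2\<close> can be substituted
    without dividing.\<close>
  have "int (Suc r) * int Q = int (Suc r) * (int ((n + 1) * d) * (int a - int b))"
  proof -
    have A: "int Q = int (Suc r) * int d * int a" by (simp only: a of_nat_mult)
    have B: "int Q = (int n + 1) * int c * int b" by (subst b) (simp add: algebra_simps)
    have C: "int (Suc r) * int d = (int n - int r) * int c"
      using arg_cong[OF e2, of int] Suc.prems by (simp add: of_nat_diff algebra_simps)
    have "int (Suc r) * (int ((n + 1) * d) * (int a - int b))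
       = (int n + 1) * (int (Suc r) * int d * int a) - (int n + 1) * (int (Suc r) * int d) * int b"
      by (simp add: algebra_simps)
    also have "\<dots> = (int n + 1) * int Q - (int n + 1) * ((int n - int r) * int c) * int b"
      by (simp only: A C)
    also have "\<dots> = (int n + 1) * int Q - (int n - int r) * int Q"
      unfolding B by (simp add: algebra_simps)
    finally show ?thesis by (simp add: algebra_simps)
  qed
  then have "int Q = int ((n + 1) * d) * (int a - int b)"
    by (metis mult_left_cancel of_nat_eq_0_iff nat.distinct(1))
  then have "int ((n + 1) * d) dvd int Q" by (metis dvd_triv_left)
  then show ?case unfolding d_def using int_dvd_int_iff by blast
qed

text \<open>Row \<open>t - 1\<close> of the triangle has \<open>t\<close> entries with sum
  \<open>t * 2 ^ (t - 1)\<close>, and each of them divides \<open>Q\<close>, so it is at most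
  \<open>Q\<close>.\<close>

lemma common_multiple_ge_power_two:
  fixes Q t :: nat
  assumes "\<And>j. 1 \<le> j \<Longrightarrow> j \<le> t \<Longrightarrow> j dvd Q" "Q > 0" "t \<ge> 1"
  shows "2 ^ (t - 1) \<le> Q"
proof -
  obtain n where n: "t = Suc n" using assms by (cases t) auto
  have "(n + 1) * (n choose r) \<le> Q" if "r \<le> n" for r
    using leibniz_triangle_dvd[of t Q n r] assms that n by (auto intro: dvd_imp_le)
  then have "(\<Sum>r\<le>n. (n + 1) * (n choose r)) \<le> (\<Sum>r\<le>n. Q)" by (intro sum_mono) auto
  then have "(n + 1) * 2 ^ n \<le> (n + 1) * Q" by (simp only: sum_distrib_left[symmetric] choose_row_sum sum_constant card_atMost) simp
  then show ?thesis using n by (simp only: mult_le_cancel1) simp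
qed

text \<open>The square matters: it says that \<open>4 * n ^ 2 + 1\<close> is at most two to the
  power n / 2, and the isolating argument relies on this half in the exponent. From 64 on, one step
  enlarges the left side by a factor of at most 49/25, which is below two.\<close>

lemma square_quadratic_le_power_two:
  fixes n :: nat
  assumes "64 \<le> n"
  shows "(4 * n ^ 2 + 1) ^ 2 \<le> 2 ^ n"
  using assms
proof (induction n rule: dec_induct)
  case base
  show ?case by simp
next
  case (step n)
  have "64 * n \<le> n * n" using step by (intro mult_le_mono1)
  then have "40 * n + 18 \<le> 8 * (n * n)" using step by linarith
  then have "5 * (4 * Suc n ^ 2 + 1) \<le> 7 * (4 * n ^ 2 + 1)"
    by (simp add: power2_eq_square)
  then have "(5 * (4 * Suc n ^ 2 + 1)) ^ 2 \<le> (7 * (4 * n ^ 2 + 1)) ^ 2" by (rule power_mono) simp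
  then have "25 * (4 * Suc n ^ 2 + 1) ^ 2 \<le> 49 * (4 * n ^ 2 + 1) ^ 2"
    unfolding power_mult_distrib by simp
  then show ?case using step by simp
qed

text \<open>Among the coordinates with \<open>y e \<noteq> 0\<close> consider the one with the
  smallest exponent: all other terms are divisible by the next power of \<open>B\<close>, so a
  vanishing sum would make \<open>B\<close> divide a nonzero number of absolute value below
  \<open>B\<close>.\<close>

lemma sum_powers_nonzero:
  fixes y :: "'a \<Rightarrow> int" and B :: int
  assumes "finite E" "inj_on num E" "\<exists>e\<in>E. y e \<noteq> 0" "\<And>e. e \<in> E \<Longrightarrow> \<bar>y e\<bar> < B"
  shows "(\<Sum>e\<in>E. B ^ num e * y e) \<noteq> 0"
proof
  assume z: "(\<Sum>e\<in>E. B ^ num e * y e) = 0"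
  obtain e where e: "e \<in> E" "y e \<noteq> 0" and least: "\<And>f. f \<in> E \<Longrightarrow> y f \<noteq> 0 \<Longrightarrow> num e \<le> num f"
    using exists_least_iff[of "\<lambda>k. \<exists>e\<in>E. y e \<noteq> 0 \<and> num e = k"] assms(3) by (metis not_le)
  have B: "B > 0" using assms(4)[OF e(1)] by linarith
  have "B ^ Suc (num e) dvd (\<Sum>f\<in>E - {e}. B ^ num f * y f)"
  proof (rule dvd_sum)
    fix f assume f: "f \<in> E - {e}"
    show "B ^ Suc (num e) dvd B ^ num f * y f"
    proof (cases "y f = 0")
      case False
      then have "num e < num f" using least[of f] f e assms(2)
        by (metis Diff_iff inj_onD insertI1 le_neq_implies_less)
      then show ?thesis by (meson Suc_leI dvd_mult2 le_imp_power_dvd)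
    qed simp
  qed
  moreover have "(\<Sum>f\<in>E - {e}. B ^ num f * y f) = - (B ^ num e * y e)"
    using z sum.remove[OF assms(1) e(1), of "\<lambda>e. B ^ num e * y e"] by simp
  ultimately have "B ^ num e * B dvd B ^ num e * y e" by (simp add: mult.commute)
  then have "B dvd y e" using B by simp
  then show False using assms(4)[OF e(1)] e(2) zdvd_not_zless by (metis abs_dvd_iff dvd_abs_iff zero_less_abs_iff)
qed

text \<open>Weights are powers of \<open>B\<close> reduced modulo \<open>k\<close>, so
  \<open>y\<close> gets weight zero only if \<open>k\<close> divides the unreduced weight
  \<open>q y\<close>. The product \<open>Q\<close> of the absolute values of all \<open>q y\<close>
  is positive and below \<open>2 ^ (n ^ 20 - 1)\<close>, hence no common multiple of the numbers up
  to \<open>n ^ 20\<close>. A \<open>k\<close> that does not divide \<open>Q\<close> works for every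
  \<open>y\<close> at once.\<close>

lemma exists_isolating_weight:
  fixes Y :: "('v set \<Rightarrow> int) set"
  assumes n: "64 \<le> n" and E: "finite E" "card E \<le> n ^ 2" and num: "bij_betw num E {1..card E}"
    and Y: "finite Y" "card Y \<le> n ^ 17"
    and nz: "\<And>y. y \<in> Y \<Longrightarrow> \<exists>e\<in>E. y e \<noteq> 0"
    and bd: "\<And>y e. y \<in> Y \<Longrightarrow> e \<in> E \<Longrightarrow> \<bar>y e\<bar> \<le> 4 * int n ^ 2"
  shows "\<exists>w\<in>weights n num. \<forall>y\<in>Y. (\<Sum>e\<in>E. w e * y e) \<noteq> 0"
proof -
  define B where "B = 4 * n ^ 2 + 1"
  define q where "q y = (\<Sum>e\<in>E. int B ^ num e * y e)" for y :: "'v set \<Rightarrow> int"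
  have Bge: "B \<ge> 1" by (simp add: B_def)
  have q0: "q y \<noteq> 0" if "y \<in> Y" for y
    unfolding q_def
  proof (rule sum_powers_nonzero)
    show "\<bar>y e\<bar> < int B" if "e \<in> E" for e
      using bd[OF \<open>y \<in> Y\<close> that] by (simp add: B_def)
  qed (use E num nz[OF that] in \<open>auto simp: bij_betw_def\<close>)
  have qb: "nat \<bar>q y\<bar> \<le> B ^ (n ^ 2 + 2)" if y: "y \<in> Y" for y
  proof -
    have "\<bar>q y\<bar> \<le> (\<Sum>e\<in>E. \<bar>int B ^ num e * y e\<bar>)" unfolding q_def by (rule sum_abs)
    also have "\<dots> \<le> (\<Sum>e\<in>E. int B ^ (n ^ 2) * int B)"
    proof (rule sum_mono)
      fix e assume e: "e \<in> E"
      have "num e \<in> {1..card E}" using num e bij_betwE by blast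
      then have "num e \<le> n ^ 2" using E by simp
      then have "int B ^ num e \<le> int B ^ (n ^ 2)" using Bge by (intro power_increasing) auto
      moreover have "\<bar>y e\<bar> \<le> int B" using bd[OF y e] by (simp add: B_def)
      ultimately show "\<bar>int B ^ num e * y e\<bar> \<le> int B ^ (n ^ 2) * int B"
        unfolding abs_mult by (intro mult_mono) auto
    qed
    also have "\<dots> = int (card E) * (int B ^ (n ^ 2) * int B)" by simp
    also have "\<dots> \<le> int B * (int B ^ (n ^ 2) * int B)"
    proof (rule mult_right_mono)
      have "card E \<le> B" using E by (simp add: B_def)
      then show "int (card E) \<le> int B" by simp
    qed simp
    also have "\<dots> = int (B ^ (n ^ 2 + 2))" by (simp add: power2_eq_square power_add algebra_simps)
    finally show ?thesis by linarith
  qed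
  define Q where "Q = (\<Prod>y\<in>Y. nat \<bar>q y\<bar>)"
  have Qpos: "Q > 0" unfolding Q_def using q0 by (intro prod_pos) auto
  have "Q \<le> (\<Prod>y\<in>Y. B ^ (n ^ 2 + 2))" unfolding Q_def using qb by (intro prod_mono) auto
  also have "\<dots> = B ^ ((n ^ 2 + 2) * card Y)" by (simp only: prod_constant power_mult)
  also have "\<dots> \<le> B ^ ((n ^ 2 + 2) * n ^ 17)" using Y Bge by (intro power_increasing mult_le_mono2) auto
  finally have QB: "Q \<le> B ^ ((n ^ 2 + 2) * n ^ 17)" .
  have small: "Q < 2 ^ (n ^ 20 - 1)"
  proof -
    \<comment> \<open>Comparing squares avoids logarithms: \<open>B ^ 2 \<le> 2 ^ n\<close> turns
      the exponent into \<open>n ^ 20 + 2 * n ^ 18\<close>, which has to stay below twice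
      \<open>n ^ 20 - 1\<close>.\<close>
    have "Q ^ 2 \<le> (B ^ ((n ^ 2 + 2) * n ^ 17)) ^ 2" using QB by (rule power_mono) simp
    also have "\<dots> = (B ^ 2) ^ ((n ^ 2 + 2) * n ^ 17)" by (simp add: power_mult[symmetric] mult.commute)
    also have "\<dots> \<le> (2 ^ n) ^ ((n ^ 2 + 2) * n ^ 17)"
      using square_quadratic_le_power_two[OF n] by (intro power_mono) (auto simp: B_def)
    also have "\<dots> = 2 ^ (n ^ 20 + 2 * n ^ 18)"
      by (simp add: algebra_simps flip: power_mult power_add power_Suc)
    also have "\<dots> < 2 ^ (2 * (n ^ 20 - 1))"
    proof (rule power_strict_increasing)
      have "64 ^ 2 * n ^ 18 \<le> n ^ 2 * n ^ 18" using n by (intro mult_right_mono power_mono) auto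
      then have "4096 * n ^ 18 \<le> n ^ 20" by (simp add: power_add[symmetric])
      moreover have "n ^ 18 \<ge> 1" using n by simp
      ultimately show "n ^ 20 + 2 * n ^ 18 < 2 * (n ^ 20 - 1)" by linarith
    qed simp
    also have "\<dots> = (2 ^ (n ^ 20 - 1)) ^ 2" by (simp add: power_mult[symmetric] mult.commute)
    finally show ?thesis by (rule power_less_imp_less_base) simp
  qed
  have "\<exists>k. 1 \<le> k \<and> k \<le> n ^ 20 \<and> \<not> k dvd Q"
    using common_multiple_ge_power_two[of "n ^ 20" Q] Qpos small n by (force simp: not_le)
  then obtain k where k: "1 \<le> k" "k \<le> n ^ 20" "\<not> k dvd Q" by blast
  \<comment> \<open>The admissible moduli start at two; \<open>k = 1\<close> is excluded because one
    divides \<open>Q\<close>.\<close>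
  then have k2: "k \<ge> 2" by (cases "k = 1") auto
  have "(\<Sum>e\<in>E. base_weight n num k e * y e) \<noteq> 0" if y: "y \<in> Y" for y
  proof
    assume "(\<Sum>e\<in>E. base_weight n num k e * y e) = 0"
    moreover have "(\<Sum>e\<in>E. base_weight n num k e * y e) mod int k = q y mod int k"
    proof -
      have "(\<Sum>e\<in>E. base_weight n num k e * y e) mod int k = (\<Sum>e\<in>E. base_weight n num k e * y e mod int k) mod int k"
        by (simp add: mod_sum_eq)
      also have "\<dots> = (\<Sum>e\<in>E. int B ^ num e * y e mod int k) mod int k"
        by (simp add: base_weight_def mod_mult_left_eq B_def add.commute)
      finally show ?thesis by (simp add: q_def mod_sum_eq)
    qed
    ultimately have "int k dvd q y" by (simp add: dvd_eq_mod_eq_0)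
    then have "k dvd nat \<bar>q y\<bar>" using int_dvd_int_iff[of k "nat \<bar>q y\<bar>"] by simp
    then have "k dvd Q" unfolding Q_def using Y y by (meson dvd_prodI dvd_trans)
    then show False using k by simp
  qed
  moreover have "base_weight n num k \<in> weights n num" using k k2 by (auto simp: weights_def)
  ultimately show ?thesis by blast
qed

section \<open>Cuts and the perfect matching polytope\<close>

lemma simple_graph_finite:
  assumes "simple_graph V E"
  shows "finite V" "finite E"
proof -
  show "finite V" using assms by (simp add: simple_graph_def)
  moreover have "E \<subseteq> Pow V" using assms by (auto simp: simple_graph_def)
  ultimately show "finite E" using finite_subset by blast
qed

lemma simple_graph_edge:
  assumes "simple_graph V E" "e \<in> E"
  obtains a b where "e = {a, b}" "a \<noteq> b" "a \<in> V" "b \<in> V"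
proof -
  have "card e = 2" "e \<subseteq> V" using assms by (auto simp: simple_graph_def)
  then show ?thesis using that by (auto simp: card_2_iff)
qed

lemma cut_subset: "cut E S \<subseteq> E"
  by (auto simp: cut_def)

lemma finite_cut [simp]: "finite E \<Longrightarrow> finite (cut E S)"
  using cut_subset finite_subset by blast

lemma pair_mem_cut:
  assumes "a \<noteq> b"
  shows "{a, b} \<in> cut E S \<longleftrightarrow> {a, b} \<in> E \<and> (a \<in> S) \<noteq> (b \<in> S)"
proof -
  have "{a, b} \<inter> S = (if a \<in> S then {a} else {}) \<union> (if b \<in> S then {b} else {})" by auto
  then show ?thesis using assms by (auto simp: cut_def)
qed

lemma cut_edge:
  assumes G: "simple_graph V E" and e: "e \<in> cut E S"
  obtains a b where "e = {a, b}" "a \<noteq> b" "a \<in> S" "b \<notin> S" "a \<in> V" "b \<in> V"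
proof -
  have "e \<in> E" using e cut_subset by blast
  then obtain a b where ab: "e = {a, b}" "a \<noteq> b" "a \<in> V" "b \<in> V" using simple_graph_edge[OF G] by metis
  then have "a \<in> S \<and> b \<notin> S \<or> b \<in> S \<and> a \<notin> S" using e by (auto simp: pair_mem_cut)
  then show ?thesis using that[of a b] that[of b a] ab by (auto simp: insert_commute)
qed

lemma mem_cut_singleton:
  assumes "simple_graph V E"
  shows "e \<in> cut E {v} \<longleftrightarrow> e \<in> E \<and> v \<in> e"
proof (cases "e \<in> E")
  case True
  then obtain a b where "e = {a, b}" "a \<noteq> b" using simple_graph_edge[OF assms] by metis
  then show ?thesis by (auto simp: pair_mem_cut)
qed (auto simp: cut_def)

lemma cut_empty [simp]: "cut E {} = {}"
  by (auto simp: cut_def)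

lemma cut_complement:
  assumes "simple_graph V E"
  shows "cut E (V - S) = cut E S"
proof (rule set_eqI)
  fix e
  show "e \<in> cut E (V - S) \<longleftrightarrow> e \<in> cut E S"
  proof (cases "e \<in> E")
    case True
    then obtain a b where "e = {a, b}" "a \<noteq> b" "a \<in> V" "b \<in> V" using simple_graph_edge[OF assms] by metis
    then show ?thesis by (auto simp: pair_mem_cut)
  qed (auto simp: cut_def)
qed

lemma sum_cut_restrict:
  fixes x :: "'v set \<Rightarrow> 'a::comm_ring_1"
  assumes "finite E"
  shows "(\<Sum>e\<in>cut E S. x e) = (\<Sum>e\<in>E. if e \<in> cut E S then x e else 0)"
proof -
  have "{e \<in> E. e \<in> cut E S} = cut E S" using cut_subset by blast
  then show ?thesis using sum.inter_filter[OF assms, of x "\<lambda>e. e \<in> cut E S"] by simp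
qed

text \<open>Edges between \<open>S - T\<close> and \<open>T - S\<close> are counted in both cuts on
  the left and in none on the right; making this term explicit turns submodularity into an identity.
  It is stated over a commutative ring because it is applied to real points of the polytope and to
  integer vectors.\<close>

lemma sum_cut_uncross:
  fixes x :: "'v set \<Rightarrow> 'a::comm_ring_1"
  assumes G: "simple_graph V E"
  shows "(\<Sum>e\<in>cut E S. x e) + (\<Sum>e\<in>cut E T. x e) =
    (\<Sum>e\<in>cut E (S \<inter> T). x e) + (\<Sum>e\<in>cut E (S \<union> T). x e)
      + 2 * (\<Sum>e\<in>{e \<in> E. e \<inter> (S - T) \<noteq> {} \<and> e \<inter> (T - S) \<noteq> {}}. x e)"
proof -
  note fin = simple_graph_finite(2)[OF G]
  let ?b = "\<lambda>e. e \<inter> (S - T) \<noteq> {} \<and> e \<inter> (T - S) \<noteq> {}"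
  have "(\<Sum>e\<in>E. (if e \<in> cut E S then x e else 0) + (if e \<in> cut E T then x e else 0)) =
    (\<Sum>e\<in>E. (if e \<in> cut E (S \<inter> T) then x e else 0) + (if e \<in> cut E (S \<union> T) then x e else 0)
      + 2 * (if ?b e then x e else 0))"
  proof (rule sum.cong[OF refl])
    fix e assume "e \<in> E"
    then obtain a b where e: "e = {a, b}" "a \<noteq> b" "{a, b} \<in> E" using simple_graph_edge[OF G] by metis
    show "(if e \<in> cut E S then x e else 0) + (if e \<in> cut E T then x e else 0) =
      (if e \<in> cut E (S \<inter> T) then x e else 0) + (if e \<in> cut E (S \<union> T) then x e else 0)
      + 2 * (if ?b e then x e else 0)"
      unfolding e(1) pair_mem_cut[OF e(2)]
      using e by (cases "a \<in> S"; cases "b \<in> S"; cases "a \<in> T"; cases "b \<in> T") auto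
  qed
  then show ?thesis
    using fin by (simp add: sum_cut_restrict sum.distrib sum_distrib_left[symmetric] sum.inter_filter)
qed

lemma PM_outside: "x \<in> PM V E \<Longrightarrow> e \<notin> E \<Longrightarrow> x e = 0"
  by (simp add: PM_def)

lemma PM_degree: "x \<in> PM V E \<Longrightarrow> v \<in> V \<Longrightarrow> (\<Sum>e\<in>cut E {v}. x e) = 1"
  by (simp add: PM_def)

lemma PM_odd_cut: "x \<in> PM V E \<Longrightarrow> S \<subseteq> V \<Longrightarrow> odd (card S) \<Longrightarrow> 1 \<le> (\<Sum>e\<in>cut E S. x e)"
  by (simp add: PM_def)

lemma PM_nonneg: "x \<in> PM V E \<Longrightarrow> 0 \<le> x e"
  by (cases "e \<in> E") (auto simp: PM_def)

lemma PM_le_one: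
  assumes "simple_graph V E" "x \<in> PM V E"
  shows "x e \<le> 1"
proof (cases "e \<in> E")
  case True
  then obtain a b where e: "e = {a, b}" "a \<noteq> b" "a \<in> V" using simple_graph_edge[OF assms(1)] by metis
  have "x e \<le> (\<Sum>e\<in>cut E {a}. x e)"
    using e True simple_graph_finite[OF assms(1)] PM_nonneg[OF assms(2)]
    by (intro member_le_sum) (auto simp: pair_mem_cut)
  then show ?thesis using PM_degree[OF assms(2) e(3)] by simp
qed (use PM_outside[OF assms(2)] in auto)

text \<open>\<open>V\<close> has an empty cut, which would violate the odd-set constraint. Evenness
  of \<open>V\<close> is what makes complements of odd sets odd.\<close>

lemma PM_even_card:
  assumes "simple_graph V E" "x \<in> PM V E"
  shows "even (card V)"
proof (rule ccontr)
  assume "odd (card V)"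
  moreover have "cut E V = {}" using cut_complement[OF assms(1), of V] by simp
  ultimately show False using PM_odd_cut[OF assms(2), of V] by simp
qed

lemma PM_odd_complement:
  assumes G: "simple_graph V E" and x: "x \<in> PM V E" and S: "S \<subseteq> V" "odd (card S)"
  shows "odd (card (V - S))"
proof -
  have "card (V - S) + card S = card V"
    using S(1) simple_graph_finite(1)[OF G]
    by (metis add.commute card_Diff_subset card_mono finite_subset le_add_diff_inverse)
  then show ?thesis using S(2) PM_even_card[OF G x] by (metis even_add)
qed

text \<open>Used in the converse direction: a nonzero vector that preserves degrees has a negative
  coordinate, so moving along it must eventually leave the polytope.\<close>

lemma nonneg_direction_zero:
  assumes G: "simple_graph V E" and d0: "\<And>e. e \<notin> E \<Longrightarrow> d e = (0::real)"
    and dv: "\<And>v. v \<in> V \<Longrightarrow> (\<Sum>e\<in>cut E {v}. d e) = 0" and nn: "\<And>e. 0 \<le> d e"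
  shows "d e = 0"
proof (cases "e \<in> E")
  case True
  then obtain a b where ab: "e = {a, b}" "a \<in> V" using simple_graph_edge[OF G] by metis
  have "d e \<le> (\<Sum>e\<in>cut E {a}. d e)"
    using nn simple_graph_finite[OF G] ab True by (intro member_le_sum) (auto simp: mem_cut_singleton[OF G])
  then show ?thesis using dv[OF ab(2)] nn[of e] by simp
qed (rule d0)

text \<open>Both cuts on the right of the uncrossing identity belong to odd sets and have value at
  least one, while the left side is two. So both are one, and the edges between the two differences
  carry nothing.\<close>

lemma PM_uncross:
  assumes G: "simple_graph V E" and x: "x \<in> PM V E" and S: "S \<subseteq> V" "odd (card S)" "(\<Sum>e\<in>cut E S. x e) = 1"
    and T: "T \<subseteq> V" "odd (card T)" "(\<Sum>e\<in>cut E T. x e) = 1" and odd: "odd (card (S \<inter> T))"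
  shows "odd (card (S \<union> T))" "(\<Sum>e\<in>cut E (S \<inter> T). x e) = 1" "(\<Sum>e\<in>cut E (S \<union> T). x e) = 1"
    "\<And>e. e \<inter> (S - T) \<noteq> {} \<Longrightarrow> e \<inter> (T - S) \<noteq> {} \<Longrightarrow> x e = 0"
proof -
  note fin = simple_graph_finite[OF G]
  have "finite S" "finite T" using S T fin finite_subset by auto
  then have "card S + card T = card (S \<union> T) + card (S \<inter> T)" by (rule card_Un_Int)
  then have "even (card (S \<union> T) + card (S \<inter> T))" using S(2) T(2) by (metis odd_even_add)
  then show ou: "odd (card (S \<union> T))" using odd by simp
  let ?B = "{e \<in> E. e \<inter> (S - T) \<noteq> {} \<and> e \<inter> (T - S) \<noteq> {}}"
  have i: "1 \<le> (\<Sum>e\<in>cut E (S \<inter> T). x e)" using odd S by (intro PM_odd_cut[OF x]) auto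
  have u: "1 \<le> (\<Sum>e\<in>cut E (S \<union> T). x e)" using ou S T by (intro PM_odd_cut[OF x]) auto
  have b: "0 \<le> (\<Sum>e\<in>?B. x e)" using PM_nonneg[OF x] by (intro sum_nonneg) auto
  note eq = sum_cut_uncross[OF G, of x S T]
  show "(\<Sum>e\<in>cut E (S \<inter> T). x e) = 1" "(\<Sum>e\<in>cut E (S \<union> T). x e) = 1" using i u b eq S T by linarith+
  have "(\<Sum>e\<in>?B. x e) = 0" using i u b eq S T by linarith
  then have "\<forall>e\<in>?B. x e = 0" using fin PM_nonneg[OF x] by (subst (asm) sum_nonneg_eq_0_iff) auto
  then show "x e = 0" if "e \<inter> (S - T) \<noteq> {}" "e \<inter> (T - S) \<noteq> {}" for e
    using that PM_outside[OF x] by blast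
qed

text \<open>The matchings in the smallest face of the polytope that contains \<open>x\<close>.\<close>

definition in_min_face :: "'v set \<Rightarrow> 'v set set \<Rightarrow> ('v set \<Rightarrow> real) \<Rightarrow> 'v set set \<Rightarrow> bool" where
  "in_min_face V E x M \<longleftrightarrow> perfect_matching V E M \<and> (\<forall>e\<in>M. x e > 0) \<and>
     (\<forall>S\<subseteq>V. odd (card S) \<longrightarrow> (\<Sum>e\<in>cut E S. x e) = 1 \<longrightarrow> (\<Sum>e\<in>cut E S. indicator M e) = (1::real))"

section \<open>Slack constraints and moves inside the smallest face of a point\<close>

definition odd_sets :: "'v set \<Rightarrow> 'v set set" where
  "odd_sets V = {S. S \<subseteq> V \<and> odd (card S)}"

definition slack :: "'v set set \<Rightarrow> ('v set \<Rightarrow> real) \<Rightarrow> 'v set + 'v set \<Rightarrow> real" where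
  "slack E x = case_sum x (\<lambda>S. (\<Sum>e\<in>cut E S. x e) - 1)"

text \<open>Counts the inequalities that \<open>x\<close> satisfies strictly, nonnegativity in the
  left and odd sets in the right summand. As an induction measure it replaces the dimension of the
  smallest face containing \<open>x\<close>.\<close>

definition num_slack :: "'v set \<Rightarrow> 'v set set \<Rightarrow> ('v set \<Rightarrow> real) \<Rightarrow> nat" where
  "num_slack V E x = card {i \<in> E <+> odd_sets V. slack E x i \<noteq> 0}"

lemma finite_odd_sets: "finite V \<Longrightarrow> finite (odd_sets V)"
  by (rule finite_subset[of _ "Pow V"]) (auto simp: odd_sets_def)

text \<open>The ratio test of linear programming: \<open>t\<close> is the least ratio at which a
  decreasing constraint reaches zero. It is positive because constraints that are already tight do
  not change.\<close>

lemma exists_max_step: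
  fixes s c :: "'i \<Rightarrow> real"
  assumes "finite I" "\<And>i. i \<in> I \<Longrightarrow> s i \<ge> 0" "\<And>i. i \<in> I \<Longrightarrow> s i = 0 \<Longrightarrow> c i = 0" "\<exists>i\<in>I. c i < 0"
  obtains t i where "t > 0" "\<And>i. i \<in> I \<Longrightarrow> s i + t * c i \<ge> 0" "i \<in> I" "s i \<noteq> 0" "s i + t * c i = 0"
proof -
  define R where "R = (\<lambda>i. s i / - c i) ` {i \<in> I. c i < 0}"
  have R: "finite R" "R \<noteq> {}" using assms by (auto simp: R_def)
  define t where "t = Min R"
  have "t \<in> R" using R by (simp add: t_def)
  then obtain i where i: "i \<in> I" "c i < 0" "t = s i / - c i" by (auto simp: R_def)
  have si: "s i > 0" using assms(2,3)[OF i(1)] i(2) by fastforce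
  have tpos: "t > 0" unfolding i(3) using si i(2) by (intro divide_pos_pos) auto
  have "s j + t * c j \<ge> 0" if j: "j \<in> I" for j
  proof (cases "c j < 0")
    case True
    then have "t \<le> s j / - c j" unfolding t_def using R j by (intro Min_le) (auto simp: R_def)
    then show ?thesis using True by (simp add: field_simps)
  next
    case False
    then show ?thesis using assms(2)[OF j] tpos by simp
  qed
  moreover have "s i + t * c i = 0" using i by simp
  ultimately show ?thesis using that[of t i] tpos i si by simp
qed

text \<open>The vector \<open>d\<close> is a direction inside the smallest face of \<open>x\<close>,
  as it preserves every constraint that is tight at \<open>x\<close>. Going as far as the polytope
  allows makes a further constraint tight. The new point thus lies in a smaller face, whose
  matchings belong to the smallest face of \<open>x\<close> too.\<close>

lemma PM_move:
  assumes G: "simple_graph V E" and x: "x \<in> PM V E"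
    and d0: "\<And>e. e \<notin> E \<Longrightarrow> d e = 0"
    and dv: "\<And>v. v \<in> V \<Longrightarrow> (\<Sum>e\<in>cut E {v}. d e) = 0"
    and dz: "\<And>e. x e = 0 \<Longrightarrow> d e = 0"
    and dt: "\<And>S. S \<subseteq> V \<Longrightarrow> odd (card S) \<Longrightarrow> (\<Sum>e\<in>cut E S. x e) = 1 \<Longrightarrow> (\<Sum>e\<in>cut E S. d e) = 0"
    and neg: "\<exists>e. d e < 0"
  obtains t where "t > 0" "(\<lambda>e. x e + t * d e) \<in> PM V E"
    "num_slack V E (\<lambda>e. x e + t * d e) < num_slack V E x"
    "\<And>M. in_min_face V E (\<lambda>e. x e + t * d e) M \<Longrightarrow> in_min_face V E x M"
proof -
  note fin = simple_graph_finite[OF G]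
  define c where "c = case_sum d (\<lambda>S. \<Sum>e\<in>cut E S. d e)"
  let ?I = "E <+> odd_sets V"
  have finI: "finite ?I" using fin by (intro finite_Plus finite_odd_sets)
  have s0: "slack E x i \<ge> 0" if "i \<in> ?I" for i
    using that PM_nonneg[OF x] PM_odd_cut[OF x] by (auto simp: slack_def odd_sets_def)
  have c0: "c i = 0" if "i \<in> ?I" "slack E x i = 0" for i
    using that dz dt by (auto simp: slack_def c_def odd_sets_def)
  have ng: "\<exists>i\<in>?I. c i < 0"
  proof -
    obtain e where "d e < 0" using neg by blast
    then have "d e < 0" "e \<in> E" using d0[of e] by force+
    then show ?thesis by (intro bexI[of _ "Inl e"]) (auto simp: c_def)
  qed
  obtain t i where t: "t > 0" "\<And>i. i \<in> ?I \<Longrightarrow> slack E x i + t * c i \<ge> 0"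
    and i: "i \<in> ?I" "slack E x i \<noteq> 0" "slack E x i + t * c i = 0"
    using exists_max_step[of ?I "slack E x" c] finI s0 c0 ng by (metis (no_types, lifting))
  let ?y = "\<lambda>e. x e + t * d e"
  have sum: "(\<Sum>e\<in>cut E S. ?y e) = (\<Sum>e\<in>cut E S. x e) + t * (\<Sum>e\<in>cut E S. d e)" for S
    by (simp add: sum.distrib sum_distrib_left)
  have sl: "slack E ?y i = slack E x i + t * c i" for i
    by (cases i) (auto simp: slack_def c_def sum)
  have ypm: "?y \<in> PM V E"
    unfolding PM_def
  proof (intro CollectI conjI allI ballI impI)
    show "?y e = 0" if "e \<notin> E" for e using that PM_outside[OF x] d0 by simp
    show "(\<Sum>e\<in>cut E {v}. ?y e) = 1" if "v \<in> V" for v using that PM_degree[OF x] dv unfolding sum by simp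
    show "1 \<le> (\<Sum>e\<in>cut E S. ?y e)" if "S \<subseteq> V" "odd (card S)" for S
      using t(2)[of "Inr S"] that unfolding sl[symmetric] by (auto simp: slack_def odd_sets_def)
    show "0 \<le> ?y e" if "e \<in> E" for e
      using t(2)[of "Inl e"] that unfolding sl[symmetric] by (auto simp: slack_def)
  qed
  have less: "num_slack V E ?y < num_slack V E x"
    unfolding num_slack_def
  proof (rule psubset_card_mono)
    show "finite {i \<in> ?I. slack E x i \<noteq> 0}" using finI by simp
    have "{i \<in> ?I. slack E ?y i \<noteq> 0} \<subseteq> {i \<in> ?I. slack E x i \<noteq> 0}"
    proof (rule subsetI)
      fix j assume "j \<in> {i \<in> ?I. slack E ?y i \<noteq> 0}"
      then show "j \<in> {i \<in> ?I. slack E x i \<noteq> 0}" using c0[of j] sl[of j] by auto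
    qed
    moreover have "i \<in> {i \<in> ?I. slack E x i \<noteq> 0}" "i \<notin> {i \<in> ?I. slack E ?y i \<noteq> 0}" using i sl by auto
    ultimately show "{i \<in> ?I. slack E ?y i \<noteq> 0} \<subset> {i \<in> ?I. slack E x i \<noteq> 0}" by blast
  qed
  have "in_min_face V E x M" if M: "in_min_face V E ?y M" for M
    unfolding in_min_face_def
  proof (intro conjI ballI allI impI)
    show "perfect_matching V E M" using M by (simp add: in_min_face_def)
    show "0 < x e" if "e \<in> M" for e
    proof -
      have "?y e > 0" using M that by (auto simp: in_min_face_def)
      then have "x e \<noteq> 0" using dz by fastforce
      then show ?thesis using PM_nonneg[OF x, of e] by simp
    qed
    show "(\<Sum>e\<in>cut E S. indicator M e) = (1::real)"
      if "S \<subseteq> V" "odd (card S)" "(\<Sum>e\<in>cut E S. x e) = 1" for S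
    proof -
      have "(\<Sum>e\<in>cut E S. ?y e) = 1" using that dt unfolding sum by simp
      then show ?thesis using M that by (simp add: in_min_face_def)
    qed
  qed
  then show ?thesis using that[OF t(1) ypm less] by blast
qed

section \<open>Degree-preserving directions on the fractional edges\<close>

text \<open>Gaussian elimination for a homogeneous system with more unknowns than equations: an
  equation with a nonzero coefficient at \<open>k\<close> is solved for coordinate \<open>k\<close>
  and substituted into the others.\<close>

lemma exists_kernel_vector:
  fixes a :: "'i \<Rightarrow> 'j \<Rightarrow> real"
  assumes "finite W" "finite J" "card W < card J"
  shows "\<exists>d. (\<forall>j. j \<notin> J \<longrightarrow> d j = 0) \<and> (\<exists>j. d j \<noteq> 0) \<and> (\<forall>v\<in>W. (\<Sum>j\<in>J. a v j * d j) = 0)"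
  using assms
proof (induction W arbitrary: a J rule: finite_induct)
  case empty
  then obtain j where "j \<in> J" by fastforce
  then show ?case by (intro exI[of _ "indicator {j}"]) (auto simp: indicator_def)
next
  case (insert v W)
  show ?case
  proof (cases "\<forall>j\<in>J. a v j = 0")
    case True
    have "card W < card J" using insert by simp
    from insert.IH[OF insert.prems(1) this, of a] show ?thesis using True by auto
  next
    case False
    then obtain k where k: "k \<in> J" "a v k \<noteq> 0" by blast
    \<comment> \<open>The coefficients of row \<open>u\<close> after eliminating coordinate
      \<open>k\<close> with the help of row \<open>v\<close>.\<close>
    define b where "b u j = a u j - a u k * a v j / a v k" for u j
    have "card W < card (J - {k})" using insert k by simp
    from insert.IH[OF _ this, of b] insert.prems(1) obtain d where
      d: "\<And>j. j \<notin> J - {k} \<Longrightarrow> d j = 0" "\<exists>j. d j \<noteq> 0" "\<And>u. u \<in> W \<Longrightarrow> (\<Sum>j\<in>J - {k}. b u j * d j) = 0"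
      by auto
    define r where "r = - (\<Sum>j\<in>J - {k}. a v j * d j) / a v k"
    define d' where "d' = d(k := r)"
    have eq: "(\<Sum>j\<in>J. a u j * d' j) = (\<Sum>j\<in>J - {k}. a u j * d j) + a u k * r" for u
      using sum.remove[OF insert.prems(1) k(1), of "\<lambda>j. a u j * d' j"] by (simp add: d'_def)
    have "(\<Sum>j\<in>J. a u j * d' j) = 0" if "u \<in> insert v W" for u
    proof (cases "u = v")
      case True
      then show ?thesis unfolding eq using k by (simp add: r_def)
    next
      case False
      have "(\<Sum>j\<in>J - {k}. b u j * d j) = (\<Sum>j\<in>J - {k}. a u j * d j) - (\<Sum>j\<in>J - {k}. a u k / a v k * (a v j * d j))"
        unfolding sum_subtractf[symmetric] by (rule sum.cong) (auto simp: b_def algebra_simps)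
      also have "\<dots> = (\<Sum>j\<in>J - {k}. a u j * d j) + a u k * r"
        unfolding sum_distrib_left[symmetric] by (simp add: r_def)
      finally show ?thesis using d(3)[of u] that False eq by simp
    qed
    moreover have "d' j = 0" if "j \<notin> J" for j using that d(1) k by (auto simp: d'_def)
    moreover have "\<exists>j. d' j \<noteq> 0"
    proof -
      obtain j where j: "d j \<noteq> 0" using d(2) by blast
      then have "j \<noteq> k" using d(1)[of k] by auto
      then show ?thesis using j by (intro exI[of _ j]) (simp add: d'_def)
    qed
    ultimately show ?thesis by (intro exI[of _ d']) blast
  qed
qed

text \<open>The values at \<open>v\<close> sum to one. A fractional edge leaves a remainder strictly
  between zero and one, which cannot be made up of integral values.\<close>

lemma PM_fractional_degree:
  assumes G: "simple_graph V E" and x: "x \<in> PM V E" and e: "0 < x e" "x e < 1" "v \<in> e"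
  shows "\<exists>f. f \<noteq> e \<and> v \<in> f \<and> 0 < x f \<and> x f < 1" "\<And>f. v \<in> f \<Longrightarrow> x f < 1"
proof -
  have eE: "e \<in> E" using PM_outside[OF x, of e] e by force
  then have v: "v \<in> V" using e G by (auto simp: simple_graph_def)
  have ec: "e \<in> cut E {v}" using eE e mem_cut_singleton[OF G] by blast
  have fin: "finite (cut E {v})" using simple_graph_finite[OF G] by simp
  have sum1: "x e + (\<Sum>f\<in>cut E {v} - {e}. x f) = 1"
    using PM_degree[OF x v] sum.remove[OF fin ec, of x] by simp
  show lt: "x f < 1" if "v \<in> f" for f
  proof (cases "f \<in> E \<and> f \<noteq> e")
    case True
    then have "f \<in> cut E {v} - {e}" using that mem_cut_singleton[OF G] by blast
    then have "x f \<le> (\<Sum>f\<in>cut E {v} - {e}. x f)" using fin PM_nonneg[OF x] by (intro member_le_sum) auto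
    then show ?thesis using sum1 e by linarith
  qed (use PM_outside[OF x] e in auto)
  show "\<exists>f. f \<noteq> e \<and> v \<in> f \<and> 0 < x f \<and> x f < 1"
  proof (rule ccontr)
    assume no: "\<not> (\<exists>f. f \<noteq> e \<and> v \<in> f \<and> 0 < x f \<and> x f < 1)"
    have "x f = 0" if "f \<in> cut E {v} - {e}" for f
    proof -
      have "v \<in> f" using that mem_cut_singleton[OF G] by blast
      then show ?thesis using lt[of f] no that PM_nonneg[OF x, of f] by (metis DiffD2 insertI1 order_le_less)
    qed
    then have "(\<Sum>f\<in>cut E {v} - {e}. x f) = 0" by simp
    then show False using sum1 e by simp
  qed
qed

text \<open>A walk that never turns back continues forever in a finite set, and its first repetition
  closes a cycle. The length is at least three because neither loops nor reversals occur. The last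
  conclusion says that the two neighbours of \<open>c 0\<close> on the cycle differ.\<close>

lemma exists_cycle_two_regular:
  fixes adj :: "'v \<Rightarrow> 'v \<Rightarrow> bool"
  assumes fin: "finite W" and sym: "\<And>u v. adj u v \<Longrightarrow> adj v u" and irr: "\<And>u. \<not> adj u u"
    and W: "\<And>u v. adj u v \<Longrightarrow> v \<in> W" and deg: "\<And>u v. adj u v \<Longrightarrow> \<exists>w. w \<noteq> u \<and> adj v w"
    and start: "adj a b"
  obtains c :: "nat \<Rightarrow> 'v" and m where "m \<ge> 3" "inj_on c {..<m}" "c m = c 0" "\<And>k. adj (c k) (c (Suc k))"
    "c (m - 1) \<noteq> c 1"
proof -
  \<comment> \<open>The successor map acts on directed edges, because avoiding the previous vertex
    needs one step of memory.\<close>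
  define nxt where "nxt p = (snd p, SOME w. w \<noteq> fst p \<and> adj (snd p) w)" for p :: "'v \<times> 'v"
  define p where "p k = (nxt ^^ k) (a, b)" for k
  define s where "s k = fst (p k)" for k
  have pS: "p (Suc k) = nxt (p k)" for k by (simp add: p_def)
  have nx: "snd (nxt q) \<noteq> fst q \<and> adj (snd q) (snd (nxt q))" if "adj (fst q) (snd q)" for q
    unfolding nxt_def snd_conv using someI_ex[OF deg[OF that]] by simp
  have adj: "adj (fst (p k)) (snd (p k))" for k
  proof (induction k)
    case 0
    show ?case using start by (simp add: p_def)
  next
    case (Suc k)
    show ?case unfolding pS using nx[OF Suc] by (simp add: nxt_def)
  qed
  have sS: "s (Suc k) = snd (p k)" for k unfolding s_def pS by (simp add: nxt_def)
  have sadj: "adj (s k) (s (Suc k))" for k using adj[of k] unfolding sS by (simp add: s_def)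
  have s2: "s (Suc (Suc k)) \<noteq> s k" for k
    using nx[OF adj[of k]] unfolding sS pS by (simp add: s_def)
  have sW: "s k \<in> W" for k using W[OF sym[OF sadj]] .
  have "\<exists>j. \<exists>i<j. s i = s j"
  proof (rule ccontr)
    assume "\<not> ?thesis"
    then have "inj s" by (metis injI linorder_neqE_nat)
    moreover have "range s \<subseteq> W" using sW by blast
    ultimately show False using fin by (meson finite_imageD finite_subset infinite_UNIV_nat)
  qed
  then obtain j where j: "\<exists>i<j. s i = s j" and least: "\<And>k. k < j \<Longrightarrow> \<not> (\<exists>i<k. s i = s k)"
    using exists_least_iff[of "\<lambda>j. \<exists>i<j. s i = s j"] by metis
  obtain i where i: "i < j" "s i = s j" using j by blast
  have "j \<noteq> Suc i" using i sadj[of i] irr by metis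
  moreover have "j \<noteq> Suc (Suc i)" using i s2[of i] by metis
  ultimately have m3: "j - i \<ge> 3" using i by linarith
  have inj: "inj_on (\<lambda>k. s (i + k)) {..<j - i}"
  proof (rule inj_onI)
    fix k l assume kl: "k \<in> {..<j - i}" "l \<in> {..<j - i}" "s (i + k) = s (i + l)"
    show "k = l"
    proof (rule ccontr)
      assume "k \<noteq> l"
      then consider "i + k < i + l" | "i + l < i + k" by linarith
      then show False using kl least[of "i + l"] least[of "i + k"] by (metis add.commute less_diff_conv lessThan_iff)
    qed
  qed
  show ?thesis
  proof (rule that[OF m3 inj])
    show "s (i + (j - i)) = s (i + 0)" using i by simp
    show "adj (s (i + k)) (s (i + Suc k))" for k using sadj[of "i + k"] by simp
    show "s (i + (j - i - 1)) \<noteq> s (i + 1)"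
    proof
      assume "s (i + (j - i - 1)) = s (i + 1)"
      then have "j - i - 1 = 1" using inj_onD[OF inj, of "j - i - 1" 1] m3 by simp
      then show False using m3 by simp
    qed
  qed
qed

text \<open>The graph of fractional edges has minimum degree two. With more edges than vertices, the
  degree equations have a nonzero solution by dimension count. Otherwise all degrees are two, and a
  cycle of fractional edges is a whole component; the odd-set constraint makes it even, and
  alternating signs along it preserve the degrees.\<close>

lemma fractional_direction:
  assumes G: "simple_graph V E" and x: "x \<in> PM V E" and frac: "\<exists>e. 0 < x e \<and> x e < 1"
  obtains d where "\<And>e. \<not> (0 < x e \<and> x e < 1) \<Longrightarrow> d e = 0" "\<exists>e. d e \<noteq> (0::real)"
    "\<And>v. v \<in> V \<Longrightarrow> (\<Sum>e\<in>cut E {v}. d e) = 0"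
proof -
  note fin = simple_graph_finite[OF G]
  define J where "J = {e. 0 < x e \<and> x e < 1}"
  have JE: "J \<subseteq> E" using PM_outside[OF x] by (force simp: J_def)
  have finJ: "finite J" using JE fin finite_subset by blast
  have card2: "card e = 2" if "e \<in> J" for e using that JE G by (auto simp: simple_graph_def)
  define W where "W = \<Union>J"
  have WV: "W \<subseteq> V" using JE G by (auto simp: W_def simple_graph_def)
  then have finW: "finite W" using fin finite_subset by blast
  define inc where "inc v = {e \<in> J. v \<in> e}" for v
  have fini: "finite (inc v)" for v using finJ by (simp add: inc_def)
  have two: "\<exists>f\<in>inc v. f \<noteq> e" if "e \<in> inc v" for e v
    using PM_fractional_degree(1)[OF G x, of e v] that by (auto simp: inc_def J_def)
  have ge2: "2 \<le> card (inc v)" if v: "v \<in> W" for v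
  proof -
    obtain e where e: "e \<in> inc v" using v by (auto simp: W_def inc_def)
    then obtain f where "f \<in> inc v" "f \<noteq> e" using two by blast
    then have "card {e, f} \<le> card (inc v)" using e fini by (intro card_mono) auto
    then show ?thesis using \<open>f \<noteq> e\<close> by simp
  qed
  have degsum: "(\<Sum>e\<in>cut E {v}. d e) = (\<Sum>e\<in>J. if v \<in> e then d e else 0)"
    if d: "\<And>e. e \<notin> J \<Longrightarrow> d e = 0" for d :: "'a set \<Rightarrow> real" and v
  proof -
    have "(\<Sum>e\<in>cut E {v}. d e) = (\<Sum>e\<in>inc v. d e)"
    proof (rule sum.mono_neutral_right)
      show "inc v \<subseteq> cut E {v}" using JE mem_cut_singleton[OF G] by (auto simp: inc_def)
      show "\<forall>e\<in>cut E {v} - inc v. d e = 0" using d mem_cut_singleton[OF G] by (auto simp: inc_def)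
    qed (use fin in simp)
    then show ?thesis unfolding inc_def by (simp add: sum.inter_filter[OF finJ])
  qed
  show ?thesis
  proof (cases "card W < card J")
    case True
    from exists_kernel_vector[OF finW finJ True, of "\<lambda>v e. if v \<in> e then 1 else 0"]
    obtain d :: "'a set \<Rightarrow> real" where d: "\<And>e. e \<notin> J \<Longrightarrow> d e = 0" "\<exists>e. d e \<noteq> 0"
      "\<And>v. v \<in> W \<Longrightarrow> (\<Sum>e\<in>J. (if v \<in> e then 1 else 0) * d e) = 0" by blast
    have "(\<Sum>e\<in>cut E {v}. d e) = 0" for v
    proof (cases "v \<in> W")
      case True
      have "(\<Sum>e\<in>J. if v \<in> e then d e else 0) = (\<Sum>e\<in>J. (if v \<in> e then 1 else 0) * d e)"
        by (rule sum.cong) auto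
      then show ?thesis using d(3)[OF True] degsum[of d, OF d(1)] by simp
    next
      case False
      then have "(\<Sum>e\<in>J. if v \<in> e then d e else 0) = 0" by (intro sum.neutral) (auto simp: W_def)
      then show ?thesis using degsum[of d, OF d(1)] by simp
    qed
    then show ?thesis using that[of d] d by (auto simp: J_def)
  next
    case False
    \<comment> \<open>Double counting of incidences: the total is
      \<open>2 * card J \<le> 2 * card W\<close>, which leaves no room for a vertex of degree above
      two.\<close>
    have "(\<Sum>v\<in>W. card (inc v)) = (\<Sum>v\<in>W. \<Sum>e\<in>J. if v \<in> e then 1 else 0)"
      by (simp add: inc_def finJ sum.inter_filter[symmetric])
    also have "\<dots> = (\<Sum>e\<in>J. \<Sum>v\<in>W. if v \<in> e then 1 else 0)" by (rule sum.swap)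
    also have "\<dots> = (\<Sum>e\<in>J. card e)"
    proof (rule sum.cong[OF refl])
      fix e assume "e \<in> J"
      then have "{v \<in> W. v \<in> e} = e" by (auto simp: W_def)
      then show "(\<Sum>v\<in>W. if v \<in> e then 1 else 0) = card e" using finW by (simp add: sum.inter_filter[symmetric])
    qed
    also have "\<dots> = 2 * card J" using card2 by simp
    finally have tot: "(\<Sum>v\<in>W. card (inc v)) = 2 * card J" .
    have eq2: "card (inc v) = 2" if v: "v \<in> W" for v
    proof (rule ccontr)
      assume "card (inc v) \<noteq> 2"
      then have "2 < card (inc v)" using ge2[OF v] by simp
      then have "(\<Sum>v\<in>W. 2) < (\<Sum>v\<in>W. card (inc v))" using v finW ge2 by (intro sum_strict_mono_ex1) auto
      then show False using tot False by simp
    qed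
    define adj where "adj u v \<longleftrightarrow> {u, v} \<in> J" for u v
    have irr: "\<not> adj u u" for u using card2[of "{u, u}"] by (auto simp: adj_def)
    obtain e where eJ: "e \<in> J" using frac by (auto simp: J_def)
    then obtain a b where ab: "adj a b" using card2[OF eJ] by (auto simp: adj_def card_2_iff)
    have next_adj: "\<exists>w. w \<noteq> u \<and> adj v w" if uv: "adj u v" for u v
    proof -
      have "{u, v} \<in> inc v" using uv by (auto simp: adj_def inc_def)
      then obtain f where f: "f \<in> J" "v \<in> f" "f \<noteq> {u, v}" using two[of "{u, v}" v] by (auto simp: inc_def)
      obtain p q where pq: "f = {p, q}" "p \<noteq> q" using card2[OF f(1)] by (auto simp: card_2_iff)
      show ?thesis
      proof (cases "p = v")
        case True
        then show ?thesis using f pq by (intro exI[of _ q]) (auto simp: adj_def insert_commute)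
      next
        case False
        then show ?thesis using f pq by (intro exI[of _ p]) (auto simp: adj_def insert_commute)
      qed
    qed
    obtain c :: "nat \<Rightarrow> 'a" and m where c: "m \<ge> 3" "inj_on c {..<m}" "c m = c 0" "\<And>k. adj (c k) (c (Suc k))"
      "c (m - 1) \<noteq> c 1"
    proof (rule exists_cycle_two_regular[OF finW _ irr _ next_adj ab])
      show "adj v u" if "adj u v" for u v using that by (simp add: adj_def insert_commute)
      show "v \<in> W" if "adj u v" for u v using that by (auto simp: adj_def W_def)
    qed (assumption, rule that)
    define C where "C = c ` {..<m}"
    have cW: "c k \<in> W" for k using c(4)[of k] by (auto simp: adj_def W_def)
    have inC: "c k \<in> C" if "k \<le> m" for k
      using that c(1,3) by (cases "k = m") (auto simp: C_def intro: image_eqI[of _ _ 0])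
    \<comment> \<open>As \<open>u\<close> has degree two, its neighbours are the two neighbours on
      the cycle. The case distinctions concern the positions at which the index wraps
      around.\<close>
    have closed: "v \<in> C" if u: "u \<in> C" and uv: "adj u v" for u v
    proof -
      obtain k where k: "u = c k" "k < m" using u by (auto simp: C_def)
      define pr where "pr = (if k = 0 then c (m - 1) else c (k - 1))"
      have prC: "pr \<in> C" using k c(1) by (auto simp: pr_def intro: inC)
      have pradj: "adj pr u"
      proof (cases "k = 0")
        case True
        have "adj (c (m - 1)) (c (Suc (m - 1)))" by (rule c(4))
        then show ?thesis using True c(1,3) k by (simp add: pr_def)
      next
        case False
        then show ?thesis using c(4)[of "k - 1"] k by (simp add: pr_def)
      qed
      have prne: "pr \<noteq> c (Suc k)"
      proof (cases "k = 0")
        case False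
        show ?thesis
        proof (cases "Suc k = m")
          case True
          have "c (k - 1) \<noteq> c 0"
          proof
            assume "c (k - 1) = c 0"
            then have "k - 1 = 0" using k(2) by (intro inj_onD[OF c(2)]) auto
            then show False using True c(1) by simp
          qed
          then show ?thesis using False True c(3) by (simp add: pr_def)
        next
          case F: False
          have "c (k - 1) \<noteq> c (Suc k)"
          proof
            assume "c (k - 1) = c (Suc k)"
            then have "k - 1 = Suc k" using k(2) F by (intro inj_onD[OF c(2)]) auto
            then show False by simp
          qed
          then show ?thesis using False by (simp add: pr_def)
        qed
      qed (use c(5) in \<open>simp add: pr_def\<close>)
      have neu: "pr \<noteq> u" "c (Suc k) \<noteq> u" using pradj c(4)[of k] irr k by metis+
      have "{pr, u} \<noteq> {u, c (Suc k)}" using prne neu by (auto simp: doubleton_eq_iff)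
      moreover have "{pr, u} \<in> inc u" "{u, c (Suc k)} \<in> inc u" using pradj c(4)[of k] k by (auto simp: inc_def adj_def)
      moreover have "card (inc u) = 2" using eq2 cW k by simp
      ultimately have "inc u = {{pr, u}, {u, c (Suc k)}}"
        by (intro card_subset_eq[symmetric, OF fini]) auto
      moreover have "{u, v} \<in> inc u" using uv by (auto simp: inc_def adj_def)
      ultimately have "v = pr \<or> v = c (Suc k)" by (auto simp: doubleton_eq_iff)
      then show ?thesis using prC inC[of "Suc k"] k by auto
    qed
    have CV: "C \<subseteq> V" using cW WV by (auto simp: C_def)
    have cardC: "card C = m" using c(2) by (simp add: C_def card_image)
    \<comment> \<open>No fractional edge leaves \<open>C\<close>, and an edge of value one cannot
      meet a fractional edge, so the cut has value zero. Here the odd-set constraints enter: they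
      rule out an odd cycle.\<close>
    have "(\<Sum>e\<in>cut E C. x e) = 0"
    proof (rule sum.neutral, rule ballI)
      fix e assume e: "e \<in> cut E C"
      obtain u v where uv: "e = {u, v}" "u \<in> C" "v \<notin> C" using cut_edge[OF G e] by metis
      have "u \<in> W" using uv cW by (auto simp: C_def)
      then obtain f where f: "f \<in> J" "u \<in> f" by (auto simp: W_def)
      have "x e < 1" using PM_fractional_degree(2)[OF G x, of f u e] f uv by (auto simp: J_def)
      moreover have "e \<notin> J" using closed[of u v] uv by (auto simp: adj_def)
      ultimately show "x e = 0" using PM_nonneg[OF x, of e] by (auto simp: J_def)
    qed
    then have ev: "even m" using PM_odd_cut[OF x CV] cardC by force
    define d :: "'a set \<Rightarrow> real" where "d e = (\<Sum>k<m. if e = {c k, c (Suc k)} then (-1) ^ k else 0)" for e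
    have dJ: "d e = 0" if "e \<notin> J" for e
      unfolding d_def using that c(4) by (intro sum.neutral) (auto simp: adj_def)
    have "(\<Sum>e\<in>cut E {v}. d e) = 0" for v
    proof -
      define g :: "nat \<Rightarrow> real" where "g k = (if v = c k then (-1) ^ k else 0)" for k
      have "(\<Sum>e\<in>cut E {v}. d e) = (\<Sum>e\<in>J. if v \<in> e then d e else 0)"
        by (rule degsum) (rule dJ)
      also have "\<dots> = (\<Sum>e\<in>J. \<Sum>k<m. if e = {c k, c (Suc k)} \<and> v \<in> e then (-1) ^ k else 0)"
        by (rule sum.cong) (auto simp: d_def)
      also have "\<dots> = (\<Sum>k<m. \<Sum>e\<in>J. if e = {c k, c (Suc k)} \<and> v \<in> e then (-1) ^ k else 0)" by (rule sum.swap)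
      also have "\<dots> = (\<Sum>k<m. g k - g (Suc k))"
      proof (rule sum.cong[OF refl])
        fix k
        have kJ: "{c k, c (Suc k)} \<in> J" using c(4) by (simp add: adj_def)
        have ne: "c k \<noteq> c (Suc k)" using c(4)[of k] irr by metis
        have "(\<Sum>e\<in>J. if e = {c k, c (Suc k)} \<and> v \<in> e then (-1) ^ k else 0)
          = (\<Sum>e\<in>J. if e = {c k, c (Suc k)} then (if v \<in> {c k, c (Suc k)} then (-1) ^ k else 0) else (0::real))"
          by (rule sum.cong) auto
        also have "\<dots> = (if v \<in> {c k, c (Suc k)} then (-1) ^ k else 0)" using kJ finJ by simp
        also have "\<dots> = g k - g (Suc k)" using ne by (auto simp: g_def)
        finally show "(\<Sum>e\<in>J. if e = {c k, c (Suc k)} \<and> v \<in> e then (-1) ^ k else 0) = g k - g (Suc k)" .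
      qed
      also have "\<dots> = g 0 - g m" by (rule sum_lessThan_telescope')
      also have "\<dots> = 0" using ev c(3) by (simp add: g_def)
      finally show ?thesis .
    qed
    \<comment> \<open>No cancellation: the first edge occurs only once on the cycle, which has
      length at least three.\<close>
    moreover have "d {c 0, c 1} \<noteq> 0"
    proof -
      have "{c 0, c 1} \<noteq> {c k, c (Suc k)}" if k: "k < m" "k \<noteq> 0" for k
      proof
        assume eq: "{c 0, c 1} = {c k, c (Suc k)}"
        have "c 0 \<noteq> c k" using inj_onD[OF c(2), of 0 k] k c(1) by auto
        then have s: "c 1 = c k" "c 0 = c (Suc k)" using eq by (auto simp: doubleton_eq_iff)
        then have "k = 1" using inj_onD[OF c(2), of 1 k] k c(1) by auto
        then show False using s inj_onD[OF c(2), of 0 2] c(1) by (auto simp: numeral_2_eq_2)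
      qed
      then have "d {c 0, c 1} = (\<Sum>k<m. if k = 0 then 1 else 0)" unfolding d_def by (intro sum.cong) auto
      then show ?thesis using c(1) by simp
    qed
    ultimately show ?thesis using that[of d] dJ by (auto simp: J_def)
  qed
qed

section \<open>Edmonds' theorem: every minimal face contains a matching\<close>

text \<open>Everything outside \<open>U\<close> is contracted to \<open>c\<close>, later chosen as a
  vertex outside \<open>U\<close>, so that contracted graphs stay on the same vertex type. Edges
  outside \<open>U\<close> become singletons and are dropped by \<open>collapse_edges\<close>;
  parallel edges become equal sets, which is why \<open>collapse_vec\<close> sums over
  preimages.\<close>

definition collapse :: "'v set \<Rightarrow> 'v \<Rightarrow> 'v \<Rightarrow> 'v" where
  "collapse U c v = (if v \<in> U then v else c)"

definition collapse_edges :: "'v set set \<Rightarrow> 'v set \<Rightarrow> 'v \<Rightarrow> 'v set set" where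
  "collapse_edges E U c = {g \<in> (`) (collapse U c) ` E. card g = 2}"

definition collapse_vec :: "'v set set \<Rightarrow> 'v set \<Rightarrow> 'v \<Rightarrow> ('v set \<Rightarrow> real) \<Rightarrow> 'v set \<Rightarrow> real" where
  "collapse_vec E U c x g = (if g \<in> collapse_edges E U c then \<Sum>e\<in>{e \<in> E. collapse U c ` e = g}. x e else 0)"

lemma collapse_inter:
  assumes "c \<notin> U" "S \<subseteq> U"
  shows "collapse U c ` e \<inter> S = e \<inter> S"
  using assms by (auto simp: collapse_def image_iff)

text \<open>One endpoint of an edge in the cut of \<open>S\<close> lies in \<open>S\<close> and
  stays in place, and the other is not identified with it, so the edge does not become a
  loop.\<close>

lemma collapse_mem_cut:
  assumes G: "simple_graph V E" and c: "c \<notin> U" and S: "S \<subseteq> U" and e: "e \<in> E"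
  shows "collapse U c ` e \<in> cut (collapse_edges E U c) S \<longleftrightarrow> e \<in> cut E S"
proof
  assume "e \<in> cut E S"
  obtain a b where ab: "e = {a, b}" "a \<noteq> b" using simple_graph_edge[OF G e] by metis
  have "collapse U c a \<noteq> collapse U c b"
    using \<open>e \<in> cut E S\<close> c S ab by (auto simp: pair_mem_cut collapse_def)
  then have "card (collapse U c ` e) = 2" by (simp add: ab)
  then show "collapse U c ` e \<in> cut (collapse_edges E U c) S"
    using \<open>e \<in> cut E S\<close> e by (auto simp: cut_def collapse_edges_def collapse_inter[OF c S])
qed (use e in \<open>auto simp: cut_def collapse_inter[OF c S]\<close>)

lemma sum_cut_collapse_vec:
  assumes G: "simple_graph V E" and c: "c \<notin> U" and S: "S \<subseteq> U"
  shows "(\<Sum>g\<in>cut (collapse_edges E U c) S. collapse_vec E U c x g) = (\<Sum>e\<in>cut E S. x e)"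
proof -
  note fin = simple_graph_finite[OF G]
  let ?T = "cut (collapse_edges E U c) S"
  have finE: "finite (collapse_edges E U c)" using fin by (simp add: collapse_edges_def)
  have "(\<Sum>g\<in>?T. collapse_vec E U c x g) = (\<Sum>g\<in>?T. sum x {e \<in> cut E S. collapse U c ` e = g})"
  proof (rule sum.cong[OF refl])
    fix g assume g: "g \<in> ?T"
    then have "{e \<in> cut E S. collapse U c ` e = g} = {e \<in> E. collapse U c ` e = g}"
      using collapse_mem_cut[OF G c S] cut_subset by blast
    then show "collapse_vec E U c x g = sum x {e \<in> cut E S. collapse U c ` e = g}"
      using g cut_subset[of "collapse_edges E U c" S] by (auto simp: collapse_vec_def)
  qed
  also have "\<dots> = (\<Sum>e\<in>cut E S. x e)"
    using fin finE collapse_mem_cut[OF G c S] cut_subset[of E S] by (intro sum.group) auto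
  finally show ?thesis .
qed

lemma simple_graph_collapse:
  assumes "simple_graph V E" "U \<subseteq> V"
  shows "simple_graph (insert c U) (collapse_edges E U c)"
proof -
  have "finite U" using assms simple_graph_finite finite_subset by metis
  then show ?thesis by (auto simp: simple_graph_def collapse_edges_def collapse_def)
qed

text \<open>The degree constraint of the new vertex is the tightness of \<open>U\<close>. A set that
  contains \<open>c\<close> is replaced by its complement, which lies in \<open>U\<close> and is odd
  because \<open>card U + 1\<close> is even.\<close>

lemma collapse_vec_PM:
  assumes G: "simple_graph V E" and x: "x \<in> PM V E" and U: "U \<subseteq> V" "odd (card U)" "(\<Sum>e\<in>cut E U. x e) = 1"
    and c: "c \<notin> U"
  shows "collapse_vec E U c x \<in> PM (insert c U) (collapse_edges E U c)"
  unfolding PM_def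
proof (intro CollectI conjI allI ballI impI)
  let ?E = "collapse_edges E U c" and ?V = "insert c U" and ?x = "collapse_vec E U c x"
  note G' = simple_graph_collapse[OF G U(1), of c]
  have finU: "finite U" using G' by (simp add: simple_graph_def)
  note sumc = sum_cut_collapse_vec[OF G c, of _ x]
  show "?x e = 0" if "e \<notin> ?E" for e using that by (simp add: collapse_vec_def)
  show "0 \<le> ?x e" if "e \<in> ?E" for e using PM_nonneg[OF x] by (auto simp: collapse_vec_def intro: sum_nonneg)
  show "(\<Sum>e\<in>cut ?E {v}. ?x e) = 1" if v: "v \<in> ?V" for v
  proof (cases "v = c")
    case True
    have "?V - U = {c}" using c by auto
    then have "cut ?E {c} = cut ?E U" using cut_complement[OF G', of U] by simp
    then show ?thesis using True sumc[of U] U by simp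
  next
    case False
    then show ?thesis using v sumc[of "{v}"] PM_degree[OF x, of v] U by auto
  qed
  show "1 \<le> (\<Sum>e\<in>cut ?E S. ?x e)" if S: "S \<subseteq> ?V" "odd (card S)" for S
  proof (cases "c \<in> S")
    case False
    then have "S \<subseteq> U" using S by blast
    then show ?thesis using sumc[of S] PM_odd_cut[OF x, of S] U S by auto
  next
    case True
    have sub: "?V - S \<subseteq> U" using True by blast
    have "card (?V - S) + card S = card ?V"
      using S(1) finU by (metis add.commute card_Diff_subset card_mono finite_insert finite_subset le_add_diff_inverse)
    moreover have "even (card ?V)" using U(2) c finU by simp
    ultimately have "odd (card (?V - S))" using S(2) by (metis even_add)
    then show ?thesis
      using sumc[OF sub] PM_odd_cut[OF x, of "?V - S"] sub U cut_complement[OF G', of S] by auto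
  qed
qed

lemma sum_indicator_card:
  assumes "finite A"
  shows "(\<Sum>e\<in>A. indicator M e) = real (card (A \<inter> M))"
  using assms by (simp add: indicator_def)

text \<open>\<open>M1\<close> has a single edge at \<open>c\<close>, the image of \<open>f\<close>,
  and \<open>N\<close> puts \<open>f\<close> in its place. Collapsing is injective on the edges
  obtained and preserves cuts of subsets of \<open>U\<close>, so the cut values of such subsets
  carry over.\<close>

lemma glue_half:
  assumes G: "simple_graph V E" and U: "U \<subseteq> V" and c: "c \<notin> U"
    and M1: "perfect_matching (insert c U) (collapse_edges E U c) M1"
    and f: "f \<in> cut E U" "collapse U c ` f \<in> M1" and N: "N = insert f {e \<in> M1. e \<subseteq> U}"
  shows "N \<subseteq> E" "\<And>v. v \<in> U \<Longrightarrow> \<exists>!e. e \<in> N \<and> v \<in> e"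
    "\<And>S. S \<subseteq> U \<Longrightarrow> (\<Sum>e\<in>cut E S. indicator N e) = (\<Sum>g\<in>cut (collapse_edges E U c) S. indicator M1 g :: real)"
proof -
  let ?E = "collapse_edges E U c" and ?col = "collapse U c"
  note fin = simple_graph_finite[OF G]
  have fE: "f \<in> E" using f cut_subset by blast
  obtain a b where ab: "f = {a, b}" "a \<in> U" "b \<notin> U" using cut_edge[OF G f(1)] by metis
  have colf: "?col ` f = {a, c}" using ab by (auto simp: collapse_def)
  have M1E: "M1 \<subseteq> ?E" and M1u: "\<And>v. v \<in> insert c U \<Longrightarrow> \<exists>!e. e \<in> M1 \<and> v \<in> e"
    using M1 by (auto simp: perfect_matching_def)
  have colid: "?col ` e = e" if "e \<subseteq> U" for e using that by (auto simp: collapse_def image_iff)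
  have inside: "e \<in> E" if eE: "e \<in> ?E" and eU: "e \<subseteq> U" for e
  proof -
    obtain e' where e': "e' \<in> E" "e = ?col ` e'" using eE unfolding collapse_edges_def by blast
    then have "e' \<subseteq> U" using eU c by (auto simp: collapse_def split: if_splits)
    then show ?thesis using e' colid by auto
  qed
  show NE: "N \<subseteq> E" using N fE inside M1E by auto
  have atc: "g = {a, c}" if "g \<in> M1" "\<not> g \<subseteq> U" for g
  proof -
    have "g \<subseteq> insert c U" using that M1E simple_graph_collapse[OF G U, of c] by (auto simp: simple_graph_def)
    then have "c \<in> g" using that by blast
    then show ?thesis using that f(2) colf M1u[of c] by auto
  qed
  have fU: "\<not> f \<subseteq> U" using ab by blast
  show "\<exists>!e. e \<in> N \<and> v \<in> e" if v: "v \<in> U" for v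
  proof -
    obtain g where g: "g \<in> M1" "v \<in> g" and uniq: "\<And>h. h \<in> M1 \<Longrightarrow> v \<in> h \<Longrightarrow> h = g"
      using M1u[of v] v by blast
    show ?thesis
    proof (cases "g \<subseteq> U")
      case True
      have "v \<notin> f"
      proof
        assume "v \<in> f"
        then have "v = a" using ab v by auto
        then have "{a, c} = g" using uniq[of "{a, c}"] f(2) colf by auto
        then show False using True c by auto
      qed
      then have "e = g" if "e \<in> N" "v \<in> e" for e
        using that uniq[of e] by (auto simp: N)
      moreover have "g \<in> N" using g True by (simp add: N)
      ultimately show ?thesis using g(2) by blast
    next
      case False
      then have "g = {a, c}" using atc g by blast
      then have "v = a" using g v c by auto
      moreover have "e = f" if "e \<in> N" "v \<in> e" for e
        using that uniq[of e] False by (auto simp: N)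
      moreover have "f \<in> N" by (simp add: N)
      ultimately show ?thesis using ab(1) by blast
    qed
  qed
  show "(\<Sum>e\<in>cut E S. indicator N e) = (\<Sum>g\<in>cut ?E S. indicator M1 g :: real)" if S: "S \<subseteq> U" for S
  proof -
    have "bij_betw ((`) ?col) (cut E S \<inter> N) (cut ?E S \<inter> M1)"
      unfolding bij_betw_def
    proof
      show "inj_on ((`) ?col) (cut E S \<inter> N)"
      proof (rule inj_onI)
        fix e e' assume e: "e \<in> cut E S \<inter> N" "e' \<in> cut E S \<inter> N" "?col ` e = ?col ` e'"
        have "\<not> {a, c} \<subseteq> U" using c by simp
        then show "e = e'" using e colf colid by (auto simp: N)
      qed
      show "(`) ?col ` (cut E S \<inter> N) = cut ?E S \<inter> M1"
      proof
        show "(`) ?col ` (cut E S \<inter> N) \<subseteq> cut ?E S \<inter> M1"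
        proof (rule image_subsetI)
          fix e assume e: "e \<in> cut E S \<inter> N"
          then have "?col ` e \<in> cut ?E S" using collapse_mem_cut[OF G c S] NE by blast
          moreover have "?col ` e \<in> M1" using e colid f(2) by (auto simp: N)
          ultimately show "?col ` e \<in> cut ?E S \<inter> M1" by blast
        qed
        show "cut ?E S \<inter> M1 \<subseteq> (`) ?col ` (cut E S \<inter> N)"
        proof
          fix g assume g: "g \<in> cut ?E S \<inter> M1"
          define e where "e = (if g \<subseteq> U then g else f)"
          have "?col ` e = g" using atc[of g] g colid colf by (auto simp: e_def)
          moreover have "e \<in> N" using g by (auto simp: e_def N)
          moreover have "e \<in> cut E S" using collapse_mem_cut[OF G c S, of e] calculation g NE by auto
          ultimately show "g \<in> (`) ?col ` (cut E S \<inter> N)" by blast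
        qed
      qed
    qed
    then have "card (cut E S \<inter> N) = card (cut ?E S \<inter> M1)" by (rule bij_betw_same_card)
    moreover have "finite (cut ?E S)" using fin by (simp add: collapse_edges_def)
    ultimately show ?thesis using fin by (simp add: sum_indicator_card)
  qed
qed

text \<open>The two matchings agree on \<open>f\<close> and are glued along it. The difficulty lies
  in tight sets that meet both sides: such a set is uncrossed with whichever of \<open>U\<close> and
  \<open>V - U\<close> it meets in an odd number of vertices, which leaves tight sets on one side
  each.\<close>

lemma glue_in_min_face:
  assumes G: "simple_graph V E" and x: "x \<in> PM V E" and U: "U \<subseteq> V" "odd (card U)" "(\<Sum>e\<in>cut E U. x e) = 1"
    and c: "c \<in> V - U" and d: "d \<in> U" and f: "f \<in> cut E U" "x f > 0"
    and M1: "in_min_face (insert c U) (collapse_edges E U c) (collapse_vec E U c x) M1" "collapse U c ` f \<in> M1"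
    and M2: "in_min_face (insert d (V - U)) (collapse_edges E (V - U) d) (collapse_vec E (V - U) d x) M2"
      "collapse (V - U) d ` f \<in> M2"
  shows "\<exists>M. in_min_face V E x M"
proof -
  note fin = simple_graph_finite[OF G]
  define N1 where "N1 = insert f {e \<in> M1. e \<subseteq> U}"
  define N2 where "N2 = insert f {e \<in> M2. e \<subseteq> V - U}"
  define M where "M = N1 \<union> N2"
  have cU: "c \<notin> U" and dU: "d \<notin> V - U" using c d by auto
  have f': "f \<in> cut E (V - U)" using f cut_complement[OF G] by simp
  have pm1: "perfect_matching (insert c U) (collapse_edges E U c) M1"
    and pm2: "perfect_matching (insert d (V - U)) (collapse_edges E (V - U) d) M2"
    using M1 M2 by (auto simp: in_min_face_def)
  note h1 = glue_half[OF G U(1) cU pm1 f(1) M1(2) N1_def]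
  note h2 = glue_half[OF G Diff_subset dU pm2 f' M2(2) N2_def]
  have oddU': "odd (card (V - U))" by (rule PM_odd_complement[OF G x U(1,2)])
  have pos: "x e > 0" if e: "e \<in> M" for e
  proof -
    \<comment> \<open>An edge inside \<open>W\<close> can have no preimage but itself, so its
      collapsed value is at most its value under \<open>x\<close>.\<close>
    have *: "x e > 0" if W: "e \<subseteq> W" and wc: "w \<notin> W" and MW: "M' \<subseteq> collapse_edges E W w" "\<forall>g\<in>M'. collapse_vec E W w x g > 0" "e \<in> M'" for W w M'
    proof -
      have "{e' \<in> E. collapse W w ` e' = e} \<subseteq> {e}"
        using W wc by (auto simp: collapse_def image_iff split: if_splits)
      then have "sum x {e' \<in> E. collapse W w ` e' = e} \<le> sum x {e}"
        using PM_nonneg[OF x] by (intro sum_mono2) auto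
      then have "collapse_vec E W w x e \<le> x e"
        using MW by (auto simp: collapse_vec_def)
      then show ?thesis using MW by fastforce
    qed
    show ?thesis
      using e f(2) *[of U c M1] *[of "V - U" d M2] cU dU M1(1) M2(1)
      by (auto simp: M_def N1_def N2_def in_min_face_def perfect_matching_def)
  qed
  have pm: "perfect_matching V E M"
    unfolding perfect_matching_def
  proof (intro conjI ballI)
    show "M \<subseteq> E" using h1(1) h2(1) by (simp add: M_def)
    fix v assume v: "v \<in> V"
    show "\<exists>!e. e \<in> M \<and> v \<in> e"
    proof (cases "v \<in> U")
      case True
      then have "e \<in> M \<and> v \<in> e \<longleftrightarrow> e \<in> N1 \<and> v \<in> e" for e by (auto simp: M_def N1_def N2_def)
      then show ?thesis using h1(2)[OF True] by simp
    next
      case False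
      then have "e \<in> M \<and> v \<in> e \<longleftrightarrow> e \<in> N2 \<and> v \<in> e" for e by (auto simp: M_def N1_def N2_def)
      then show ?thesis using h2(2)[of v] v False by simp
    qed
  qed
  let ?m = "\<lambda>S. (\<Sum>e\<in>cut E S. indicator M e :: real)"
  have side1: "?m S = 1" if S: "S \<subseteq> U" "odd (card S)" "(\<Sum>e\<in>cut E S. x e) = 1" for S
  proof -
    have "e \<in> M \<longleftrightarrow> e \<in> N1" if "e \<in> cut E S" for e
    proof -
      have "e \<inter> S \<noteq> {}" using that by (auto simp: cut_def)
      then show ?thesis using S(1) by (auto simp: M_def N1_def N2_def)
    qed
    then have "?m S = (\<Sum>e\<in>cut E S. indicator N1 e)" by (intro sum.cong) (auto simp: indicator_def)
    then show ?thesis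
      using h1(3)[OF S(1)] M1(1) S sum_cut_collapse_vec[OF G cU S(1), of x]
      by (auto simp: in_min_face_def)
  qed
  have side2: "?m S = 1" if S: "S \<subseteq> V - U" "odd (card S)" "(\<Sum>e\<in>cut E S. x e) = 1" for S
  proof -
    have "e \<in> M \<longleftrightarrow> e \<in> N2" if "e \<in> cut E S" for e
    proof -
      have "e \<inter> S \<noteq> {}" using that by (auto simp: cut_def)
      then show ?thesis using S(1) by (auto simp: M_def N1_def N2_def)
    qed
    then have "?m S = (\<Sum>e\<in>cut E S. indicator N2 e)" by (intro sum.cong) (auto simp: indicator_def)
    then show ?thesis
      using h2(3)[OF S(1)] M2(1) S sum_cut_collapse_vec[OF G dU S(1), of x]
      by (auto simp: in_min_face_def)
  qed
  \<comment> \<open>\<open>W\<close> stands for \<open>U\<close> or for \<open>V - U\<close>. The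
    union \<open>S \<union> W\<close> is replaced by its complement, which has the same cut and lies
    on the other side.\<close>
  have tight: "?m S = 1"
    if S: "S \<subseteq> V" "odd (card S)" "(\<Sum>e\<in>cut E S. x e) = 1" and odd: "odd (card (S \<inter> W))"
      and W: "W \<subseteq> V" "odd (card W)" "(\<Sum>e\<in>cut E W. x e) = 1"
      and s1: "\<And>S. S \<subseteq> W \<Longrightarrow> odd (card S) \<Longrightarrow> (\<Sum>e\<in>cut E S. x e) = 1 \<Longrightarrow> ?m S = 1"
      and s2: "\<And>S. S \<subseteq> V - W \<Longrightarrow> odd (card S) \<Longrightarrow> (\<Sum>e\<in>cut E S. x e) = 1 \<Longrightarrow> ?m S = 1" for S W
  proof -
    note unc = PM_uncross[OF G x S W odd]
    have "odd (card (V - (S \<union> W)))" using PM_odd_complement[OF G x _ unc(1)] S(1) W(1) by blast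
    then have "?m (V - (S \<union> W)) = 1" using unc(3) cut_complement[OF G] by (intro s2) auto
    then have u: "?m (S \<union> W) = 1" using cut_complement[OF G] by simp
    have i: "?m (S \<inter> W) = 1" using unc(2) odd by (intro s1) auto
    have "(\<Sum>e\<in>{e \<in> E. e \<inter> (S - W) \<noteq> {} \<and> e \<inter> (W - S) \<noteq> {}}. indicator M e) = (0::real)"
      using unc(4) pos by (intro sum.neutral) (fastforce simp: indicator_def)
    then show ?thesis using sum_cut_uncross[OF G, of "indicat_real M" S W] u i s1[of W] W by simp
  qed
  have "?m S = 1" if S: "S \<subseteq> V" "odd (card S)" "(\<Sum>e\<in>cut E S. x e) = 1" for S
  proof (cases "odd (card (S \<inter> U))")
    case True
    then show ?thesis using tight[OF S True U side1 side2] by blast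
  next
    case False
    have finS: "finite S" using S fin finite_subset by blast
    have "S = (S \<inter> U) \<union> (S \<inter> (V - U))" using S by blast
    then have "card S = card (S \<inter> U) + card (S \<inter> (V - U))"
      using finS by (metis (no_types, lifting) Diff_disjoint Int_Diff card_Un_disjoint finite_Int inf_assoc inf_bot_right inf_commute inf_left_commute)
    then have o: "odd (card (S \<inter> (V - U)))" using S(2) False by simp
    have t: "(\<Sum>e\<in>cut E (V - U). x e) = 1" using U(3) cut_complement[OF G] by simp
    show ?thesis
    proof (rule tight[OF S o Diff_subset oddU' t side2])
      fix T assume T: "T \<subseteq> V - (V - U)" "odd (card T)" "(\<Sum>e\<in>cut E T. x e) = 1"
      then have "T \<subseteq> U" by blast
      then show "?m T = 1" using T(2,3) by (rule side1)
    qed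
  qed
  then show ?thesis using pm pos by (intro exI[of _ M]) (auto simp: in_min_face_def)
qed

text \<open>Nested induction on the number of vertices and on \<open>num_slack\<close>. A tight odd
  set that is neither a singleton nor the complement of one splits the graph into two smaller ones.
  Without such a set every degree-preserving direction preserves all tight cuts, so a fractional
  point can be moved to a smaller face, and an integral point is a matching. The second conjunct
  feeds the induction: gluing needs matchings of both parts through the same edge
  \<open>f\<close>.\<close>

theorem PM_min_face_matching:
  fixes V :: "'v set"
  assumes "simple_graph V E" "x \<in> PM V E"
  shows "(\<exists>M. in_min_face V E x M) \<and> (\<forall>e. x e > 0 \<longrightarrow> (\<exists>M. in_min_face V E x M \<and> e \<in> M))"
  using assms
proof (induction "card V" arbitrary: V E x rule: less_induct)
  case less
  note G = less.prems(1)
  note fin = simple_graph_finite[OF G]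
  have IH: "(\<exists>M. in_min_face V' E' x' M) \<and> (\<forall>e. x' e > 0 \<longrightarrow> (\<exists>M. in_min_face V' E' x' M \<and> e \<in> M))"
    if "card V' < card V" "simple_graph V' E'" "x' \<in> PM V' E'" for V' :: "'v set" and E' x' by (rule less.hyps[OF that])
  show ?case using less.prems(2)
  proof (induction "num_slack V E x" arbitrary: x rule: less_induct)
    case (less x)
    note x = less.prems
    have IHx: "(\<exists>M. in_min_face V E x' M) \<and> (\<forall>e. x' e > 0 \<longrightarrow> (\<exists>M. in_min_face V E x' M \<and> e \<in> M))"
      if "num_slack V E x' < num_slack V E x" "x' \<in> PM V E" for x' by (rule less.hyps[OF that])
    have ex: "\<exists>M. in_min_face V E x M"
    proof (cases "\<exists>U\<subseteq>V. odd (card U) \<and> (\<Sum>e\<in>cut E U. x e) = 1 \<and> card U \<noteq> 1 \<and> card (V - U) \<noteq> 1")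
      case True
      then obtain U where U: "U \<subseteq> V" "odd (card U)" "(\<Sum>e\<in>cut E U. x e) = 1" "card U \<noteq> 1" "card (V - U) \<noteq> 1"
        by blast
      have cardU: "card (V - U) + card U = card V"
        using U(1) fin by (metis add.commute card_Diff_subset card_mono finite_subset le_add_diff_inverse)
      have oddU': "odd (card (V - U))" by (rule PM_odd_complement[OF G x U(1,2)])
      have "2 \<le> m" if "odd m" "m \<noteq> 1" for m :: nat using that by presburger
      then have big: "card U \<ge> 2" "card (V - U) \<ge> 2" using U oddU' by blast+
      have "V - U \<noteq> {}" "U \<noteq> {}" using big by (metis card.empty not_numeral_le_zero)+
      then obtain c d where c: "c \<in> V - U" and d: "d \<in> U" by blast
      have finU: "finite U" "finite (V - U)" using U fin finite_subset by auto
      have "\<exists>f\<in>cut E U. x f > 0"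
      proof (rule ccontr)
        assume "\<not> ?thesis"
        then have "(\<Sum>e\<in>cut E U. x e) \<le> 0" by (intro sum_nonpos) auto
        then show False using U by simp
      qed
      then obtain f where f: "f \<in> cut E U" "x f > 0" by blast
      have t: "(\<Sum>e\<in>cut E (V - U). x e) = 1" using U(3) cut_complement[OF G] by simp
      have pos: "collapse_vec E W w x (collapse W w ` f) > 0"
        if W: "f \<in> cut E W" "w \<notin> W" for W w
      proof -
        have fE: "f \<in> E" using W cut_subset by blast
        have "collapse W w ` f \<in> collapse_edges E W w"
          using collapse_mem_cut[OF G W(2) order_refl fE] W(1) cut_subset by blast
        moreover have "x f \<le> (\<Sum>e\<in>{e \<in> E. collapse W w ` e = collapse W w ` f}. x e)"
          using fE fin PM_nonneg[OF x] by (intro member_le_sum) auto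
        ultimately show ?thesis using f(2) by (simp add: collapse_vec_def)
      qed
      have "card (insert c U) < card V" using cardU big c finU by simp
      from IH[OF this simple_graph_collapse[OF G U(1)] collapse_vec_PM[OF G x U(1-3)]]
      obtain M1 where M1: "in_min_face (insert c U) (collapse_edges E U c) (collapse_vec E U c x) M1" "collapse U c ` f \<in> M1"
        using pos[of U c] f c by blast
      have "card (insert d (V - U)) < card V" using cardU big d finU by simp
      from IH[OF this simple_graph_collapse[OF G Diff_subset] collapse_vec_PM[OF G x Diff_subset oddU' t]]
      obtain M2 where M2: "in_min_face (insert d (V - U)) (collapse_edges E (V - U) d) (collapse_vec E (V - U) d x) M2"
        "collapse (V - U) d ` f \<in> M2"
        using pos[of "V - U" d] f d cut_complement[OF G] by blast
      show ?thesis by (rule glue_in_min_face[OF G x U(1-3) c d f M1 M2])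
    next
      case triv: False
      show ?thesis
      proof (cases "\<exists>e. 0 < x e \<and> x e < 1")
        case True
        obtain d where d: "\<And>e. \<not> (0 < x e \<and> x e < 1) \<Longrightarrow> d e = 0" "\<exists>e. d e \<noteq> (0::real)"
          "\<And>v. v \<in> V \<Longrightarrow> (\<Sum>e\<in>cut E {v}. d e) = 0" using fractional_direction[OF G x True] by blast
        have d0: "d e = 0" if "e \<notin> E" for e using that PM_outside[OF x that] d(1)[of e] by simp
        have neg: "\<exists>e. d e < 0"
        proof (rule ccontr)
          assume "\<not> ?thesis"
          then have "0 \<le> d e" for e by (meson not_le)
          from nonneg_direction_zero[OF G d0 d(3) this] show False using d(2) by blast
        qed
        have dt: "(\<Sum>e\<in>cut E S. d e) = 0" if S: "S \<subseteq> V" "odd (card S)" "(\<Sum>e\<in>cut E S. x e) = 1" for S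
        proof -
          have "card S = 1 \<or> card (V - S) = 1" using triv S by blast
          then obtain v where "v \<in> V" "cut E S = cut E {v}"
            using S(1) cut_complement[OF G, of S] by (metis DiffD1 card_1_singletonE insert_subset singletonI)
          then show ?thesis using d(3) by simp
        qed
        obtain t where "t > 0" and t: "(\<lambda>e. x e + t * d e) \<in> PM V E"
          "num_slack V E (\<lambda>e. x e + t * d e) < num_slack V E x"
          "\<And>M. in_min_face V E (\<lambda>e. x e + t * d e) M \<Longrightarrow> in_min_face V E x M"
          by (rule PM_move[OF G x d0 d(3) _ dt neg]) (use d(1) in auto)
        show ?thesis using IHx[OF t(2,1)] t(3) by blast
      next
        case False
        have x01: "x e = 0 \<or> x e = 1" for e
        proof -
          have "\<not> (0 < x e \<and> x e < 1)" using False by blast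
          then show ?thesis using PM_nonneg[OF x, of e] PM_le_one[OF G x, of e] by auto
        qed
        define M where "M = {e. x e = 1}"
        have xM: "x = indicator M"
        proof
          fix e
          show "x e = indicator M e" using x01[of e] by (auto simp: M_def)
        qed
        have "M \<subseteq> E" using PM_outside[OF x] by (force simp: M_def)
        moreover have "\<exists>!e. e \<in> M \<and> v \<in> e" if v: "v \<in> V" for v
        proof -
          have "real (card (cut E {v} \<inter> M)) = 1" using PM_degree[OF x v] fin unfolding xM by (simp add: sum_indicator_card)
          then obtain e where "cut E {v} \<inter> M = {e}" by (metis card_1_singletonE of_nat_eq_1_iff)
          then have "f \<in> M \<and> v \<in> f \<longleftrightarrow> f = e" for f using \<open>M \<subseteq> E\<close> mem_cut_singleton[OF G, of f v] by blast
          then show ?thesis by simp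
        qed
        ultimately have "perfect_matching V E M" by (simp add: perfect_matching_def)
        then show ?thesis by (intro exI[of _ M]) (auto simp: in_min_face_def xM)
      qed
    qed
    moreover have "\<exists>M. in_min_face V E x M \<and> e \<in> M" if e: "x e > 0" for e
    proof -
      obtain M where M: "in_min_face V E x M" using ex by blast
      show ?thesis
      proof (cases "e \<in> M")
        case False
        have eE: "e \<in> E" using e PM_outside[OF x, of e] by force
        obtain a b where ab: "e = {a, b}" "a \<in> V" using simple_graph_edge[OF G eE] by metis
        have pm: "perfect_matching V E M" using M by (simp add: in_min_face_def)
        then obtain f where f: "f \<in> M" "a \<in> f" using ab by (auto simp: perfect_matching_def)
        have fe: "f \<noteq> e" "f \<in> E" using f False pm by (auto simp: perfect_matching_def)
        have "(\<Sum>g\<in>{e, f}. x g) \<le> (\<Sum>g\<in>cut E {a}. x g)"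
          using f fe eE ab fin PM_nonneg[OF x] by (intro sum_mono2) (auto simp: mem_cut_singleton[OF G])
        then have xf: "x f < 1" using PM_degree[OF x ab(2)] fe e by simp
        \<comment> \<open>Moving away from \<open>M\<close> raises the value of \<open>e\<close>,
          which is not in \<open>M\<close>, and shrinks the face; a matching through
          \<open>e\<close> found there also belongs to the smallest face of
          \<open>x\<close>.\<close>
        define d where "d e = x e - indicator M e" for e
        have sumd: "(\<Sum>e\<in>cut E S. d e) = (\<Sum>e\<in>cut E S. x e) - (\<Sum>e\<in>cut E S. indicator M e)" for S
          by (simp add: d_def sum_subtractf)
        have dt: "(\<Sum>e\<in>cut E S. d e) = 0" if S: "S \<subseteq> V" "odd (card S)" "(\<Sum>e\<in>cut E S. x e) = 1" for S
          using S M by (simp add: sumd in_min_face_def)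
        have dv: "(\<Sum>e\<in>cut E {v}. d e) = 0" if "v \<in> V" for v using that PM_degree[OF x] by (intro dt) auto
        have dz: "d e = 0" if "x e = 0" for e
        proof -
          have "e \<notin> M" using that M by (auto simp: in_min_face_def)
          then show ?thesis using that by (simp add: d_def)
        qed
        have neg: "\<exists>e. d e < 0" using xf f by (intro exI[of _ f]) (simp add: d_def)
        obtain t where t: "t > 0" "(\<lambda>e. x e + t * d e) \<in> PM V E"
          "num_slack V E (\<lambda>e. x e + t * d e) < num_slack V E x"
          "\<And>M. in_min_face V E (\<lambda>e. x e + t * d e) M \<Longrightarrow> in_min_face V E x M"
          by (rule PM_move[OF G x _ dv dz dt neg]) (use dz PM_outside[OF x] in auto)
        have "x e + t * d e > 0" using e False t(1) by (simp add: d_def add_pos_pos)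
        then show ?thesis using IHx[OF t(3,2)] t(4) by blast
      qed (use M in blast)
    qed
    ultimately show ?case by blast
  qed
qed

section \<open>Faces and their matchings\<close>

lemma perfect_matching_cover: "perfect_matching V E M \<Longrightarrow> v \<in> V \<Longrightarrow> \<exists>e\<in>M. v \<in> e"
  unfolding perfect_matching_def by blast

lemma perfect_matching_unique:
  "perfect_matching V E M \<Longrightarrow> v \<in> V \<Longrightarrow> e \<in> M \<Longrightarrow> f \<in> M \<Longrightarrow> v \<in> e \<Longrightarrow> v \<in> f \<Longrightarrow> e = f"
  unfolding perfect_matching_def by blast

text \<open>Every vertex of \<open>S\<close> is covered once, by a cut edge alone or by an inner
  edge together with another vertex of \<open>S\<close>. The parity statement that follows is the
  origin of the odd-set constraints.\<close>

lemma perfect_matching_card: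
  assumes G: "simple_graph V E" and M: "perfect_matching V E M" and S: "S \<subseteq> V"
  shows "card S = card (M \<inter> cut E S) + 2 * card (M \<inter> edges_inside E S)"
proof -
  note fin = simple_graph_finite[OF G]
  have ME: "M \<subseteq> E" using M by (simp add: perfect_matching_def)
  have finM: "finite M" using ME fin finite_subset by blast
  have "S = (\<Union>e\<in>M. e \<inter> S)" using perfect_matching_cover[OF M] S by auto
  then have "card S = card (\<Union>e\<in>M. e \<inter> S)" by simp
  also have "\<dots> = (\<Sum>e\<in>M. card (e \<inter> S))"
  proof (rule card_UN_disjoint[OF finM])
    show "\<forall>i\<in>M. finite (i \<inter> S)" using S fin finite_subset by blast
    show "\<forall>i\<in>M. \<forall>j\<in>M. i \<noteq> j \<longrightarrow> i \<inter> S \<inter> (j \<inter> S) = {}"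
    proof (intro ballI impI)
      fix i j assume "i \<in> M" "j \<in> M" "i \<noteq> j"
      then show "i \<inter> S \<inter> (j \<inter> S) = {}" using perfect_matching_unique[OF M, of _ i j] S by auto
    qed
  qed
  also have "\<dots> = (\<Sum>e\<in>M. (if e \<in> cut E S then 1 else 0) + 2 * (if e \<in> edges_inside E S then 1 else 0))"
  proof (rule sum.cong[OF refl])
    fix e assume "e \<in> M"
    then have e: "e \<in> E" using ME by blast
    obtain a b where ab: "e = {a, b}" "a \<noteq> b" using simple_graph_edge[OF G e] by metis
    have "{a, b} \<inter> S = (if a \<in> S then {a} else {}) \<union> (if b \<in> S then {b} else {})" by auto
    then show "card (e \<inter> S) = (if e \<in> cut E S then 1 else 0) + 2 * (if e \<in> edges_inside E S then 1 else 0)"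
      using ab e by (auto simp: pair_mem_cut edges_inside_def)
  qed
  also have "\<dots> = card (M \<inter> cut E S) + 2 * card (M \<inter> edges_inside E S)"
    using finM by (simp add: sum.distrib sum_distrib_left[symmetric] sum.If_cases)
  finally show ?thesis .
qed

lemma indicator_in_PM:
  assumes G: "simple_graph V E" and M: "perfect_matching V E M"
  shows "indicator M \<in> PM V E"
  unfolding PM_def
proof (intro CollectI conjI allI ballI impI)
  note fin = simple_graph_finite[OF G]
  show "indicator M e = (0::real)" if "e \<notin> E" for e using that M by (auto simp: perfect_matching_def indicator_def)
  show "(\<Sum>e\<in>cut E {v}. indicator M e) = (1::real)" if v: "v \<in> V" for v
  proof -
    obtain e where e: "e \<in> M" "v \<in> e" using perfect_matching_cover[OF M v] by blast
    have "M \<subseteq> E" using M by (simp add: perfect_matching_def)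
    then have "cut E {v} \<inter> M = {e}"
      using mem_cut_singleton[OF G, of _ v] e perfect_matching_unique[OF M v e(1) _ e(2)] by blast
    then show ?thesis using fin by (simp add: sum_indicator_card)
  qed
  show "1 \<le> (\<Sum>e\<in>cut E S. indicator M e :: real)" if S: "S \<subseteq> V" "odd (card S)" for S
  proof -
    have "odd (card (M \<inter> cut E S))" using perfect_matching_card[OF G M S(1)] S(2) by simp
    then have "1 \<le> card (cut E S \<inter> M)" by (metis Int_commute One_nat_def Suc_leI odd_pos)
    then show ?thesis using fin by (simp add: sum_indicator_card)
  qed
qed simp

lemma face_subset_PM: "is_face V E F \<Longrightarrow> F \<subseteq> PM V E"
  by (auto simp: is_face_def)

text \<open>A face contains the smallest face around each of its points, so membership can be tested
  against the equalities at \<open>x\<close> instead of the defining ones.\<close>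

lemma face_closed:
  assumes F: "is_face V E F" and x: "x \<in> F" and z: "z \<in> PM V E"
    and zero: "\<And>e. x e = 0 \<Longrightarrow> z e = 0"
    and tight: "\<And>S. S \<subseteq> V \<Longrightarrow> odd (card S) \<Longrightarrow> (\<Sum>e\<in>cut E S. x e) = 1 \<Longrightarrow> (\<Sum>e\<in>cut E S. z e) = 1"
  shows "z \<in> F"
proof -
  obtain A \<S> where A: "A \<subseteq> E" "\<S> \<subseteq> {S. S \<subseteq> V \<and> odd (card S)}"
    and Feq: "F = {x \<in> PM V E. (\<forall>e\<in>A. x e = 0) \<and> (\<forall>S\<in>\<S>. (\<Sum>e\<in>cut E S. x e) = 1)}"
    using F unfolding is_face_def by blast
  have xF: "\<forall>e\<in>A. x e = 0" "\<forall>S\<in>\<S>. (\<Sum>e\<in>cut E S. x e) = 1" using x unfolding Feq by blast+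
  have "\<forall>e\<in>A. z e = 0" using xF(1) zero by blast
  moreover have "\<forall>S\<in>\<S>. (\<Sum>e\<in>cut E S. z e) = 1"
  proof
    fix S assume "S \<in> \<S>"
    then show "(\<Sum>e\<in>cut E S. z e) = 1" using tight[of S] xF(2) A(2) by auto
  qed
  ultimately show ?thesis unfolding Feq using z by blast
qed

lemma min_face_matching_in_face:
  assumes G: "simple_graph V E" and F: "is_face V E F" and x: "x \<in> F" and M: "in_min_face V E x M"
  shows "matching_in_face V E F M"
proof -
  have pm: "perfect_matching V E M" using M by (simp add: in_min_face_def)
  have "indicator M \<in> F"
  proof (rule face_closed[OF F x indicator_in_PM[OF G pm]])
    show "indicator M e = (0::real)" if "x e = 0" for e using M that by (auto simp: in_min_face_def indicator_def)
  qed (use M in \<open>auto simp: in_min_face_def\<close>)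
  then show ?thesis using pm by (simp add: matching_in_face_def)
qed

lemma face_has_matching:
  assumes G: "simple_graph V E" and F: "is_face V E F"
  shows "\<exists>M. matching_in_face V E F M"
proof -
  obtain x where x: "x \<in> F" using F by (auto simp: is_face_def)
  then have "\<exists>M. in_min_face V E x M" using PM_min_face_matching[OF G] face_subset_PM[OF F] by blast
  then show ?thesis using min_face_matching_in_face[OF G F x] by blast
qed

lemma supp_iff_matching:
  assumes G: "simple_graph V E" and F: "is_face V E F"
  shows "e \<in> supp E F \<longleftrightarrow> (\<exists>M. matching_in_face V E F M \<and> e \<in> M)"
proof
  assume "e \<in> supp E F"
  then obtain x where x: "x \<in> F" "x e > 0" by (auto simp: supp_def)
  then have "\<exists>M. in_min_face V E x M \<and> e \<in> M" using PM_min_face_matching[OF G] face_subset_PM[OF F] by blast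
  then show "\<exists>M. matching_in_face V E F M \<and> e \<in> M" using min_face_matching_in_face[OF G F x(1)] by blast
next
  assume "\<exists>M. matching_in_face V E F M \<and> e \<in> M"
  then obtain M where M: "indicator M \<in> F" "e \<in> M" "M \<subseteq> E" by (auto simp: matching_in_face_def perfect_matching_def)
  then show "e \<in> supp E F" by (auto simp: supp_def intro!: bexI[of _ "indicator M"])
qed

lemma tight_matching:
  assumes G: "simple_graph V E" and S: "S \<in> tight V E F" and M: "matching_in_face V E F M"
  obtains e where "M \<inter> cut E S = {e}"
proof -
  have "(\<Sum>e\<in>cut E S. indicator M e) = (1::real)" using S M by (simp add: tight_def matching_in_face_def)
  then have "card (cut E S \<inter> M) = 1" using simple_graph_finite[OF G] by (simp add: sum_indicator_card)
  then show ?thesis using that by (metis Int_commute card_1_singletonE)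
qed

section \<open>Small steps and relative interior points\<close>

text \<open>As \<open>d\<close> respects everything that is tight at \<open>x\<close>, a positive
  step stays in the polytope and then, by \<open>face_closed\<close>, in \<open>F\<close>. If
  \<open>d\<close> has no negative coordinate, it vanishes and any step will do.\<close>

lemma face_step:
  assumes G: "simple_graph V E" and F: "is_face V E F" and x: "x \<in> F"
    and dz: "\<And>e. x e = 0 \<Longrightarrow> d e = 0"
    and dt: "\<And>S. S \<subseteq> V \<Longrightarrow> odd (card S) \<Longrightarrow> (\<Sum>e\<in>cut E S. x e) = 1 \<Longrightarrow> (\<Sum>e\<in>cut E S. d e) = 0"
  obtains t where "t > 0" "(\<lambda>e. x e + t * d e) \<in> F"
proof -
  note fin = simple_graph_finite[OF G]
  have xP: "x \<in> PM V E" using face_subset_PM[OF F] x by blast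
  have d0: "d e = 0" if "e \<notin> E" for e using dz PM_outside[OF xP that] by blast
  have dv: "(\<Sum>e\<in>cut E {v}. d e) = 0" if v: "v \<in> V" for v using PM_degree[OF xP v] v by (intro dt) auto
  have "\<exists>t>0. (\<lambda>e. x e + t * d e) \<in> PM V E"
  proof (cases "\<exists>e. d e < 0")
    case True
    show ?thesis by (rule PM_move[OF G xP d0 dv dz dt True]) blast+
  next
    case False
    then have "0 \<le> d e" for e by (meson not_le)
    from nonneg_direction_zero[OF G d0 dv this] have "d e = 0" for e .
    then show ?thesis using xP by (intro exI[of _ 1]) simp
  qed
  then obtain t where t: "t > 0" "(\<lambda>e. x e + t * d e) \<in> PM V E" by blast
  have "(\<lambda>e. x e + t * d e) \<in> F"
    by (rule face_closed[OF F x t(2)]) (use dz dt in \<open>auto simp: sum.distrib sum_distrib_left[symmetric]\<close>)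
  then show ?thesis using that t(1) by blast
qed

text \<open>Take a point with the largest number of slack constraints: if some \<open>y\<close> were
  slack where \<open>x\<close> is tight, their midpoint would have strictly more. Closure under
  midpoints is assumed instead of being a face, because the lemma is also applied to a minimising
  set that is not yet known to be one.\<close>

lemma exists_interior_point:
  assumes G: "simple_graph V E" and ne: "F \<noteq> {}" and sub: "F \<subseteq> PM V E"
    and mid: "\<And>x y. x \<in> F \<Longrightarrow> y \<in> F \<Longrightarrow> (\<lambda>e. (x e + y e) / 2) \<in> F"
  obtains x where "x \<in> F" "\<And>y e. y \<in> F \<Longrightarrow> x e = 0 \<Longrightarrow> y e = 0"
    "\<And>y S. y \<in> F \<Longrightarrow> S \<subseteq> V \<Longrightarrow> odd (card S) \<Longrightarrow> (\<Sum>e\<in>cut E S. x e) = 1 \<Longrightarrow> (\<Sum>e\<in>cut E S. y e) = 1"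
proof -
  note fin = simple_graph_finite[OF G]
  let ?I = "E <+> odd_sets V"
  have finI: "finite ?I" using fin by (intro finite_Plus finite_odd_sets)
  have bd: "\<forall>x. x \<in> F \<longrightarrow> num_slack V E x < Suc (card ?I)"
    unfolding num_slack_def using finI by (intro allI impI le_imp_less_Suc card_mono) auto
  obtain k where "k \<in> F" using ne by blast
  from ex_has_greatest_nat[of "\<lambda>x. x \<in> F", OF this bd]
  obtain x where x: "x \<in> F" and max: "\<And>y. y \<in> F \<Longrightarrow> num_slack V E y \<le> num_slack V E x" by blast
  have key: "slack E y i = 0" if y: "y \<in> F" and i: "i \<in> ?I" and xi: "slack E x i = 0" for y i
  proof (rule ccontr)
    assume yi: "slack E y i \<noteq> 0"
    define z where "z e = (x e + y e) / 2" for e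
    have z: "z \<in> F" using mid[OF x y] by (simp add: z_def[abs_def])
    have sz: "slack E z j = (slack E x j + slack E y j) / 2" for j
      by (cases j) (auto simp: slack_def z_def sum.distrib sum_divide_distrib[symmetric] field_simps)
    have nn: "slack E u j \<ge> 0" if u: "u \<in> F" and j: "j \<in> ?I" for u j
    proof -
      have uP: "u \<in> PM V E" using u sub by blast
      show ?thesis using j PM_nonneg[OF uP] PM_odd_cut[OF uP] by (auto simp: slack_def odd_sets_def)
    qed
    have "{j \<in> ?I. slack E x j \<noteq> 0} \<subset> {j \<in> ?I. slack E z j \<noteq> 0}"
    proof
      show "{j \<in> ?I. slack E x j \<noteq> 0} \<subseteq> {j \<in> ?I. slack E z j \<noteq> 0}"
      proof (rule subsetI)
        fix j assume j: "j \<in> {j \<in> ?I. slack E x j \<noteq> 0}"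
        then show "j \<in> {j \<in> ?I. slack E z j \<noteq> 0}" using nn[OF x, of j] nn[OF y, of j] sz[of j] by auto
      qed
      have "i \<in> {j \<in> ?I. slack E z j \<noteq> 0}" "i \<notin> {j \<in> ?I. slack E x j \<noteq> 0}" using i xi yi sz[of i] by auto
      then show "{j \<in> ?I. slack E x j \<noteq> 0} \<noteq> {j \<in> ?I. slack E z j \<noteq> 0}" by blast
    qed
    then have "num_slack V E x < num_slack V E z" unfolding num_slack_def using finI by (intro psubset_card_mono) auto
    then show False using max[OF z] by simp
  qed
  show ?thesis
  proof (rule that[OF x])
    show "y e = 0" if "y \<in> F" "x e = 0" for y e
    proof (cases "e \<in> E")
      case True
      then show ?thesis using key[OF that(1), of "Inl e"] that(2) by (auto simp: slack_def)
    qed (use sub that PM_outside in blast)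
    show "(\<Sum>e\<in>cut E S. y e) = 1"
      if "y \<in> F" "S \<subseteq> V" "odd (card S)" "(\<Sum>e\<in>cut E S. x e) = 1" for y S
      using key[OF that(1), of "Inr S"] that by (auto simp: slack_def odd_sets_def)
  qed
qed

lemma face_midpoint:
  assumes "is_face V E F" "x \<in> F" "y \<in> F"
  shows "(\<lambda>e. (x e + y e) / 2) \<in> F"
proof -
  obtain A \<S> where Feq: "F = {x \<in> PM V E. (\<forall>e\<in>A. x e = 0) \<and> (\<forall>S\<in>\<S>. (\<Sum>e\<in>cut E S. x e) = 1)}"
    using assms(1) unfolding is_face_def by blast
  have s: "(\<Sum>e\<in>cut E S. (x e + y e) / 2) = ((\<Sum>e\<in>cut E S. x e) + (\<Sum>e\<in>cut E S. y e)) / 2" for S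
    by (simp add: sum.distrib sum_divide_distrib[symmetric])
  have xP: "x \<in> PM V E" and yP: "y \<in> PM V E" using assms(2,3) unfolding Feq by blast+
  have xF: "\<And>e. e \<in> A \<Longrightarrow> x e = 0" "\<And>S. S \<in> \<S> \<Longrightarrow> (\<Sum>e\<in>cut E S. x e) = 1" using assms(2) unfolding Feq by blast+
  have yF: "\<And>e. e \<in> A \<Longrightarrow> y e = 0" "\<And>S. S \<in> \<S> \<Longrightarrow> (\<Sum>e\<in>cut E S. y e) = 1" using assms(3) unfolding Feq by blast+
  have "(\<lambda>e. (x e + y e) / 2) \<in> PM V E"
    unfolding PM_def
  proof (intro CollectI conjI allI ballI impI)
    show "(x e + y e) / 2 = 0" if "e \<notin> E" for e using PM_outside[OF xP that] PM_outside[OF yP that] by simp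
    show "(\<Sum>e\<in>cut E {v}. (x e + y e) / 2) = 1" if "v \<in> V" for v
      unfolding s using PM_degree[OF xP that] PM_degree[OF yP that] by simp
    show "1 \<le> (\<Sum>e\<in>cut E S. (x e + y e) / 2)" if "S \<subseteq> V" "odd (card S)" for S
      unfolding s using PM_odd_cut[OF xP that] PM_odd_cut[OF yP that] by simp
    show "0 \<le> (x e + y e) / 2" for e using PM_nonneg[OF xP, of e] PM_nonneg[OF yP, of e] by simp
  qed
  then show ?thesis unfolding Feq by (simp add: s xF yF)
qed

definition vec_weight :: "'v set set \<Rightarrow> ('v set \<Rightarrow> real) \<Rightarrow> ('v set \<Rightarrow> real) \<Rightarrow> real" where
  "vec_weight E w x = (\<Sum>e\<in>E. w e * x e)"

lemma vec_weight_linear: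
  "vec_weight E w (\<lambda>e. x e + t * d e) = vec_weight E w x + t * vec_weight E w d"
  "vec_weight E w (\<lambda>e. x e - d e) = vec_weight E w x - vec_weight E w d"
  by (simp_all add: vec_weight_def algebra_simps sum.distrib sum_distrib_left sum_subtractf)

text \<open>Takes the place of writing \<open>x\<close> as a convex combination of matchings. If
  \<open>x\<close> weighs less than a matching \<open>M\<close> of its smallest face, then moving
  along \<open>x - M\<close> lowers the weight further and ends in a smaller face, where induction
  applies.\<close>

lemma vec_weight_ge_matchings:
  assumes G: "simple_graph V E" and F: "is_face V E F"
    and m: "\<And>M. matching_in_face V E F M \<Longrightarrow> m \<le> vec_weight E w (indicator M)"
  shows "x \<in> F \<Longrightarrow> m \<le> vec_weight E w x"
proof (induction "num_slack V E x" arbitrary: x rule: less_induct)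
  case (less x)
  note x = less.prems
  have xP: "x \<in> PM V E" using face_subset_PM[OF F] x by blast
  obtain M where M: "in_min_face V E x M" using PM_min_face_matching[OF G xP] by blast
  have mM: "m \<le> vec_weight E w (indicator M)" using m min_face_matching_in_face[OF G F x M] by blast
  show ?case
  proof (cases "vec_weight E w (indicator M) \<le> vec_weight E w x")
    case False
    define d where "d e = x e - indicator M e" for e
    have sumd: "(\<Sum>e\<in>cut E S. d e) = (\<Sum>e\<in>cut E S. x e) - (\<Sum>e\<in>cut E S. indicator M e)" for S
      by (simp add: d_def sum_subtractf)
    have dt: "(\<Sum>e\<in>cut E S. d e) = 0" if S: "S \<subseteq> V" "odd (card S)" "(\<Sum>e\<in>cut E S. x e) = 1" for S
      using S M by (simp add: sumd in_min_face_def)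
    have dv: "(\<Sum>e\<in>cut E {v}. d e) = 0" if "v \<in> V" for v using that PM_degree[OF xP] by (intro dt) auto
    have dz: "d e = 0" if "x e = 0" for e
    proof -
      have "e \<notin> M" using that M by (auto simp: in_min_face_def)
      then show ?thesis using that by (simp add: d_def)
    qed
    have wd: "vec_weight E w d < 0" using False vec_weight_linear(2)[of E w x "indicator M"] by (simp add: d_def[abs_def])
    have neg: "\<exists>e. d e < 0"
    proof (rule ccontr)
      assume no: "\<not> ?thesis"
      have nn: "0 \<le> d e" for e using no by (meson not_le)
      have "d e = 0" for e by (rule nonneg_direction_zero[OF G _ dv nn]) (use dz PM_outside[OF xP] in blast)
      then show False using wd by (simp add: vec_weight_def)
    qed
    obtain t where t: "t > 0" "(\<lambda>e. x e + t * d e) \<in> PM V E"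
      "num_slack V E (\<lambda>e. x e + t * d e) < num_slack V E x"
      by (rule PM_move[OF G xP _ dv dz dt neg]) (use dz PM_outside[OF xP] in blast)+
    have "(\<lambda>e. x e + t * d e) \<in> F"
      by (rule face_closed[OF F x t(2)]) (use dz dt in \<open>auto simp: sum.distrib sum_distrib_left[symmetric]\<close>)
    then have "m \<le> vec_weight E w x + t * vec_weight E w d" using less.hyps[OF t(3)] vec_weight_linear(1) by metis
    also have "\<dots> \<le> vec_weight E w x" using t(1) wd by (simp add: mult_le_0_iff)
    finally show ?thesis .
  qed (use mM in simp)
qed

section \<open>Minimising faces\<close>

lemma Min_face_eq:
  "Min_face E F w = {x \<in> F. \<forall>y\<in>F. vec_weight E (\<lambda>e. of_int (w e)) x \<le> vec_weight E (\<lambda>e. of_int (w e)) y}"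
  by (auto simp: Min_face_def is_arg_min_def vec_weight_def not_less)

lemma finite_matchings:
  assumes "simple_graph V E"
  shows "finite {M. matching_in_face V E F M}"
proof -
  have "{M. matching_in_face V E F M} \<subseteq> Pow E" by (auto simp: matching_in_face_def perfect_matching_def)
  then show ?thesis using simple_graph_finite[OF assms] finite_subset by blast
qed

lemma Min_face_level:
  assumes G: "simple_graph V E" and F: "is_face V E F"
  obtains M m where "matching_in_face V E F M" "m = vec_weight E (\<lambda>e. of_int (w e)) (indicator M)"
    "Min_face E F w = {x \<in> F. vec_weight E (\<lambda>e. of_int (w e)) x = m}"
    "\<And>x. x \<in> F \<Longrightarrow> m \<le> vec_weight E (\<lambda>e. of_int (w e)) x"
proof -
  let ?w = "vec_weight E (\<lambda>e. of_int (w e))"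
  let ?A = "(\<lambda>M. ?w (indicator M)) ` {M. matching_in_face V E F M}"
  have A: "finite ?A" "?A \<noteq> {}" using finite_matchings[OF G] face_has_matching[OF G F] by auto
  define m where "m = Min ?A"
  have "m \<in> ?A" unfolding m_def using A by (rule Min_in)
  then obtain M where M: "matching_in_face V E F M" "m = ?w (indicator M)" by auto
  have "m \<le> ?w (indicator N)" if "matching_in_face V E F N" for N
    unfolding m_def using A that by (intro Min_le) auto
  then have le: "m \<le> ?w x" if "x \<in> F" for x using vec_weight_ge_matchings[OF G F _ that] by blast
  have MF: "indicator M \<in> F" using M by (simp add: matching_in_face_def)
  have "Min_face E F w = {x \<in> F. ?w x = m}"
    unfolding Min_face_eq using le MF M(2) by (auto intro: antisym)
  then show ?thesis using that M le by blast
qed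

text \<open>The defining equations are those that hold at a relative interior point \<open>x\<close>
  of the minimising set. If \<open>y\<close> satisfies them, the segment from \<open>y\<close> to
  \<open>x\<close> can be prolonged beyond \<open>x\<close> inside \<open>F\<close>; were
  \<open>y\<close> heavier than the minimum, the prolonged point would be too light.\<close>

lemma Min_face_is_face:
  assumes G: "simple_graph V E" and F: "is_face V E F"
  shows "is_face V E (Min_face E F w)"
proof -
  let ?w = "vec_weight E (\<lambda>e. of_int (w e))"
  let ?F = "Min_face E F w"
  obtain M m where M: "matching_in_face V E F M" "m = ?w (indicator M)"
    and Feq: "?F = {x \<in> F. ?w x = m}" and le: "\<And>x. x \<in> F \<Longrightarrow> m \<le> ?w x"
    by (rule Min_face_level[OF G F, where w = w]) (rule that)
  have ne: "?F \<noteq> {}" using M unfolding Feq by (auto simp: matching_in_face_def)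
  have sub: "?F \<subseteq> F" unfolding Feq by blast
  have subP: "?F \<subseteq> PM V E" using sub face_subset_PM[OF F] by blast
  have mid: "(\<lambda>e. (x e + y e) / 2) \<in> ?F" if "x \<in> ?F" "y \<in> ?F" for x y
  proof -
    have "?w (\<lambda>e. (x e + y e) / 2) = (?w x + ?w y) / 2"
      by (simp add: vec_weight_def sum.distrib[symmetric] sum_divide_distrib algebra_simps)
    then show ?thesis using that face_midpoint[OF F] unfolding Feq by simp
  qed
  obtain x where x: "x \<in> ?F" and x0: "\<And>y e. y \<in> ?F \<Longrightarrow> x e = 0 \<Longrightarrow> y e = 0"
    and x1: "\<And>y S. y \<in> ?F \<Longrightarrow> S \<subseteq> V \<Longrightarrow> odd (card S) \<Longrightarrow> (\<Sum>e\<in>cut E S. x e) = 1 \<Longrightarrow> (\<Sum>e\<in>cut E S. y e) = 1"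
    by (rule exists_interior_point[OF G ne subP mid]) (assumption | rule that)+
  have xF: "x \<in> F" and xm: "?w x = m" using x unfolding Feq by auto
  define A where "A = {e \<in> E. x e = 0}"
  define \<S> where "\<S> = {S. S \<subseteq> V \<and> odd (card S) \<and> (\<Sum>e\<in>cut E S. x e) = 1}"
  have "?F = {y \<in> PM V E. (\<forall>e\<in>A. y e = 0) \<and> (\<forall>S\<in>\<S>. (\<Sum>e\<in>cut E S. y e) = 1)}"
  proof
    show "?F \<subseteq> {y \<in> PM V E. (\<forall>e\<in>A. y e = 0) \<and> (\<forall>S\<in>\<S>. (\<Sum>e\<in>cut E S. y e) = 1)}"
      using subP x0 x1 by (auto simp: A_def \<S>_def)
    show "{y \<in> PM V E. (\<forall>e\<in>A. y e = 0) \<and> (\<forall>S\<in>\<S>. (\<Sum>e\<in>cut E S. y e) = 1)} \<subseteq> ?F"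
    proof
      fix y assume y: "y \<in> {y \<in> PM V E. (\<forall>e\<in>A. y e = 0) \<and> (\<forall>S\<in>\<S>. (\<Sum>e\<in>cut E S. y e) = 1)}"
      then have yP: "y \<in> PM V E" by blast
      have y0: "y e = 0" if "x e = 0" for e using y that PM_outside[OF yP, of e] by (cases "e \<in> E") (auto simp: A_def)
      have y1: "(\<Sum>e\<in>cut E S. y e) = 1" if "S \<subseteq> V" "odd (card S)" "(\<Sum>e\<in>cut E S. x e) = 1" for S
        using y that by (auto simp: \<S>_def)
      have yF: "y \<in> F" by (rule face_closed[OF F xF yP y0 y1])
      obtain t where t: "t > 0" "(\<lambda>e. x e + t * (x e - y e)) \<in> F"
        by (rule face_step[OF G F xF, of "\<lambda>e. x e - y e"]) (use y0 y1 in \<open>auto simp: sum_subtractf\<close>)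
      have "m \<le> ?w x + t * (?w x - ?w y)" using le[OF t(2)] unfolding vec_weight_linear by simp
      then have "0 \<le> t * (m - ?w y)" using xm by simp
      then have "?w y \<le> m" using t(1) by (simp add: zero_le_mult_iff)
      then show "y \<in> ?F" using le[OF yF] yF unfolding Feq by simp
    qed
  qed
  then show ?thesis unfolding is_face_def using ne
    by (intro conjI exI[of _ A] exI[of _ \<S>]) (auto simp: A_def \<S>_def)
qed

text \<open>The lower bound by matchings is applied to \<open>w\<close> and to its negative.\<close>

lemma face_vec_weight_const:
  assumes G: "simple_graph V E" and F: "is_face V E F"
    and m: "\<And>M. matching_in_face V E F M \<Longrightarrow> vec_weight E w (indicator M) = m" and x: "x \<in> F"
  shows "vec_weight E w x = m"
proof -
  have neg: "vec_weight E (\<lambda>e. - w e) y = - vec_weight E w y" for y by (simp add: vec_weight_def sum_negf)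
  have "m \<le> vec_weight E w x" using vec_weight_ge_matchings[OF G F _ x, of m w] m by simp
  moreover have "- m \<le> vec_weight E (\<lambda>e. - w e) x"
    using vec_weight_ge_matchings[OF G F _ x, of "- m" "\<lambda>e. - w e"] m by (simp add: neg)
  ultimately show ?thesis by (simp add: neg)
qed

lemma weight_indicator:
  assumes "finite E" "M \<subseteq> E"
  shows "vec_weight E (\<lambda>e. of_int (w e)) (indicator M) = of_int (\<Sum>e\<in>M. w e)"
proof -
  have "(\<Sum>e\<in>M. w e) = (\<Sum>e\<in>E. w e * indicator M e)"
    using assms by (simp add: indicator_def sum.If_cases Int_absorb1 mult.commute[of _ "of_bool _"] if_distrib)
  also have "real_of_int \<dots> = (\<Sum>e\<in>E. real_of_int (w e) * indicator M e)" by (simp add: indicator_def)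
  finally show ?thesis by (simp add: vec_weight_def)
qed

lemma matching_weight:
  assumes G: "simple_graph V E" and M: "matching_in_face V E F M"
  shows "vec_weight E (\<lambda>e. of_int (w e)) (indicator M) = of_int (\<Sum>e\<in>M. w e)"
  using assms by (intro weight_indicator simple_graph_finite[OF G]) (auto simp: matching_in_face_def perfect_matching_def)

lemma matching_in_Min_face_iff:
  assumes G: "simple_graph V E" and F: "is_face V E F"
  shows "matching_in_face V E (Min_face E F w) M \<longleftrightarrow> matching_in_face V E F M \<and>
    (\<forall>N. matching_in_face V E F N \<longrightarrow> (\<Sum>e\<in>M. w e) \<le> (\<Sum>e\<in>N. w e))"
proof -
  let ?w = "vec_weight E (\<lambda>e. of_int (w e))"
  obtain M0 m where M0: "matching_in_face V E F M0" "m = ?w (indicator M0)"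
    and Feq: "Min_face E F w = {x \<in> F. ?w x = m}" and le: "\<And>x. x \<in> F \<Longrightarrow> m \<le> ?w x"
    by (rule Min_face_level[OF G F, where w = w]) (rule that)
  note mw = matching_weight[OF G, of F _ w]
  show ?thesis
  proof
    assume M: "matching_in_face V E (Min_face E F w) M"
    then have MF: "matching_in_face V E F M" "?w (indicator M) = m" unfolding Feq by (auto simp: matching_in_face_def)
    have "(\<Sum>e\<in>M. w e) \<le> (\<Sum>e\<in>N. w e)" if N: "matching_in_face V E F N" for N
    proof -
      have "?w (indicator M) \<le> ?w (indicator N)" using le[of "indicator N"] N MF by (simp add: matching_in_face_def)
      then show ?thesis unfolding mw[OF MF(1)] mw[OF N] of_int_le_iff .
    qed
    then show "matching_in_face V E F M \<and> (\<forall>N. matching_in_face V E F N \<longrightarrow> (\<Sum>e\<in>M. w e) \<le> (\<Sum>e\<in>N. w e))" using MF by blast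
  next
    assume M: "matching_in_face V E F M \<and> (\<forall>N. matching_in_face V E F N \<longrightarrow> (\<Sum>e\<in>M. w e) \<le> (\<Sum>e\<in>N. w e))"
    then have "(\<Sum>e\<in>M. w e) \<le> (\<Sum>e\<in>M0. w e)" using M0 by blast
    then have "?w (indicator M) \<le> m" unfolding M0(2) mw[OF conjunct1[OF M]] mw[OF M0(1)] of_int_le_iff .
    then show "matching_in_face V E (Min_face E F w) M"
      using le[of "indicator M"] M unfolding Feq by (auto simp: matching_in_face_def)
  qed
qed

lemma Min_face_subset: "Min_face E F w \<subseteq> F"
  by (auto simp: Min_face_eq)

text \<open>Each defining equation of \<open>F'\<close> fixes the value of a linear functional that
  is constant on the matchings of \<open>F\<close>, hence on \<open>F\<close>. So a face is
  determined by its matchings.\<close>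

lemma face_subset_if_matchings:
  assumes G: "simple_graph V E" and F: "is_face V E F" and F': "is_face V E F'"
    and sub: "\<And>M. matching_in_face V E F M \<Longrightarrow> matching_in_face V E F' M"
  shows "F \<subseteq> F'"
proof
  fix x assume x: "x \<in> F"
  note fin = simple_graph_finite[OF G]
  obtain A \<S> where A: "A \<subseteq> E" "\<S> \<subseteq> {S. S \<subseteq> V \<and> odd (card S)}"
    and Feq: "F' = {x \<in> PM V E. (\<forall>e\<in>A. x e = 0) \<and> (\<forall>S\<in>\<S>. (\<Sum>e\<in>cut E S. x e) = 1)}"
    using F' unfolding is_face_def by blast
  have M': "(\<forall>e\<in>A. indicator M e = (0::real)) \<and> (\<forall>S\<in>\<S>. (\<Sum>e\<in>cut E S. indicator M e) = (1::real))"
    if "matching_in_face V E F M" for M using sub[OF that] unfolding matching_in_face_def Feq by blast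
  have vw: "vec_weight E (indicator B) y = (\<Sum>e\<in>B. y e)" if "B \<subseteq> E" for B and y :: "'a set \<Rightarrow> real"
    using that fin by (simp add: vec_weight_def sum_indicator_mult Int_absorb1)
  have "x e = 0" if e: "e \<in> A" for e
  proof -
    have "vec_weight E (indicator {e}) x = 0"
      by (rule face_vec_weight_const[OF G F _ x]) (use M' e A in \<open>auto simp: vw\<close>)
    then show ?thesis using vw[of "{e}" x] e A by auto
  qed
  moreover have "(\<Sum>e\<in>cut E S. x e) = 1" if S: "S \<in> \<S>" for S
  proof -
    have "vec_weight E (indicator (cut E S)) x = 1"
      by (rule face_vec_weight_const[OF G F _ x]) (use M' S in \<open>auto simp: vw cut_subset\<close>)
    then show ?thesis using vw[of "cut E S" x] by (simp add: cut_subset)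
  qed
  ultimately show "x \<in> F'" unfolding Feq using face_subset_PM[OF F] x by blast
qed

lemma matching_card_le:
  assumes G: "simple_graph V E" and M: "perfect_matching V E M"
  shows "card M \<le> card V"
proof -
  note fin = simple_graph_finite[OF G]
  have ME: "M \<subseteq> E" using M by (simp add: perfect_matching_def)
  have "cut E V = {}" using cut_complement[OF G, of V] by simp
  moreover have "M \<inter> edges_inside E V = M" using ME G by (auto simp: edges_inside_def simple_graph_def)
  ultimately show ?thesis using perfect_matching_card[OF G M order_refl] by simp
qed

text \<open>A matching has at most \<open>n\<close> edges, each of weight below
  \<open>n ^ 20\<close>, so its total under \<open>w'\<close> stays below the factor
  \<open>n ^ 21\<close> and can only break ties of \<open>w\<close>. Comparing matchings suffices,
  because they determine the faces.\<close>

lemma Min_face_weight_comp: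
  assumes G: "simple_graph V E" and F: "is_face V E F" and n: "card V = n" "n > 0" and w': "w' \<in> weights n num"
  shows "Min_face E F (weight_comp n w w') = Min_face E (Min_face E F w) w'"
proof -
  let ?F1 = "Min_face E F w" and ?c = "weight_comp n w w'"
  note f1 = Min_face_is_face[OF G F, of w]
  have bd: "0 \<le> (\<Sum>e\<in>M. w' e)" "(\<Sum>e\<in>M. w' e) < int n ^ 21" if M: "matching_in_face V E F M" for M
  proof -
    obtain k where k: "2 \<le> k" "k \<le> n ^ 20" "w' = base_weight n num k" using w' by (auto simp: weights_def)
    have e0: "0 \<le> w' e" for e using k by (simp add: base_weight_def)
    have e1: "w' e \<le> int n ^ 20 - 1" for e
    proof -
      have "w' e < int k" using k by (simp add: base_weight_def)
      also have "int k \<le> int n ^ 20" using k(2) by (metis of_nat_le_iff of_nat_power)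
      finally show ?thesis by simp
    qed
    show "0 \<le> (\<Sum>e\<in>M. w' e)" using e0 by (intro sum_nonneg) auto
    have "(\<Sum>e\<in>M. w' e) \<le> (\<Sum>e\<in>M. int n ^ 20 - 1)" using e1 by (intro sum_mono) auto
    also have "\<dots> = int (card M) * (int n ^ 20 - 1)" by simp
    also have "\<dots> \<le> int n * (int n ^ 20 - 1)"
      using matching_card_le[OF G] M n by (intro mult_right_mono) (auto simp: matching_in_face_def)
    also have "\<dots> < int n ^ 21" using n by (simp add: algebra_simps flip: power_Suc)
    finally show "(\<Sum>e\<in>M. w' e) < int n ^ 21" .
  qed
  have csum: "(\<Sum>e\<in>M. ?c e) = int n ^ 21 * (\<Sum>e\<in>M. w e) + (\<Sum>e\<in>M. w' e)" for M
    by (simp add: weight_comp_def sum.distrib sum_distrib_left)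
  have eq: "matching_in_face V E (Min_face E F ?c) M \<longleftrightarrow> matching_in_face V E (Min_face E ?F1 w') M" for M
  proof
    assume "matching_in_face V E (Min_face E F ?c) M"
    then have MF: "matching_in_face V E F M" and min: "\<And>N. matching_in_face V E F N \<Longrightarrow> (\<Sum>e\<in>M. ?c e) \<le> (\<Sum>e\<in>N. ?c e)"
      using matching_in_Min_face_iff[OF G F] by blast+
    have "(\<Sum>e\<in>M. w e) \<le> (\<Sum>e\<in>N. w e)" if N: "matching_in_face V E F N" for N
    proof (rule ccontr)
      assume "\<not> ?thesis"
      then have "(\<Sum>e\<in>N. w e) + 1 \<le> (\<Sum>e\<in>M. w e)" by simp
      then have "int n ^ 21 * ((\<Sum>e\<in>N. w e) + 1) \<le> int n ^ 21 * (\<Sum>e\<in>M. w e)" by (intro mult_left_mono) auto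
      then have "int n ^ 21 * (\<Sum>e\<in>N. w e) + int n ^ 21 \<le> int n ^ 21 * (\<Sum>e\<in>M. w e)" by (simp add: algebra_simps)
      then show False using min[OF N] bd[OF N] bd[OF MF] unfolding csum by linarith
    qed
    then have M1: "matching_in_face V E ?F1 M" using MF matching_in_Min_face_iff[OF G F] by blast
    have "(\<Sum>e\<in>M. w' e) \<le> (\<Sum>e\<in>N. w' e)" if N: "matching_in_face V E ?F1 N" for N
    proof -
      have NF: "matching_in_face V E F N" "(\<Sum>e\<in>N. w e) \<le> (\<Sum>e\<in>M. w e)" "(\<Sum>e\<in>M. w e) \<le> (\<Sum>e\<in>N. w e)"
        using N M1 MF matching_in_Min_face_iff[OF G F] by blast+
      then have "(\<Sum>e\<in>N. w e) = (\<Sum>e\<in>M. w e)" by simp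
      then show ?thesis using min[OF NF(1)] unfolding csum by simp
    qed
    then show "matching_in_face V E (Min_face E ?F1 w') M" using M1 matching_in_Min_face_iff[OF G f1] by blast
  next
    assume "matching_in_face V E (Min_face E ?F1 w') M"
    then have M1: "matching_in_face V E ?F1 M" and min': "\<And>N. matching_in_face V E ?F1 N \<Longrightarrow> (\<Sum>e\<in>M. w' e) \<le> (\<Sum>e\<in>N. w' e)"
      using matching_in_Min_face_iff[OF G f1] by blast+
    then have MF: "matching_in_face V E F M" and min: "\<And>N. matching_in_face V E F N \<Longrightarrow> (\<Sum>e\<in>M. w e) \<le> (\<Sum>e\<in>N. w e)"
      using matching_in_Min_face_iff[OF G F] by blast+
    have "(\<Sum>e\<in>M. ?c e) \<le> (\<Sum>e\<in>N. ?c e)" if N: "matching_in_face V E F N" for N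
    proof (cases "(\<Sum>e\<in>N. w e) = (\<Sum>e\<in>M. w e)")
      case True
      then have "matching_in_face V E ?F1 N" using N min matching_in_Min_face_iff[OF G F] by simp
      then show ?thesis using min' True unfolding csum by simp
    next
      case False
      then have "(\<Sum>e\<in>M. w e) + 1 \<le> (\<Sum>e\<in>N. w e)" using min[OF N] by simp
      then have "int n ^ 21 * ((\<Sum>e\<in>M. w e) + 1) \<le> int n ^ 21 * (\<Sum>e\<in>N. w e)" by (intro mult_left_mono) auto
      then have "int n ^ 21 * (\<Sum>e\<in>M. w e) + int n ^ 21 \<le> int n ^ 21 * (\<Sum>e\<in>N. w e)" by (simp add: algebra_simps)
      then show ?thesis using bd[OF N] bd[OF MF] unfolding csum by linarith
    qed
    then show "matching_in_face V E (Min_face E F ?c) M" using MF matching_in_Min_face_iff[OF G F] by blast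
  qed
  show ?thesis
    using face_subset_if_matchings[OF G Min_face_is_face[OF G F] Min_face_is_face[OF G f1]]
      face_subset_if_matchings[OF G Min_face_is_face[OF G f1] Min_face_is_face[OF G F]] eq by blast
qed

text \<open>Such a \<open>y\<close> is a direction within the minimising face: from a relative
  interior point one can move along it without leaving the face, on which the weight is
  constant.\<close>

lemma Min_face_orthogonal:
  assumes G: "simple_graph V E" and F: "is_face V E F"
    and d0: "\<And>e. e \<notin> supp E (Min_face E F w) \<Longrightarrow> y e = 0"
    and dt: "\<And>S. S \<in> tight V E (Min_face E F w) \<Longrightarrow> (\<Sum>e\<in>cut E S. y e) = (0::int)"
  shows "(\<Sum>e\<in>E. w e * y e) = 0"
proof -
  let ?F = "Min_face E F w" and ?w = "vec_weight E (\<lambda>e. of_int (w e))"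
  note f1 = Min_face_is_face[OF G F, of w]
  have ne: "?F \<noteq> {}" using f1 by (simp add: is_face_def)
  define d where "d e = real_of_int (y e)" for e
  obtain x where x: "x \<in> ?F" and x0: "\<And>y e. y \<in> ?F \<Longrightarrow> x e = 0 \<Longrightarrow> y e = 0"
    and x1: "\<And>y S. y \<in> ?F \<Longrightarrow> S \<subseteq> V \<Longrightarrow> odd (card S) \<Longrightarrow> (\<Sum>e\<in>cut E S. x e) = 1 \<Longrightarrow> (\<Sum>e\<in>cut E S. y e) = 1"
    by (rule exists_interior_point[OF G ne face_subset_PM[OF f1] face_midpoint[OF f1]]) (assumption | rule that)+
  obtain t where t: "t > 0" "(\<lambda>e. x e + t * d e) \<in> ?F"
  proof (rule face_step[OF G f1 x])
    show "d e = 0" if "x e = 0" for e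
    proof -
      have "e \<notin> supp E ?F" using x0[OF _ that] by (force simp: supp_def)
      then show ?thesis using d0 by (simp add: d_def)
    qed
    show "(\<Sum>e\<in>cut E S. d e) = 0" if "S \<subseteq> V" "odd (card S)" "(\<Sum>e\<in>cut E S. x e) = 1" for S
    proof -
      have "S \<in> tight V E ?F" using that x1 by (auto simp: tight_def)
      then have "real_of_int (\<Sum>e\<in>cut E S. y e) = 0" using dt by simp
      then show ?thesis by (simp add: d_def)
    qed
  qed (rule that)
  have "?w (\<lambda>e. x e + t * d e) = ?w x" using t(2) x by (auto simp: Min_face_eq intro: antisym)
  then have "?w d = 0" using t(1) unfolding vec_weight_linear by simp
  then have "real_of_int (\<Sum>e\<in>E. w e * y e) = 0" by (simp add: vec_weight_def d_def)
  then show ?thesis by linarith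
qed

section \<open>Swapping and uncrossing\<close>

definition swap_matching :: "'v set set \<Rightarrow> 'v set \<Rightarrow> 'v set set \<Rightarrow> 'v set set \<Rightarrow> 'v set set" where
  "swap_matching E U M N = (M - edges_inside E U) \<union> (N \<inter> edges_inside E U)"

lemma edge_meets:
  assumes G: "simple_graph V E" and e: "e \<in> E" and v: "v \<in> e" "v \<in> U"
  shows "e \<in> cut E U \<or> e \<in> edges_inside E U"
proof -
  obtain a b where "e = {a, b}" "a \<noteq> b" using simple_graph_edge[OF G e] by metis
  then show ?thesis using e v by (auto simp: pair_mem_cut edges_inside_def)
qed

lemma swap_perfect_matching:
  assumes G: "simple_graph V E" and M: "perfect_matching V E M" and N: "perfect_matching V E N"
    and agree: "M \<inter> cut E U = N \<inter> cut E U"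
  shows "perfect_matching V E (swap_matching E U M N)"
  unfolding perfect_matching_def
proof (intro conjI ballI)
  let ?K = "swap_matching E U M N"
  have ME: "M \<subseteq> E" and NE: "N \<subseteq> E" using M N by (auto simp: perfect_matching_def)
  then show "?K \<subseteq> E" by (auto simp: swap_matching_def)
  fix v assume v: "v \<in> V"
  show "\<exists>!e. e \<in> ?K \<and> v \<in> e"
  proof (cases "v \<in> U")
    case True
    have eq: "e \<in> ?K \<longleftrightarrow> e \<in> N" if "v \<in> e" for e
    proof (cases "e \<in> E")
      case eE: True
      have "e \<in> cut E U \<or> e \<in> edges_inside E U" by (rule edge_meets[OF G eE that True])
      moreover have "\<not> (e \<in> cut E U \<and> e \<in> edges_inside E U)"
        using eE G by (auto simp: cut_def edges_inside_def simple_graph_def Int_absorb2)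
      ultimately show ?thesis using agree by (auto simp: swap_matching_def)
    qed (use ME NE in \<open>auto simp: swap_matching_def\<close>)
    then have "(\<exists>!e. e \<in> ?K \<and> v \<in> e) \<longleftrightarrow> (\<exists>!e. e \<in> N \<and> v \<in> e)" by metis
    then show ?thesis using N v by (simp add: perfect_matching_def)
  next
    case False
    then have eq: "e \<in> ?K \<longleftrightarrow> e \<in> M" if "v \<in> e" for e
      using that by (auto simp: swap_matching_def edges_inside_def)
    then have "(\<exists>!e. e \<in> ?K \<and> v \<in> e) \<longleftrightarrow> (\<exists>!e. e \<in> M \<and> v \<in> e)" by metis
    then show ?thesis using M v by (simp add: perfect_matching_def)
  qed
qed

text \<open>\<open>y1\<close> and \<open>y2\<close> satisfy all inequalities of the polytope, and
  their sum attains equality in those defining \<open>F\<close>, so neither can be strict.\<close>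

lemma face_exchange:
  assumes F: "is_face V E F" and x: "x1 \<in> F" "x2 \<in> F" and y: "y1 \<in> PM V E" "y2 \<in> PM V E"
    and eq: "\<And>e. y1 e + y2 e = x1 e + (x2 e :: real)"
  shows "y1 \<in> F"
proof -
  obtain A \<S> where A: "A \<subseteq> E" "\<S> \<subseteq> {S. S \<subseteq> V \<and> odd (card S)}"
    and Feq: "F = {x \<in> PM V E. (\<forall>e\<in>A. x e = 0) \<and> (\<forall>S\<in>\<S>. (\<Sum>e\<in>cut E S. x e) = 1)}"
    using F unfolding is_face_def by blast
  have x1: "\<forall>e\<in>A. x1 e = 0" "\<forall>S\<in>\<S>. (\<Sum>e\<in>cut E S. x1 e) = 1" using x(1) unfolding Feq by blast+
  have x2: "\<forall>e\<in>A. x2 e = 0" "\<forall>S\<in>\<S>. (\<Sum>e\<in>cut E S. x2 e) = 1" using x(2) unfolding Feq by blast+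
  have "y1 e = 0" if "e \<in> A" for e
    using eq[of e] x1 x2 that PM_nonneg[OF y(1), of e] PM_nonneg[OF y(2), of e] by simp
  moreover have "(\<Sum>e\<in>cut E S. y1 e) = 1" if S: "S \<in> \<S>" for S
  proof -
    have So: "S \<subseteq> V" "odd (card S)" using S A by auto
    have "(\<Sum>e\<in>cut E S. y1 e) + (\<Sum>e\<in>cut E S. y2 e) = (\<Sum>e\<in>cut E S. x1 e) + (\<Sum>e\<in>cut E S. x2 e)"
      unfolding sum.distrib[symmetric] using eq by simp
    moreover have "(\<Sum>e\<in>cut E S. x1 e) = 1" "(\<Sum>e\<in>cut E S. x2 e) = 1" using x1 x2 S by blast+
    ultimately show ?thesis using PM_odd_cut[OF y(1) So] PM_odd_cut[OF y(2) So] by linarith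
  qed
  ultimately show ?thesis unfolding Feq using y by blast
qed

text \<open>Exchanging the inner parts of \<open>M\<close> and \<open>N\<close> gives two matchings
  of \<open>F\<close>. Neither exchange can lower the weight, but what one loses the other
  gains.\<close>

lemma Min_face_swap:
  assumes G: "simple_graph V E" and F: "is_face V E F"
    and M: "matching_in_face V E (Min_face E F w) M" and N: "matching_in_face V E (Min_face E F w) N"
    and agree: "M \<inter> cut E U = N \<inter> cut E U"
  shows "(\<Sum>e\<in>M \<inter> edges_inside E U. w e) = (\<Sum>e\<in>N \<inter> edges_inside E U. w e)"
proof -
  note fin = simple_graph_finite[OF G]
  have MF: "matching_in_face V E F M" "\<And>K. matching_in_face V E F K \<Longrightarrow> (\<Sum>e\<in>M. w e) \<le> (\<Sum>e\<in>K. w e)"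
    and NF: "matching_in_face V E F N" "\<And>K. matching_in_face V E F K \<Longrightarrow> (\<Sum>e\<in>N. w e) \<le> (\<Sum>e\<in>K. w e)"
    using M N matching_in_Min_face_iff[OF G F] by blast+
  have pM: "perfect_matching V E M" and pN: "perfect_matching V E N" using MF NF by (auto simp: matching_in_face_def)
  then have ME: "M \<subseteq> E" "N \<subseteq> E" by (auto simp: perfect_matching_def)
  let ?M = "swap_matching E U M N" and ?N = "swap_matching E U N M"
  have p1: "perfect_matching V E ?M" by (rule swap_perfect_matching[OF G pM pN agree])
  have p2: "perfect_matching V E ?N" by (rule swap_perfect_matching[OF G pN pM agree[symmetric]])
  have i: "indicator M \<in> F" "indicator N \<in> F" using MF NF by (auto simp: matching_in_face_def)
  have "indicator ?M \<in> F" "indicator ?N \<in> F"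
    by (rule face_exchange[OF F i indicator_in_PM[OF G p1] indicator_in_PM[OF G p2]],
        simp add: swap_matching_def indicator_def)
      (rule face_exchange[OF F i indicator_in_PM[OF G p2] indicator_in_PM[OF G p1]],
        simp add: swap_matching_def indicator_def)
  then have "(\<Sum>e\<in>M. w e) \<le> (\<Sum>e\<in>?M. w e)" "(\<Sum>e\<in>N. w e) \<le> (\<Sum>e\<in>?N. w e)"
    using MF(2) NF(2) p1 p2 by (auto simp: matching_in_face_def)
  moreover have "(\<Sum>e\<in>swap_matching E U A B. w e) = (\<Sum>e\<in>A. w e) - (\<Sum>e\<in>A \<inter> edges_inside E U. w e) + (\<Sum>e\<in>B \<inter> edges_inside E U. w e)"
    if "A \<subseteq> E" "B \<subseteq> E" for A B
  proof -
    have fA: "finite A" "finite B" using that fin finite_subset by blast+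
    have "(\<Sum>e\<in>swap_matching E U A B. w e) = (\<Sum>e\<in>A - edges_inside E U. w e) + (\<Sum>e\<in>B \<inter> edges_inside E U. w e)"
      unfolding swap_matching_def using fA by (intro sum.union_disjoint) auto
    moreover have "(\<Sum>e\<in>A. w e) = (\<Sum>e\<in>A - edges_inside E U. w e) + (\<Sum>e\<in>A \<inter> edges_inside E U. w e)"
      using sum.Int_Diff[OF fA(1), of w "edges_inside E U"] by simp
    ultimately show ?thesis by simp
  qed
  ultimately show ?thesis using ME by simp
qed

lemma Min_face_swap_vec:
  assumes G: "simple_graph V E" and F: "is_face V E F"
    and M: "matching_in_face V E (Min_face E F w) M" and N: "matching_in_face V E (Min_face E F w) N"
    and agree: "M \<inter> cut E U = N \<inter> cut E U"
  shows "(\<Sum>e\<in>E. w e * (indicator (M \<inter> edges_inside E U) e - indicator (N \<inter> edges_inside E U) e)) = 0"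
proof -
  note fin = simple_graph_finite[OF G]
  have i: "E \<inter> (K \<inter> edges_inside E U) = K \<inter> edges_inside E U" for K by (auto simp: edges_inside_def)
  have "(\<Sum>e\<in>E. w e * (indicator (M \<inter> edges_inside E U) e - indicator (N \<inter> edges_inside E U) e)) =
    (\<Sum>e\<in>E. indicator (M \<inter> edges_inside E U) e * w e) - (\<Sum>e\<in>E. indicator (N \<inter> edges_inside E U) e * w e)"
    by (simp add: sum_subtractf algebra_simps)
  then show ?thesis using Min_face_swap[OF assms] by (simp add: sum_indicator_mult[OF fin(2)] i)
qed

lemma matchings_agree_cut_Diff:
  assumes G: "simple_graph V E" and A: "M \<inter> cut E A = N \<inter> cut E A" and C: "M \<inter> cut E C = N \<inter> cut E C"
  shows "M \<inter> cut E (C - A) = N \<inter> cut E (C - A)"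
proof -
  have "e \<in> cut E A \<or> e \<in> cut E C" if e: "e \<in> cut E (C - A)" for e
  proof -
    obtain a b where "e = {a, b}" "a \<noteq> b" using cut_edge[OF G e] by metis
    then show ?thesis using e by (auto simp: pair_mem_cut)
  qed
  then show ?thesis using A C by blast
qed

section \<open>Uncrossing tight sets\<close>

lemma tight_complement:
  assumes G: "simple_graph V E" and F: "is_face V E F" and S: "S \<in> tight V E F"
  shows "V - S \<in> tight V E F"
proof -
  obtain x where "x \<in> F" using F by (auto simp: is_face_def)
  then have "x \<in> PM V E" using face_subset_PM[OF F] by blast
  then have "odd (card (V - S))" using S by (intro PM_odd_complement[OF G]) (auto simp: tight_def)
  then show ?thesis using S cut_complement[OF G] by (auto simp: tight_def)
qed

text \<open>Transfers uncrossing from points of the face to vectors on its support: edges between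
  the two differences lie outside the support, so \<open>d\<close> vanishes on them.\<close>

lemma tight_uncross:
  assumes G: "simple_graph V E" and F: "is_face V E F" and S: "S \<in> tight V E F" and T: "T \<in> tight V E F"
    and odd: "odd (card (S \<inter> T))" and d0: "\<And>e. e \<notin> supp E F \<Longrightarrow> d e = (0::int)"
  shows "S \<inter> T \<in> tight V E F" "S \<union> T \<in> tight V E F"
    "(\<Sum>e\<in>cut E S. d e) + (\<Sum>e\<in>cut E T. d e) = (\<Sum>e\<in>cut E (S \<inter> T). d e) + (\<Sum>e\<in>cut E (S \<union> T). d e)"
proof -
  have unc: "odd (card (S \<union> T))" "(\<Sum>e\<in>cut E (S \<inter> T). x e) = 1" "(\<Sum>e\<in>cut E (S \<union> T). x e) = 1"
    "\<And>e. e \<inter> (S - T) \<noteq> {} \<Longrightarrow> e \<inter> (T - S) \<noteq> {} \<Longrightarrow> x e = 0" if x: "x \<in> F" for x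
  proof -
    have xP: "x \<in> PM V E" using x face_subset_PM[OF F] by blast
    have S': "S \<subseteq> V" "odd (card S)" "(\<Sum>e\<in>cut E S. x e) = 1"
      and T': "T \<subseteq> V" "odd (card T)" "(\<Sum>e\<in>cut E T. x e) = 1" using S T x by (auto simp: tight_def)
    note u = PM_uncross[OF G xP S' T' odd]
    show "odd (card (S \<union> T))" "(\<Sum>e\<in>cut E (S \<inter> T). x e) = 1" "(\<Sum>e\<in>cut E (S \<union> T). x e) = 1"
      "\<And>e. e \<inter> (S - T) \<noteq> {} \<Longrightarrow> e \<inter> (T - S) \<noteq> {} \<Longrightarrow> x e = 0" by (fact u)+
  qed
  obtain x0 where x0: "x0 \<in> F" using F by (auto simp: is_face_def)
  have "S \<subseteq> V" "T \<subseteq> V" using S T by (auto simp: tight_def)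
  then show "S \<inter> T \<in> tight V E F" "S \<union> T \<in> tight V E F"
    using odd unc(1)[OF x0] unc(2,3) by (auto simp: tight_def)
  have "(\<Sum>e\<in>{e \<in> E. e \<inter> (S - T) \<noteq> {} \<and> e \<inter> (T - S) \<noteq> {}}. d e) = 0"
  proof (rule sum.neutral, rule ballI)
    fix e assume e: "e \<in> {e \<in> E. e \<inter> (S - T) \<noteq> {} \<and> e \<inter> (T - S) \<noteq> {}}"
    have "e \<notin> supp E F" using unc(4) e by (fastforce simp: supp_def)
    then show "d e = 0" by (rule d0)
  qed
  then show "(\<Sum>e\<in>cut E S. d e) + (\<Sum>e\<in>cut E T. d e) = (\<Sum>e\<in>cut E (S \<inter> T). d e) + (\<Sum>e\<in>cut E (S \<union> T). d e)"
    using sum_cut_uncross[OF G, of d S T] by simp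
qed

text \<open>Induction on the number of members of \<open>L\<close> that \<open>S\<close> crosses. A
  crossed member \<open>T\<close> is uncrossed into \<open>S \<inter> T\<close> and
  \<open>S \<union> T\<close>, or into \<open>S - T\<close> and \<open>T - S\<close>, depending on
  parity. These sets do not cross \<open>T\<close>, and they cross no member that \<open>S\<close>
  does not cross. A tight set that crosses nothing belongs to \<open>L\<close> by
  maximality.\<close>

lemma laminar_span:
  assumes G: "simple_graph V E" and F: "is_face V E F" and L: "maximal_laminar_subset V (tight V E F) L"
    and d0: "\<And>e. e \<notin> supp E F \<Longrightarrow> d e = (0::int)" and dL: "\<And>S. S \<in> L \<Longrightarrow> (\<Sum>e\<in>cut E S. d e) = 0"
  shows "S \<in> tight V E F \<Longrightarrow> (\<Sum>e\<in>cut E S. d e) = 0"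
proof (induction "card {R \<in> L. crossing S R}" arbitrary: S rule: less_induct)
  case (less S)
  note fin = simple_graph_finite[OF G]
  have lam: "laminar V L" "L \<subseteq> tight V E F" using L by (auto simp: maximal_laminar_subset_def)
  have finL: "finite L" using lam(1) fin by (meson finite_Pow_iff finite_subset laminar_def)
  have nc: "\<not> crossing R T" if "R \<in> L" "T \<in> L" for R T using lam(1) that by (auto simp: laminar_def)
  have IH: "(\<Sum>e\<in>cut E S'. d e) = 0"
    if S': "S' \<in> tight V E F" and T: "T \<in> L" "crossing S T" "\<not> crossing S' T"
      and imp: "\<And>R. R \<in> L \<Longrightarrow> \<not> crossing S R \<Longrightarrow> \<not> crossing S' R" for S' T
  proof (rule less.hyps[OF _ S'])
    have "{R \<in> L. crossing S' R} \<subset> {R \<in> L. crossing S R}" using T imp by blast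
    then show "card {R \<in> L. crossing S' R} < card {R \<in> L. crossing S R}" using finL by (intro psubset_card_mono) auto
  qed
  show ?case
  proof (cases "\<exists>T\<in>L. crossing S T")
    case False
    have sym: "crossing A B \<longleftrightarrow> crossing B A" for A B :: "'a set" by (auto simp: crossing_def)
    have "\<not> crossing S S" by (auto simp: crossing_def)
    then have "laminar V (insert S L)" using lam(1) False less.prems sym by (auto simp: laminar_def tight_def)
    then have "S \<in> L" using L less.prems by (auto simp: maximal_laminar_subset_def)
    then show ?thesis by (rule dL)
  next
    case True
    then obtain T where T: "T \<in> L" "crossing S T" by blast
    have Tt: "T \<in> tight V E F" using T lam by blast
    have SV: "S \<subseteq> V" "T \<subseteq> V" using less.prems Tt by (auto simp: tight_def)
    show ?thesis
    proof (cases "odd (card (S \<inter> T))")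
      case odd: True
      note u = tight_uncross[OF G F less.prems Tt odd, of d, OF d0]
      have "(\<Sum>e\<in>cut E (S \<inter> T). d e) = 0"
      proof (rule IH[OF u(1) T])
        show "\<not> crossing (S \<inter> T) T" by (auto simp: crossing_def)
        show "\<not> crossing (S \<inter> T) R" if R: "R \<in> L" "\<not> crossing S R" for R
          using R nc[OF R(1) T(1)] T(2) unfolding crossing_def by blast
      qed
      moreover have "(\<Sum>e\<in>cut E (S \<union> T). d e) = 0"
      proof (rule IH[OF u(2) T])
        show "\<not> crossing (S \<union> T) T" by (auto simp: crossing_def)
        show "\<not> crossing (S \<union> T) R" if R: "R \<in> L" "\<not> crossing S R" for R
          using R nc[OF R(1) T(1)] T(2) unfolding crossing_def by blast
      qed
      ultimately show ?thesis using u(3) dL[OF T(1)] by simp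
    next
      case even: False
      have finS: "finite S" using SV fin finite_subset by blast
      \<comment> \<open>An even intersection with \<open>T\<close> is the odd case for
        \<open>V - T\<close>, which is tight with the same cut; the union is then traded for its
        complement \<open>T - S\<close>.\<close>
      have SmT: "S \<inter> (V - T) = S - T" using SV by blast
      have "card S = card (S \<inter> T) + card (S - T)"
        using finS by (metis Int_Diff_Un Int_Diff_disjoint card_Un_disjoint finite_Diff finite_Int)
      then have odd: "odd (card (S \<inter> (V - T)))" using less.prems even SmT by (auto simp: tight_def)
      note u = tight_uncross[OF G F less.prems tight_complement[OF G F Tt] odd, of d, OF d0]
      have TmS: "V - (S \<union> (V - T)) = T - S" using SV by blast
      have tT: "T - S \<in> tight V E F" using tight_complement[OF G F u(2)] TmS by simp
      have "(\<Sum>e\<in>cut E (S - T). d e) = 0"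
      proof (rule IH[OF u(1)[unfolded SmT] T])
        show "\<not> crossing (S - T) T" by (auto simp: crossing_def)
        show "\<not> crossing (S - T) R" if R: "R \<in> L" "\<not> crossing S R" for R
          using R nc[OF R(1) T(1)] T(2) unfolding crossing_def by blast
      qed
      moreover have "(\<Sum>e\<in>cut E (T - S). d e) = 0"
      proof (rule IH[OF tT T])
        show "\<not> crossing (T - S) T" by (auto simp: crossing_def)
        show "\<not> crossing (T - S) R" if R: "R \<in> L" "\<not> crossing S R" for R
          using R nc[OF R(1) T(1)] T(2) unfolding crossing_def by blast
      qed
      moreover have "cut E (S \<union> (V - T)) = cut E (T - S)" using cut_complement[OF G, of "S \<union> (V - T)"] TmS by simp
      ultimately show ?thesis using u(3) dL[OF T(1)] SmT cut_complement[OF G, of T] by simp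
    qed
  qed
qed

lemma exists_maximal_laminar:
  assumes fin: "finite V" and L: "laminar V L" "L \<subseteq> \<S>"
  shows "\<exists>L'. L \<subseteq> L' \<and> maximal_laminar_subset V \<S> L'"
proof -
  let ?P = "\<lambda>K. L \<subseteq> K \<and> laminar V K \<and> K \<subseteq> \<S>"
  have sub: "K \<subseteq> Pow V" if "laminar V K" for K using that by (simp add: laminar_def)
  have bd: "\<forall>K. ?P K \<longrightarrow> card K < Suc (card (Pow V))"
    using fin sub by (intro allI impI le_imp_less_Suc card_mono) auto
  from ex_has_greatest_nat[of ?P L, OF _ bd] L obtain K where K: "?P K" and max: "\<And>K'. ?P K' \<Longrightarrow> card K' \<le> card K"
    by blast
  have finK: "finite K" using K sub fin by (meson finite_Pow_iff finite_subset)
  have "\<not> laminar V (insert S K)" if S: "S \<in> \<S> - K" for S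
  proof
    assume "laminar V (insert S K)"
    then have "card (insert S K) \<le> card K" using S K by (intro max) auto
    then show False using S finK by simp
  qed
  then show ?thesis using K by (auto simp: maximal_laminar_subset_def)
qed

section \<open>Counting light alternating circuits\<close>

text \<open>A cyclic walk unrolled to an infinite one, so that segments need no indices modulo the
  length.\<close>

definition is_walk :: "('a, 'e) weighted_multigraph \<Rightarrow> (nat \<Rightarrow> 'a) \<Rightarrow> (nat \<Rightarrow> 'e) \<Rightarrow> bool" where
  "is_walk H v e \<longleftrightarrow> (\<forall>i. v i \<in> nodes H \<and> e i \<in> edges H \<and> ends H (e i) = {v i, v (Suc i)})"

definition alt_seg :: "(nat \<Rightarrow> 'e) \<Rightarrow> nat \<Rightarrow> nat \<Rightarrow> 'e \<Rightarrow> int" where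
  "alt_seg e i j f = (\<Sum>t\<in>{i..<j}. (-1) ^ t * indicator {e t} f)"

text \<open>The weight of a piece omits its first node and includes its last, so that weights of
  consecutive pieces add up. A single step is allowed whatever it weighs.\<close>

definition light :: "('a, 'e) weighted_multigraph \<Rightarrow> nat \<Rightarrow> (nat \<Rightarrow> 'a) \<Rightarrow> nat \<Rightarrow> nat \<Rightarrow> bool" where
  "light H l v i j \<longleftrightarrow> i < j \<and> (j = Suc i \<or> 2 * (\<Sum>t\<in>{i<..j}. node_weight H (v t)) \<le> l)"

text \<open>The parity of the position fixes the sign of the edge in the alternating vector. With
  two directions and two parities, an edge gives rise to at most four darts.\<close>

definition dart :: "(nat \<Rightarrow> 'a) \<Rightarrow> (nat \<Rightarrow> 'e) \<Rightarrow> nat \<Rightarrow> 'e \<times> 'a \<times> 'a \<times> bool" where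
  "dart v e i = (e i, v i, v (Suc i), even i)"

lemma cyclic_walk_map:
  assumes "U m = U 0"
    and "\<And>t. t < m \<Longrightarrow> U t \<in> nodes H \<and> c t \<in> edges H \<and> ends H (c t) = {U t, U (Suc t)}"
  shows "cyclic_walk H (map U [0..<m]) (map c [0..<m])"
  unfolding cyclic_walk_def
proof (intro conjI allI impI)
  fix i assume i: "i < length (map c [0..<m])"
  have "map U [0..<m] ! (Suc i mod m) = U (Suc i)"
    using i assms(1) by (cases "Suc i = m") auto
  then show "ends H (map c [0..<m] ! i) = {map U [0..<m] ! i, map U [0..<m] ! (Suc i mod length (map c [0..<m]))}"
    using i assms(2)[of i] by simp
qed (use assms(2) in auto)

lemma alt_vec_map: "alt_vec (map c [0..<m]) f = (\<Sum>t<m. (-1) ^ t * indicator {c t} f)"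
  by (simp add: alt_vec_def)

lemma walk_weight_map: "walk_weight H (map U [0..<m]) = (\<Sum>t<m. node_weight H (U t))"
  unfolding walk_weight_def by (simp add: comp_def interv_sum_list_conv_sum_set_nat atLeast0LessThan)

lemma sum_lessThan_add:
  fixes g :: "nat \<Rightarrow> 'b::comm_monoid_add"
  shows "(\<Sum>t<a + b. g t) = (\<Sum>t<a. g t) + (\<Sum>s<b. g (a + s))"
  by (induction b) (auto simp: add.assoc)

text \<open>Following the first piece from its second node to its last and returning along the other
  piece gives a closed walk, because the end darts agree. Its length is even since the parities
  agree, and its weight is at most \<open>l\<close>, so it is no alternating circuit. Its
  alternating vector is thus zero, and this vector is, up to sign, the difference of the two
  segments.\<close>

lemma alt_seg_eq:
  assumes none: "\<And>vs es. alternating_circuit H vs es \<Longrightarrow> l < walk_weight H vs"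
    and W: "is_walk H v e" and W': "is_walk H v' e'"
    and i: "light H l v i i2" and j: "light H l v' j j2"
    and d1: "dart v e i = dart v' e' j" and d2: "dart v e i2 = dart v' e' j2"
  shows "alt_seg e i i2 = alt_seg e' j j2"
proof -
  have ij: "i < i2" "j < j2" using i j by (auto simp: light_def)
  have par: "even i = even j" "even i2 = even j2" and e1: "e i = e' j" and v1: "v (Suc i) = v' (Suc j)"
    and v2: "v i2 = v' j2" using d1 d2 by (auto simp: dart_def)
  have split: "alt_seg c p q f = (-1) ^ p * indicator {c p} f + (\<Sum>t\<in>{Suc p..<q}. (-1) ^ t * indicator {c t} f)"
    if "p < q" for c :: "nat \<Rightarrow> 'b" and p q f
    using that by (simp add: alt_seg_def sum.atLeast_Suc_lessThan)
  define a b where "a = i2 - i - 1" and "b = j2 - j - 1"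
  have i2: "i2 = Suc i + a" and j2: "j2 = Suc j + b" using ij by (auto simp: a_def b_def)
  show ?thesis
  proof (cases "a = 0 \<and> b = 0")
    case True
    then have "alt_seg e i i2 f = alt_seg e' j j2 f" for f using split ij i2 j2 e1 par by (simp add: minus_one_power_iff)
    then show ?thesis by blast
  next
    case False
    let ?w = "node_weight H"
    \<comment> \<open>A piece that is a single step carries no weight bound of its own, but the only
      node it counts is also counted by the other piece.\<close>
    have wi: "2 * (\<Sum>t\<in>{i<..i2}. ?w (v t)) \<le> l" and wj: "2 * (\<Sum>t\<in>{j<..j2}. ?w (v' t)) \<le> l"
    proof -
      have I: "{i<..Suc i} = {Suc i}" "{j<..Suc j} = {Suc j}" by auto
      have le: "?w (v (Suc i)) \<le> (\<Sum>t\<in>{i<..i2}. ?w (v t))" "?w (v' (Suc j)) \<le> (\<Sum>t\<in>{j<..j2}. ?w (v' t))"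
        using ij by (auto intro!: member_le_sum[where f="\<lambda>t. ?w (v t)"] member_le_sum[where f="\<lambda>t. ?w (v' t)"])
      show "2 * (\<Sum>t\<in>{i<..i2}. ?w (v t)) \<le> l" "2 * (\<Sum>t\<in>{j<..j2}. ?w (v' t)) \<le> l"
        using i j False le v1 unfolding light_def i2 j2 by (cases "a = 0"; cases "b = 0"; force simp: I)+
    qed
    \<comment> \<open>Forward through the first piece, then backward through the second;
      \<open>a\<close> and \<open>b\<close> are their numbers of steps after the common first
      edge.\<close>
    define U where "U t = (if t \<le> a then v (Suc i + t) else v' (j2 - (t - a)))" for t
    define c where "c t = (if t < a then e (Suc i + t) else e' (j2 - 1 - (t - a)))" for t
    define m where "m = a + b"
    have Wp: "v t \<in> nodes H" "e t \<in> edges H" "ends H (e t) = {v t, v (Suc t)}" for t using W by (auto simp: is_walk_def)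
    have Wp': "v' t \<in> nodes H" "e' t \<in> edges H" "ends H (e' t) = {v' t, v' (Suc t)}" for t using W' by (auto simp: is_walk_def)
    have U0: "U m = U 0" using v1 v2 by (cases "b = 0") (auto simp: U_def m_def i2 j2)
    have step: "U t \<in> nodes H \<and> c t \<in> edges H \<and> ends H (c t) = {U t, U (Suc t)}" if t: "t < m" for t
    proof (cases "t < a")
      case True
      then show ?thesis using Wp by (simp add: U_def c_def)
    next
      case F: False
      define s where "s = t - a"
      have s: "t = a + s" "s < b" using F t by (auto simp: s_def m_def)
      have Ut: "U t = v' (j2 - s)" using s v2 by (cases "s = 0") (auto simp: U_def i2)
      have US: "U (Suc t) = v' (j2 - Suc s)" using s by (simp add: U_def)
      have ct: "c t = e' (j2 - Suc s)" using s by (simp add: c_def)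
      have "Suc (j2 - Suc s) = j2 - s" using s j2 by simp
      then show ?thesis using Wp' Ut US ct by (metis insert_commute)
    qed
    have cw: "cyclic_walk H (map U [0..<m]) (map c [0..<m])" by (rule cyclic_walk_map[OF U0 step])
    have evm: "even m" using par i2 j2 unfolding m_def by presburger
    note splitm = sum_lessThan_add[of _ a b, folded m_def]
    have wt: "walk_weight H (map U [0..<m]) \<le> l"
    proof -
      have "(\<Sum>t<a. ?w (U t)) = (\<Sum>t\<in>{Suc i..<i2}. ?w (v t))"
        by (rule sum.reindex_bij_witness[where j="\<lambda>t. Suc i + t" and i="\<lambda>t. t - Suc i"]) (auto simp: U_def i2)
      also have "\<dots> \<le> (\<Sum>t\<in>{i<..i2}. ?w (v t))" by (rule sum_mono2) auto
      finally have A: "(\<Sum>t<a. ?w (U t)) \<le> (\<Sum>t\<in>{i<..i2}. ?w (v t))" .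
      have "(\<Sum>s<b. ?w (U (a + s))) = (\<Sum>t\<in>{Suc j<..j2}. ?w (v' t))"
        by (rule sum.reindex_bij_witness[where j="\<lambda>s. j2 - s" and i="\<lambda>t. j2 - t"])
          (use v2 in \<open>auto simp: U_def i2 j2 not_le\<close>)
      also have "\<dots> \<le> (\<Sum>t\<in>{j<..j2}. ?w (v' t))" by (rule sum_mono2) auto
      finally have B: "(\<Sum>s<b. ?w (U (a + s))) \<le> (\<Sum>t\<in>{j<..j2}. ?w (v' t))" .
      show ?thesis unfolding walk_weight_map splitm using A B wi wj by linarith
    qed
    have "alt_vec (map c [0..<m]) = (\<lambda>f. 0)"
      using none[of "map U [0..<m]" "map c [0..<m]"] wt cw evm unfolding alternating_circuit_def by auto
    then have z: "(\<Sum>t<m. (-1) ^ t * indicator {c t} f) = (0::int)" for f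
      using alt_vec_map[of c m f] by simp
    show ?thesis
    proof
      fix f
      let ?g = "\<lambda>t. (-1) ^ t * indicator {e t} f :: int" and ?h = "\<lambda>t. (-1) ^ t * indicator {e' t} f :: int"
      have "(\<Sum>t<a. (-1) ^ t * indicator {c t} f) = (\<Sum>t\<in>{Suc i..<i2}. (-1) ^ Suc i * ?g t)"
        by (rule sum.reindex_bij_witness[where j="\<lambda>t. Suc i + t" and i="\<lambda>t. t - Suc i"])
          (auto simp: c_def i2 power_add minus_one_power_iff)
      then have A: "(\<Sum>t<a. (-1) ^ t * indicator {c t} f) = (-1) ^ Suc i * (\<Sum>t\<in>{Suc i..<i2}. ?g t)"
        by (simp add: sum_distrib_left)
      have "(\<Sum>s<b. (-1) ^ (a + s) * indicator {c (a + s)} f) = (\<Sum>t\<in>{Suc j..<j2}. - ((-1) ^ Suc i * ?h t))"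
      proof (rule sum.reindex_bij_witness[where j="\<lambda>s. j2 - Suc s" and i="\<lambda>t. j2 - Suc t"])
        fix s assume s: "s \<in> {..<b}"
        \<comment> \<open>Running backwards gives the second piece the opposite sign.\<close>
        have "even (a + s) \<longleftrightarrow> \<not> even (Suc i + (j2 - Suc s))" using s par i2 j2 by (auto; presburger)
        then show "- ((-1) ^ Suc i * ((-1) ^ (j2 - Suc s) * indicator {e' (j2 - Suc s)} f)) =
          (-1) ^ (a + s) * (indicator {c (a + s)} f :: int)"
          by (auto simp: c_def minus_one_power_iff)
      qed (auto simp: j2)
      then have B: "(\<Sum>s<b. (-1) ^ (a + s) * indicator {c (a + s)} f) = - ((-1) ^ Suc i * (\<Sum>t\<in>{Suc j..<j2}. ?h t))"
        by (simp add: sum_distrib_left sum_negf)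
      have "(-1) ^ Suc i * (\<Sum>t\<in>{Suc i..<i2}. ?g t) - (-1) ^ Suc i * (\<Sum>t\<in>{Suc j..<j2}. ?h t) = 0"
        using z[of f] A B unfolding splitm by simp
      then have "(\<Sum>t\<in>{Suc i..<i2}. ?g t) = (\<Sum>t\<in>{Suc j..<j2}. ?h t)" by (simp add: minus_one_power_iff split: if_splits)
      then show "alt_seg e i i2 f = alt_seg e' j j2 f" using split ij e1 par by (simp add: minus_one_power_iff)
    qed
  qed
qed

lemma alt_seg_append: "i \<le> j \<Longrightarrow> j \<le> k \<Longrightarrow> alt_seg e i k f = alt_seg e i j f + alt_seg e j k f"
  unfolding alt_seg_def by (simp add: sum.atLeastLessThan_concat)

lemma successively_light_le: "successively (light H l v) bs \<Longrightarrow> bs \<noteq> [] \<Longrightarrow> hd bs \<le> last bs"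
proof (induction bs)
  case (Cons b bs)
  then show ?case by (cases bs) (auto simp: light_def)
qed simp

text \<open>The two lists may cut at different positions; it is enough that the darts at the cuts
  match, since then corresponding pieces agree and the pieces add up.\<close>

lemma alt_seg_eq_chain:
  assumes none: "\<And>vs es. alternating_circuit H vs es \<Longrightarrow> l < walk_weight H vs"
    and W: "is_walk H v e" and W': "is_walk H v' e'"
  shows "successively (light H l v) bs \<Longrightarrow> successively (light H l v') cs \<Longrightarrow> bs \<noteq> [] \<Longrightarrow>
    map (dart v e) bs = map (dart v' e') cs \<Longrightarrow>
    alt_seg e (hd bs) (last bs) = alt_seg e' (hd cs) (last cs)"
proof (induction bs arbitrary: cs)
  case (Cons b bs)
  then obtain c cs' where cs: "cs = c # cs'" by (cases cs) auto
  show ?case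
  proof (cases bs)
    case Nil
    then show ?thesis using Cons.prems cs by (auto simp: alt_seg_def)
  next
    case (Cons b2 bs2)
    then obtain c2 cs2 where cs': "cs' = c2 # cs2" using Cons.prems cs by (cases cs') auto
    have P: "light H l v b b2" "light H l v' c c2" "successively (light H l v) bs" "successively (light H l v') cs'"
      "dart v e b = dart v' e' c" "dart v e b2 = dart v' e' c2" "map (dart v e) bs = map (dart v' e') cs'"
      using Cons.prems cs cs' Cons by auto
    have le: "b2 \<le> last bs" "c2 \<le> last cs'"
      using successively_light_le[OF P(3)] successively_light_le[OF P(4)] Cons cs' by auto
    have lt: "b \<le> b2" "c \<le> c2" using P(1,2) by (auto simp: light_def)
    have s1: "alt_seg e b b2 = alt_seg e' c c2" by (rule alt_seg_eq[OF none W W' P(1,2,5,6)])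
    have "alt_seg e (hd bs) (last bs) = alt_seg e' (hd cs') (last cs')" using Cons.IH[OF P(3,4) _ P(7)] Cons by blast
    then have s2: "alt_seg e b2 (last bs) = alt_seg e' c2 (last cs')" using Cons cs' by simp
    have "alt_seg e b (last bs) f = alt_seg e' c (last cs') f" for f
      using s1 s2 alt_seg_append[OF lt(1) le(1), of e f] alt_seg_append[OF lt(2) le(2), of e' f] by simp
    then show ?thesis using Cons cs cs' by auto
  qed
qed simp

text \<open>Greedy cutting: go to the first index \<open>j\<close> at which the doubled weight from
  \<open>i\<close> exceeds \<open>l\<close>, and cut at \<open>j - 1\<close> and at
  \<open>j\<close>. The part up to \<open>j - 1\<close> is light and the last step is a single edge.
  Each round uses up at least \<open>l + 1\<close> of the doubled weight and adds at most two
  cuts.\<close>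

lemma exists_light_chain:
  "i \<le> k \<Longrightarrow> 2 * (\<Sum>t\<in>{i<..k}. node_weight H (v t)) \<le> l + m * (l + 1) \<Longrightarrow>
   \<exists>bs. successively (light H l v) bs \<and> bs \<noteq> [] \<and> hd bs = i \<and> last bs = k \<and> length bs \<le> 2 * m + 2"
proof (induction m arbitrary: i)
  case 0
  show ?case
  proof (cases "i = k")
    case True
    then show ?thesis by (intro exI[of _ "[k]"]) simp
  next
    case False
    then show ?thesis using 0 by (intro exI[of _ "[i, k]"]) (simp add: light_def)
  qed
next
  case (Suc m)
  let ?s = "\<lambda>p q. \<Sum>t\<in>{p<..q}. node_weight H (v t)"
  show ?case
  proof (cases "2 * ?s i k \<le> l")
    case True
    show ?thesis
    proof (cases "i = k")
      case True
      then show ?thesis by (intro exI[of _ "[k]"]) simp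
    next
      case False
      then show ?thesis using Suc.prems True by (intro exI[of _ "[i, k]"]) (simp add: light_def)
    qed
  next
    case False
    then obtain j where j: "l < 2 * ?s i j" and least: "\<And>q. q < j \<Longrightarrow> \<not> l < 2 * ?s i q"
      using exists_least_iff[of "\<lambda>j. l < 2 * ?s i j"] by (meson not_le)
    have jk: "j \<le> k" using least[of k] False by (meson not_le)
    have ij: "i < j" using j by (cases "i < j") auto
    then obtain p where p: "j = Suc p" "i \<le> p" by (cases j) auto
    have lp: "2 * ?s i p \<le> l" using least[of p] p by simp
    have "{i<..k} = {i<..j} \<union> {j<..k}" "{i<..j} \<inter> {j<..k} = {}" using ij jk by auto
    then have "?s i k = ?s i j + ?s j k" by (simp add: sum.union_disjoint)
    then have "2 * ?s j k \<le> l + m * (l + 1)" using Suc.prems j by simp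
    then obtain bs where bs: "successively (light H l v) bs" "bs \<noteq> []" "hd bs = j" "last bs = k" "length bs \<le> 2 * m + 2"
      using Suc.IH[OF jk] by blast
    obtain bs' where bs': "bs = j # bs'" using bs by (cases bs) auto
    show ?thesis
    proof (cases "i = p")
      case True
      then show ?thesis using bs bs' p by (intro exI[of _ "i # bs"]) (auto simp: light_def)
    next
      case False
      then show ?thesis using bs bs' p lp by (intro exI[of _ "i # p # bs"]) (auto simp: light_def)
    qed
  qed
qed

lemma cyclic_walk_is_walk:
  assumes "cyclic_walk H vs es" "es \<noteq> []"
  shows "is_walk H (\<lambda>i. vs ! (i mod length es)) (\<lambda>i. es ! (i mod length es))"
  unfolding is_walk_def
proof (intro allI conjI)
  fix i
  have m: "i mod length es < length es" using assms by simp
  show "vs ! (i mod length es) \<in> nodes H" "es ! (i mod length es) \<in> edges H"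
    using m assms unfolding cyclic_walk_def by (metis nth_mem subsetD)+
  show "ends H (es ! (i mod length es)) = {vs ! (i mod length es), vs ! (Suc i mod length es)}"
    using m assms unfolding cyclic_walk_def by (metis mod_Suc_eq)
qed

definition circuit_vecs :: "('a, 'e) weighted_multigraph \<Rightarrow> nat \<Rightarrow> ('e \<Rightarrow> int) set" where
  "circuit_vecs H r = {alt_vec es | vs es. alternating_circuit H vs es \<and> walk_weight H vs \<le> r}"

text \<open>A circuit is encoded by the darts at its cut points. Its alternating vector is
  determined by this code, and there are at most four darts per edge.\<close>

lemma card_circuit_vecs:
  assumes none: "\<And>vs es. alternating_circuit H vs es \<Longrightarrow> l < walk_weight H vs"
    and fin: "finite (edges H)"
  shows "finite (circuit_vecs H (2 * l))" "card (circuit_vecs H (2 * l)) \<le> (\<Sum>i\<le>8. (4 * card (edges H)) ^ i)"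
proof -
  define D where "D = (SIGMA e:edges H. {(u, v, b) | u v (b::bool). ends H e = {u, v}})"
  have D1: "finite {(u, v, b) | u v (b::bool). X = {u, v}} \<and> card {(u, v, b) | u v (b::bool). X = {u, v}} \<le> 4"
    for X :: "'a set"
  proof (cases "\<exists>u v. X = {u, v}")
    case True
    then obtain u v where X: "X = {u, v}" by blast
    let ?Q = "[(u, v, True), (u, v, False), (v, u, True), (v, u, False)]"
    have sub: "{(u, v, b) | u v (b::bool). X = {u, v}} \<subseteq> set ?Q"
      unfolding X by (auto simp: doubleton_eq_iff)
    have c: "card (set ?Q) \<le> 4" using card_length[of ?Q] by simp
    have f: "finite (set ?Q)" by simp
    then show ?thesis using sub c card_mono[OF f sub] finite_subset[OF sub f] by linarith
  next
    case False
    then have "{(u, v, b) | u v (b::bool). X = {u, v}} = {}" by blast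
    then show ?thesis by (metis card.empty finite.emptyI le0)
  qed
  have finD: "finite D" unfolding D_def using fin D1 by blast
  have "card D = (\<Sum>e\<in>edges H. card {(u, v, b) | u v (b::bool). ends H e = {u, v}})"
    unfolding D_def using fin D1 by (intro card_SigmaI) blast+
  also have "\<dots> \<le> (\<Sum>e\<in>edges H. 4)" using D1 by (intro sum_mono) blast
  finally have cardD: "card D \<le> 4 * card (edges H)" by simp
  define Sig where "Sig = {xs. set xs \<subseteq> D \<and> length xs \<le> 8}"
  have finSig: "finite Sig" unfolding Sig_def using finite_lists_length_le[OF finD] .
  have cardSig: "card Sig = (\<Sum>i\<le>8. card D ^ i)" unfolding Sig_def using card_lists_length_le[OF finD] .
  \<comment> \<open>Different walks may have the same code; uniqueness is claimed for the resulting
    vector only.\<close>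
  define R where "R \<chi> xs \<longleftrightarrow> (\<exists>v e bs. is_walk H v e \<and> successively (light H l v) bs \<and> bs \<noteq> [] \<and>
    map (dart v e) bs = xs \<and> \<chi> = alt_seg e (hd bs) (last bs))" for \<chi> xs
  have ex: "\<exists>xs\<in>Sig. R \<chi> xs" if \<chi>: "\<chi> \<in> circuit_vecs H (2 * l)" for \<chi>
  proof -
    obtain vs es where c: "alternating_circuit H vs es" "walk_weight H vs \<le> 2 * l" "\<chi> = alt_vec es"
      using \<chi> by (auto simp: circuit_vecs_def)
    have cw: "cyclic_walk H vs es" "alt_vec es \<noteq> (\<lambda>e. 0)" using c by (auto simp: alternating_circuit_def)
    have ne: "es \<noteq> []" using cw by (auto simp: alt_vec_def)
    define k where "k = length es"
    have k: "k > 0" "length vs = k" using ne cw by (auto simp: k_def cyclic_walk_def)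
    define v where "v i = vs ! (i mod k)" for i
    define e where "e i = es ! (i mod k)" for i
    have W: "is_walk H v e" using cyclic_walk_is_walk[OF cw(1) ne] by (simp add: v_def[abs_def] e_def[abs_def] k_def)
    \<comment> \<open>Pieces omit their first node, so the indices run from one to \<open>k\<close>;
      as \<open>v k = v 0\<close>, this is still the full weight of the circuit.\<close>
    have "(\<Sum>t\<in>{0<..k}. node_weight H (v t)) = (\<Sum>t<k. node_weight H (v t))"
    proof -
      have "{0<..k} = insert k {1..<k}" "{..<k} = insert 0 {1..<k}" using k by auto
      moreover have "v k = v 0" by (simp add: v_def)
      ultimately show ?thesis by simp
    qed
    also have "\<dots> = walk_weight H vs"
    proof -
      have "map v [0..<k] = vs" using k by (auto simp: v_def intro: nth_equalityI)
      then show ?thesis using walk_weight_map[of H v k] by simp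
    qed
    \<comment> \<open>The doubled weight is at most \<open>4 * l \<le> l + 3 * (l + 1)\<close>, so
      three rounds of cutting suffice, which yields at most eight cut points.\<close>
    finally have "2 * (\<Sum>t\<in>{0<..k}. node_weight H (v t)) \<le> l + 3 * (l + 1)" using c(2) by simp
    from exists_light_chain[OF _ this] obtain bs where
      bs: "successively (light H l v) bs" "bs \<noteq> []" "hd bs = 0" "last bs = k" "length bs \<le> 8" by auto
    have "\<chi> = alt_seg e 0 k"
      unfolding c(3) alt_vec_def alt_seg_def k_def[symmetric] by (auto simp: e_def atLeast0LessThan intro!: sum.cong)
    then have "R \<chi> (map (dart v e) bs)" unfolding R_def using W bs
      by (intro exI[of _ v] exI[of _ e] exI[of _ bs]) simp
    moreover have "map (dart v e) bs \<in> Sig"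
      using W bs(5) by (auto simp: Sig_def D_def dart_def is_walk_def)
    ultimately show ?thesis by blast
  qed
  have uniq: "\<chi> = \<chi>'" if "R \<chi> xs" "R \<chi>' xs" for \<chi> \<chi>' xs
  proof -
    obtain v e bs where 1: "is_walk H v e" "successively (light H l v) bs" "bs \<noteq> []"
      "map (dart v e) bs = xs" "\<chi> = alt_seg e (hd bs) (last bs)" using \<open>R \<chi> xs\<close> unfolding R_def by blast
    obtain v' e' bs' where 2: "is_walk H v' e'" "successively (light H l v') bs'" "bs' \<noteq> []"
      "map (dart v' e') bs' = xs" "\<chi>' = alt_seg e' (hd bs') (last bs')" using \<open>R \<chi>' xs\<close> unfolding R_def by blast
    have "map (dart v e) bs = map (dart v' e') bs'" using 1(4) 2(4) by simp
    from alt_seg_eq_chain[OF none 1(1) 2(1) 1(2) 2(2) 1(3) this] show ?thesis using 1(5) 2(5) by simp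
  qed
  define \<sigma> where "\<sigma> \<chi> = (SOME xs. xs \<in> Sig \<and> R \<chi> xs)" for \<chi>
  have \<sigma>: "\<sigma> \<chi> \<in> Sig \<and> R \<chi> (\<sigma> \<chi>)" if "\<chi> \<in> circuit_vecs H (2 * l)" for \<chi>
    unfolding \<sigma>_def by (rule someI_ex) (use ex[OF that] in blast)
  have inj: "inj_on \<sigma> (circuit_vecs H (2 * l))" using \<sigma> uniq by (metis inj_onI)
  have sub: "\<sigma> ` circuit_vecs H (2 * l) \<subseteq> Sig" using \<sigma> by blast
  show "finite (circuit_vecs H (2 * l))" using inj sub finSig by (meson finite_imageD finite_subset)
  have "card (circuit_vecs H (2 * l)) \<le> card Sig" using card_inj_on_le[OF inj sub finSig] .
  also have "\<dots> \<le> (\<Sum>i\<le>8. (4 * card (edges H)) ^ i)"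
    unfolding cardSig using cardD by (intro sum_mono power_mono) auto
  finally show "card (circuit_vecs H (2 * l)) \<le> (\<Sum>i\<le>8. (4 * card (edges H)) ^ i)" .
qed

section \<open>Contractions and lifted circuits\<close>

lemma laminar_comparable:
  assumes "laminar V L" "S \<in> L" "T \<in> L" "v \<in> S" "v \<in> T"
  shows "S \<subseteq> T \<or> T \<subseteq> S"
  using assms unfolding laminar_def crossing_def by blast

lemma contraction_node_exists:
  assumes fin: "finite V" and L: "laminar V L" and S: "S \<in> L" "card S \<le> \<mu>"
  shows "\<exists>N\<in>contraction_nodes L \<mu>. S \<subseteq> N"
proof -
  let ?P = "\<lambda>N. N \<in> L \<and> card N \<le> \<mu> \<and> S \<subseteq> N"
  have sub: "N \<subseteq> V" if "N \<in> L" for N using that L by (auto simp: laminar_def)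
  have bd: "\<forall>N. ?P N \<longrightarrow> card N < Suc \<mu>" by auto
  have "?P S" using S by simp
  from ex_has_greatest_nat[of ?P, OF this bd] obtain N where N: "?P N" and max: "\<And>T. ?P T \<Longrightarrow> card T \<le> card N" by blast
  have "\<not> (\<exists>T\<in>L. card T \<le> \<mu> \<and> N \<subset> T)"
  proof
    assume "\<exists>T\<in>L. card T \<le> \<mu> \<and> N \<subset> T"
    then obtain T where T: "T \<in> L" "card T \<le> \<mu>" "N \<subset> T" by blast
    have "card N < card T" using T sub[of T] fin by (meson finite_subset psubset_card_mono)
    moreover have "card T \<le> card N" using T N by (intro max) auto
    ultimately show False by simp
  qed
  then show ?thesis using N by (auto simp: contraction_nodes_def)
qed

lemma contraction_node_of_vertex:
  assumes fin: "finite V" and L: "laminar V L" and v: "v \<in> V" and \<mu>: "1 \<le> \<mu>"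
  shows "\<exists>N\<in>contraction_nodes L \<mu>. v \<in> N"
proof -
  have "{v} \<in> L" using L v by (auto simp: laminar_def)
  from contraction_node_exists[OF fin L this, of \<mu>] show ?thesis using \<mu> by auto
qed

lemma contraction_node_unique:
  assumes L: "laminar V L" and "N \<in> contraction_nodes L \<mu>" "N' \<in> contraction_nodes L \<mu>" "v \<in> N" "v \<in> N'"
  shows "N = N'"
proof -
  have "N \<in> L" "N' \<in> L" using assms by (auto simp: contraction_nodes_def)
  then have "N \<subseteq> N' \<or> N' \<subseteq> N" using laminar_comparable[OF L] assms by metis
  then show ?thesis using assms(2,3) unfolding contraction_nodes_def by blast
qed

lemma contraction_ends:
  assumes L: "laminar V L" and N: "N \<in> contraction_nodes L \<mu>" "N' \<in> contraction_nodes L \<mu>" "a \<in> N" "b \<in> N'"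
  shows "{S \<in> contraction_nodes L \<mu>. {a, b} \<inter> S \<noteq> {}} = {N, N'}"
proof
  show "{S \<in> contraction_nodes L \<mu>. {a, b} \<inter> S \<noteq> {}} \<subseteq> {N, N'}"
  proof
    fix S assume S: "S \<in> {S \<in> contraction_nodes L \<mu>. {a, b} \<inter> S \<noteq> {}}"
    then have "a \<in> S \<or> b \<in> S" by auto
    then show "S \<in> {N, N'}" using S N contraction_node_unique[OF L, of S \<mu> N a] contraction_node_unique[OF L, of S \<mu> N' b] by auto
  qed
qed (use N in auto)

lemma cut_not_inside_node:
  assumes G: "simple_graph V E" and L: "laminar V L" and N: "N \<in> contraction_nodes L \<mu>" and f: "f \<in> cut E N"
  shows "\<not> (\<exists>S\<in>contraction_nodes L \<mu>. f \<subseteq> S)"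
proof
  assume "\<exists>S\<in>contraction_nodes L \<mu>. f \<subseteq> S"
  then obtain S where S: "S \<in> contraction_nodes L \<mu>" "f \<subseteq> S" by blast
  obtain a b where ab: "f = {a, b}" "a \<in> N" "b \<notin> N" using cut_edge[OF G f] by metis
  then have "N = S" using contraction_node_unique[OF L N S(1), of a] S(2) by auto
  then show False using S ab by auto
qed

section \<open>Lifting vectors from a contraction to the whole graph\<close>

text \<open>An arbitrary choice; inside a contractible node that \<open>e\<close> enters, all
  choices agree.\<close>

definition face_matching :: "'v set \<Rightarrow> 'v set set \<Rightarrow> ('v set \<Rightarrow> real) set \<Rightarrow> 'v set \<Rightarrow> 'v set set" where
  "face_matching V E F e = (SOME M. matching_in_face V E F M \<and> e \<in> M)"

lemma face_matching:
  assumes "simple_graph V E" "is_face V E F" "e \<in> supp E F"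
  shows "matching_in_face V E F (face_matching V E F e)" "e \<in> face_matching V E F e"
  using someI_ex[of "\<lambda>M. matching_in_face V E F M \<and> e \<in> M"] supp_iff_matching[OF assms(1,2), of e] assms(3)
  unfolding face_matching_def by auto

text \<open>Completes a vector on the edges of the contraction inside the contracted nodes: entering a contractible
  node through the edge \<open>e\<close> determines the matching edges inside that node.\<close>

definition lift ::
  "'v set \<Rightarrow> 'v set set \<Rightarrow> ('v set \<Rightarrow> real) set \<Rightarrow> 'v set set \<Rightarrow> nat \<Rightarrow> ('v set \<Rightarrow> int) \<Rightarrow> 'v set \<Rightarrow> int" where
  "lift V E F L \<mu> \<chi> f = (if \<exists>N\<in>contraction_nodes L \<mu>. f \<subseteq> N
     then \<Sum>e\<in>cut E (SOME N. N \<in> contraction_nodes L \<mu> \<and> f \<subseteq> N). \<chi> e * indicator (face_matching V E F e) f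
     else \<chi> f)"

lemma lift_inside:
  assumes G: "simple_graph V E" and L: "laminar V L" and N: "N \<in> contraction_nodes L \<mu>" and f: "f \<in> E" "f \<subseteq> N"
  shows "lift V E F L \<mu> \<chi> f = (\<Sum>e\<in>cut E N. \<chi> e * indicator (face_matching V E F e) f)"
proof -
  obtain a b where ab: "f = {a, b}" using simple_graph_edge[OF G f(1)] by metis
  have "(SOME N. N \<in> contraction_nodes L \<mu> \<and> f \<subseteq> N) = N"
  proof (rule some_equality)
    show "N \<in> contraction_nodes L \<mu> \<and> f \<subseteq> N" using N f by blast
    show "S = N" if "S \<in> contraction_nodes L \<mu> \<and> f \<subseteq> S" for S
      using that contraction_node_unique[OF L, of S \<mu> N a] N f ab by auto
  qed
  then show ?thesis using N f by (auto simp: lift_def)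
qed

lemma lift_outside:
  "\<not> (\<exists>N\<in>contraction_nodes L \<mu>. f \<subseteq> N) \<Longrightarrow> lift V E F L \<mu> \<chi> f = \<chi> f"
  by (simp add: lift_def)

lemma contractible_unique:
  assumes "contractible V E F S" "e \<in> cut E S" "matching_in_face V E F M" "matching_in_face V E F N" "e \<in> M" "e \<in> N"
  shows "M \<inter> edges_inside E S = N \<inter> edges_inside E S"
  using assms unfolding contractible_def by blast

lemma alt_vec_support: "alt_vec es e \<noteq> 0 \<Longrightarrow> e \<in> set es"
proof (rule ccontr)
  assume "alt_vec es e \<noteq> 0" "e \<notin> set es"
  then have "(\<Sum>i<length es. (-1) ^ i * indicator {es ! i} e) = (0::int)"
    by (intro sum.neutral) (auto simp: indicator_def)
  then show False using \<open>alt_vec es e \<noteq> 0\<close> by (simp add: alt_vec_def)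
qed

lemma alt_vec_norm:
  assumes "finite A"
  shows "(\<Sum>e\<in>A. \<bar>alt_vec es e\<bar>) \<le> int (length es)"
proof -
  have "(\<Sum>e\<in>A. \<bar>alt_vec es e\<bar>) \<le> (\<Sum>e\<in>A. \<Sum>i<length es. indicator {es ! i} e)"
  proof (rule sum_mono)
    fix e
    have "\<bar>alt_vec es e\<bar> \<le> (\<Sum>i<length es. \<bar>(-1) ^ i * indicator {es ! i} e\<bar>)" unfolding alt_vec_def by (rule sum_abs)
    also have "\<dots> = (\<Sum>i<length es. indicator {es ! i} e)" by (simp add: abs_mult power_abs indicator_def)
    finally show "\<bar>alt_vec es e\<bar> \<le> (\<Sum>i<length es. indicator {es ! i} e)" .
  qed
  also have "\<dots> = (\<Sum>i<length es. \<Sum>e\<in>A. indicator {es ! i} e)" by (rule sum.swap)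
  also have "\<dots> \<le> (\<Sum>i<length es. 1)"
  proof (rule sum_mono)
    fix i
    have "card (A \<inter> {es ! i}) \<le> card {es ! i}" by (intro card_mono) auto
    then show "(\<Sum>e\<in>A. indicator {es ! i} e) \<le> (1::int)" using assms by (simp add: indicator_def)
  qed
  finally show ?thesis by simp
qed

lemma simple_graph_card_edges:
  assumes G: "simple_graph V E"
  shows "2 * card E \<le> card V ^ 2"
proof -
  note fin = simple_graph_finite[OF G]
  have "E \<subseteq> {K. K \<subseteq> V \<and> card K = 2}" using G by (auto simp: simple_graph_def)
  then have "card E \<le> card {K. K \<subseteq> V \<and> card K = 2}" using fin by (intro card_mono) auto
  then have "card E \<le> card V choose 2" using n_subsets[OF fin(1), of 2] by simp
  then have "2 * card E \<le> card V * (card V - 1)" by (simp add: choose_two)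
  also have "\<dots> \<le> card V ^ 2" by (simp add: power2_eq_square)
  finally show ?thesis .
qed

text \<open>Nine summands of at most \<open>(2 * n ^ 2) ^ 8 = 256 * n ^ 16\<close> bound the number
  of circuit vectors by \<open>2304 * n ^ 16\<close>, the origin of the threshold for
  \<open>n\<close>. Lifts are nonzero because they agree with the circuit outside the nodes, and
  their entries are bounded by the length of the circuit, which is at most its node-weight.\<close>

lemma isolate_circuits:
  assumes G: "simple_graph V E" and n: "card V = n" "2304 \<le> n" and num: "bij_betw num E {1..card E}"
    and L: "laminar V L" "L \<subseteq> tight V E F" and l: "l \<le> n"
    and none: "\<And>vs es. alternating_circuit (contraction E F L \<mu>) vs es \<Longrightarrow> l < walk_weight (contraction E F L \<mu>) vs"
  shows "\<exists>w\<in>weights n num. \<forall>\<chi>\<in>circuit_vecs (contraction E F L \<mu>) (2 * l). (\<Sum>e\<in>E. w e * lift V E F L \<mu> \<chi> e) \<noteq> 0"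
proof -
  note fin = simple_graph_finite[OF G]
  let ?H = "contraction E F L \<mu>"
  let ?C = "circuit_vecs ?H (2 * l)"
  let ?lift = "lift V E F L \<mu>"
  have edgesE: "edges ?H \<subseteq> E" by (auto simp: contraction_def supp_def)
  then have finH: "finite (edges ?H)" using fin finite_subset by blast
  have cE: "2 * card E \<le> n ^ 2" using simple_graph_card_edges[OF G] n by simp
  have "card (edges ?H) \<le> card E" using edgesE fin by (intro card_mono) auto
  then have cH: "4 * card (edges ?H) \<le> 2 * n ^ 2" using cE by simp
  note count = card_circuit_vecs[OF none finH]
  have "card ?C \<le> (\<Sum>i\<le>8. (4 * card (edges ?H)) ^ i)" by (rule count(2))
  also have "\<dots> \<le> (\<Sum>i\<le>8::nat. (2 * n ^ 2) ^ 8)"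
  proof (rule sum_mono)
    fix i :: nat assume "i \<in> {..8}"
    then have "(2 * n ^ 2) ^ i \<le> (2 * n ^ 2) ^ 8" using n by (intro power_increasing) auto
    moreover have "(4 * card (edges ?H)) ^ i \<le> (2 * n ^ 2) ^ i" using cH by (intro power_mono) auto
    ultimately show "(4 * card (edges ?H)) ^ i \<le> (2 * n ^ 2) ^ 8" by simp
  qed
  also have "\<dots> = 2304 * n ^ 16" by (simp add: power_mult_distrib flip: power_mult)
  also have "\<dots> \<le> n * n ^ 16" using n by (intro mult_right_mono) auto
  also have "\<dots> = n ^ 17" by (simp flip: power_Suc)
  finally have cardC: "card ?C \<le> n ^ 17" .
  have props: "(\<exists>e\<in>E. ?lift \<chi> e \<noteq> 0) \<and> (\<forall>e\<in>E. \<bar>?lift \<chi> e\<bar> \<le> 4 * int n ^ 2)" if \<chi>: "\<chi> \<in> ?C" for \<chi>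
  proof -
    obtain vs es where c: "alternating_circuit ?H vs es" "walk_weight ?H vs \<le> 2 * l" "\<chi> = alt_vec es"
      using \<chi> by (auto simp: circuit_vecs_def)
    have cw: "cyclic_walk ?H vs es" "alt_vec es \<noteq> (\<lambda>e. 0)" using c by (auto simp: alternating_circuit_def)
    obtain e where e: "\<chi> e \<noteq> 0" using cw c by (auto simp: fun_eq_iff)
    then have "e \<in> edges ?H" using alt_vec_support[of es e] c cw by (auto simp: cyclic_walk_def)
    then have "e \<in> E" "?lift \<chi> e = \<chi> e" using edgesE by (auto simp: contraction_def lift_def)
    then have nz: "\<exists>e\<in>E. ?lift \<chi> e \<noteq> 0" using e by (intro bexI[of _ e]) simp_all
    have "length es \<le> walk_weight ?H vs"
    proof -
      have pos: "1 \<le> node_weight ?H v" if "v \<in> set vs" for v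
      proof -
        have "v \<in> L" using that cw by (auto simp: cyclic_walk_def contraction_def contraction_nodes_def)
        then have "odd (card v)" using L by (auto simp: tight_def)
        then have "0 < card v" by (rule odd_pos)
        then show ?thesis by (simp add: contraction_def)
      qed
      have "(\<Sum>v\<leftarrow>vs. 1) \<le> (\<Sum>v\<leftarrow>vs. node_weight ?H v)" by (rule sum_list_mono) (rule pos)
      then show ?thesis using cw by (simp add: walk_weight_def cyclic_walk_def sum_list_triv)
    qed
    then have len: "int (length es) \<le> 2 * int n" using c(2) l by simp
    have n2: "2 * int n \<le> 4 * int n ^ 2"
    proof -
      have "int n * 1 \<le> int n * int n" using n by (intro mult_left_mono) auto
      then show ?thesis by (simp add: power2_eq_square)
    qed
    have "\<bar>?lift \<chi> f\<bar> \<le> 4 * int n ^ 2" if f: "f \<in> E" for f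
    proof (cases "\<exists>N\<in>contraction_nodes L \<mu>. f \<subseteq> N")
      case True
      then obtain N where N: "N \<in> contraction_nodes L \<mu>" "f \<subseteq> N" by blast
      have "\<bar>?lift \<chi> f\<bar> \<le> (\<Sum>e\<in>cut E N. \<bar>\<chi> e * indicator (face_matching V E F e) f\<bar>)"
        unfolding lift_inside[OF G L(1) N(1) f N(2)] by (rule sum_abs)
      also have "\<dots> \<le> (\<Sum>e\<in>cut E N. \<bar>\<chi> e\<bar>)" by (intro sum_mono) (auto simp: indicator_def)
      also have "\<dots> \<le> int (length es)" unfolding c(3) using fin by (intro alt_vec_norm) simp
      finally show ?thesis using len n2 by linarith
    next
      case False
      have "(\<Sum>e\<in>{f}. \<bar>\<chi> e\<bar>) \<le> int (length es)" unfolding c(3) by (intro alt_vec_norm) simp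
      then show ?thesis using lift_outside[OF False] len n2 by simp
    qed
    then show ?thesis using nz by blast
  qed
  have "\<exists>w\<in>weights n num. \<forall>y\<in>?lift ` ?C. (\<Sum>e\<in>E. w e * y e) \<noteq> 0"
  proof (rule exists_isolating_weight)
    show "card (?lift ` ?C) \<le> n ^ 17" using card_image_le[OF count(1)] cardC by (rule order_trans)
    show "\<exists>e\<in>E. y e \<noteq> 0" if "y \<in> ?lift ` ?C" for y using that props by auto
    show "\<bar>y e\<bar> \<le> 4 * int n ^ 2" if "y \<in> ?lift ` ?C" "e \<in> E" for y e using that props by auto
  qed (use n cE num fin count(1) in auto)
  then show ?thesis by simp
qed

text \<open>A circuit of weight at most \<open>l\<close> visits only nodes of size at most
  \<open>l\<close>, which are nodes of the finer contraction as well. Its edges avoid the cuts of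
  sets \<open>T\<close> with \<open>l < card T \<le> 2 * l\<close>: an endpoint in \<open>T\<close>
  would lie in a visited node properly inside \<open>T\<close>, against the maximality of that
  node.\<close>

lemma no_light_circuit_coarser:
  assumes G: "simple_graph V E" and L: "laminar V L" and l: "1 \<le> l" and sub: "supp E F' \<subseteq> supp E F"
    and none: "\<And>vs es. alternating_circuit (contraction E F L l) vs es \<Longrightarrow> l < walk_weight (contraction E F L l) vs"
    and c: "alternating_circuit (contraction E F' L (2 * l)) vs es"
  shows "l < walk_weight (contraction E F' L (2 * l)) vs"
proof (rule ccontr)
  let ?H = "contraction E F L l" and ?H' = "contraction E F' L (2 * l)"
  note fin = simple_graph_finite[OF G]
  assume "\<not> ?thesis"
  then have wt: "(\<Sum>v\<leftarrow>vs. card v) \<le> l" by (simp add: walk_weight_def contraction_def)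
  have cw: "cyclic_walk ?H' vs es" using c by (simp add: alternating_circuit_def)
  have small: "card N \<le> l" if "N \<in> set vs" for N
    using member_le_sum_list[of "card N" "map card vs"] that wt by auto
  have nodes: "N \<in> contraction_nodes L (2 * l)" if "N \<in> set vs" for N
    using that cw by (auto simp: cyclic_walk_def contraction_def)
  have nodes': "N \<in> contraction_nodes L l" if "N \<in> contraction_nodes L (2 * l)" "card N \<le> l" for N
    using that unfolding contraction_nodes_def by auto
  have edge: "es ! i \<in> edges ?H \<and> ends ?H (es ! i) = {vs ! i, vs ! (Suc i mod length es)}" if i: "i < length es" for i
  proof -
    let ?e = "es ! i"
    have e': "?e \<in> edges ?H'" using cw i by (auto simp: cyclic_walk_def)
    then have e: "?e \<in> supp E F'" "\<And>T. T \<in> L \<Longrightarrow> card T > 2 * l \<Longrightarrow> ?e \<notin> cut E T"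
      "\<And>S. S \<in> contraction_nodes L (2 * l) \<Longrightarrow> \<not> ?e \<subseteq> S" by (auto simp: contraction_def)
    have eE: "?e \<in> E" using e(1) by (simp add: supp_def)
    obtain a b where ab: "?e = {a, b}" "a \<noteq> b" "a \<in> V" "b \<in> V" using simple_graph_edge[OF G eE] by metis
    have endse: "{S \<in> contraction_nodes L (2 * l). ?e \<inter> S \<noteq> {}} = {vs ! i, vs ! (Suc i mod length es)}"
      using cw i by (simp add: cyclic_walk_def contraction_def)
    have "Suc i mod length es < length es" using i by (intro mod_less_divisor) auto
    then have vsi: "vs ! i \<in> set vs" "vs ! (Suc i mod length es) \<in> set vs"
      using cw i by (auto simp: cyclic_walk_def intro!: nth_mem)
    have vsm: "card S \<le> l" if "S \<in> contraction_nodes L (2 * l)" "?e \<inter> S \<noteq> {}" for S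
    proof -
      have "S \<in> {vs ! i, vs ! (Suc i mod length es)}" unfolding endse[symmetric] using that by simp
      then show ?thesis using small vsi by auto
    qed
    have l2: "1 \<le> 2 * l" using l by simp
    obtain Na Nb where N: "Na \<in> contraction_nodes L (2 * l)" "a \<in> Na" "Nb \<in> contraction_nodes L (2 * l)" "b \<in> Nb"
      using contraction_node_of_vertex[OF fin(1) L ab(3) l2] contraction_node_of_vertex[OF fin(1) L ab(4) l2] by blast
    have Nl: "Na \<in> contraction_nodes L l" "Nb \<in> contraction_nodes L l"
      using N ab vsm by (auto intro!: nodes')
    have "ends ?H ?e = {Na, Nb}"
      using contraction_ends[OF L Nl N(2,4)] ab by (simp add: contraction_def)
    moreover have "{S \<in> contraction_nodes L (2 * l). ?e \<inter> S \<noteq> {}} = {Na, Nb}"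
      using contraction_ends[OF L N(1,3,2,4)] ab by simp
    ultimately have "ends ?H ?e = {vs ! i, vs ! (Suc i mod length es)}" using endse by simp
    moreover have "?e \<notin> cut E T" if T: "T \<in> L" "card T > l" for T
    proof (cases "card T > 2 * l")
      case False
      have nt: "\<not> (N \<in> contraction_nodes L (2 * l) \<and> card N \<le> l \<and> v \<in> N \<and> v \<in> T)" for N v
      proof
        assume N: "N \<in> contraction_nodes L (2 * l) \<and> card N \<le> l \<and> v \<in> N \<and> v \<in> T"
        then have NL: "N \<in> L" by (simp add: contraction_nodes_def)
        have "finite N" using NL L fin by (meson PowD finite_subset laminar_def subsetD)
        then have "\<not> T \<subseteq> N" using N T card_mono[of N T] by linarith
        then have "N \<subset> T" using laminar_comparable[OF L NL T(1)] N by blast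
        then show False using N T False unfolding contraction_nodes_def by auto
      qed
      have "a \<notin> T" using nt[of Na a] N vsm[of Na] ab by auto
      moreover have "b \<notin> T" using nt[of Nb b] N vsm[of Nb] ab by auto
      ultimately show ?thesis using ab by (simp add: pair_mem_cut)
    qed (use e(2) T in blast)
    moreover have "\<not> ?e \<subseteq> S" if S: "S \<in> contraction_nodes L l" for S
    proof
      assume "?e \<subseteq> S"
      moreover obtain N where "N \<in> contraction_nodes L (2 * l)" "S \<subseteq> N"
        using contraction_node_exists[OF fin(1) L, of S "2 * l"] S by (auto simp: contraction_nodes_def)
      ultimately show False using e(3) by blast
    qed
    moreover have "?e \<in> supp E F" using e(1) sub by blast
    ultimately show ?thesis by (auto simp: contraction_def)
  qed
  have "cyclic_walk ?H vs es"
    unfolding cyclic_walk_def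
  proof (intro conjI)
    show "length vs = length es" using cw by (simp add: cyclic_walk_def)
    show "set vs \<subseteq> nodes ?H" using nodes nodes' small by (auto simp: contraction_def)
    show "set es \<subseteq> edges ?H" using edge by (auto simp: in_set_conv_nth)
  qed (use edge in blast)
  then have "alternating_circuit ?H vs es" using c by (simp add: alternating_circuit_def)
  from none[OF this] show False using wt by (simp add: walk_weight_def contraction_def)
qed

lemma matching_in_face_mono: "F' \<subseteq> F \<Longrightarrow> matching_in_face V E F' M \<Longrightarrow> matching_in_face V E F M"
  by (auto simp: matching_in_face_def)

lemma tight_antimono: "F' \<subseteq> F \<Longrightarrow> tight V E F \<subseteq> tight V E F'"
  by (auto simp: tight_def)

lemma supp_mono: "F' \<subseteq> F \<Longrightarrow> supp E F' \<subseteq> supp E F"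
  by (auto simp: supp_def)

text \<open>By \<open>laminar_span\<close> it suffices to treat a maximal laminar family of tight
  sets of \<open>F'\<close>. A member contained in no node is a union of nodes, and on its cut the
  lift coincides with \<open>\<chi>\<close>. For a member \<open>S\<close> inside a node
  \<open>N\<close>, each edge \<open>e\<close> in the cut of \<open>N\<close> with
  \<open>\<chi> e \<noteq> 0\<close> extends to a matching with exactly one edge in the cut of
  \<open>S\<close>. So the cut of \<open>S\<close> receives \<open>\<chi> e\<close> once for every
  \<open>e\<close>, in total the sum over the cut of \<open>N\<close>, which is zero.\<close>

lemma lift_orthogonal:
  assumes G: "simple_graph V E" and F: "is_face V E F" and F': "is_face V E F'" and sub: "F' \<subseteq> F"
    and L: "laminar V L" "L \<subseteq> tight V E F" and \<mu>: "1 \<le> \<mu>"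
    and con: "\<And>N. N \<in> contraction_nodes L \<mu> \<Longrightarrow> contractible V E F N"
    and supp: "\<And>e. \<chi> e \<noteq> 0 \<Longrightarrow> e \<in> supp E F'"
    and resp: "\<And>S \<N>. S \<in> tight V E F' \<Longrightarrow> \<N> \<subseteq> contraction_nodes L \<mu> \<Longrightarrow> S = \<Union>\<N> \<Longrightarrow> (\<Sum>e\<in>cut E S. \<chi> e) = 0"
  shows "\<And>f. f \<notin> supp E F' \<Longrightarrow> lift V E F L \<mu> \<chi> f = 0"
    "\<And>S. S \<in> tight V E F' \<Longrightarrow> (\<Sum>f\<in>cut E S. lift V E F L \<mu> \<chi> f) = 0"
proof -
  note fin = simple_graph_finite[OF G]
  let ?y = "lift V E F L \<mu> \<chi>" and ?M = "face_matching V E F"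
  have Lt: "L \<subseteq> tight V E F'" using L tight_antimono[OF sub] by blast
  have nodeL: "N \<in> L" if "N \<in> contraction_nodes L \<mu>" for N using that by (simp add: contraction_nodes_def)
  \<comment> \<open>The lift is built from matchings of \<open>F\<close>; inside a contractible node
    they may be replaced by matchings of the smaller face \<open>F'\<close>.\<close>
  have key: "\<exists>M'. matching_in_face V E F' M' \<and> e \<in> M' \<and> M' \<inter> edges_inside E N = ?M e \<inter> edges_inside E N"
    if N: "N \<in> contraction_nodes L \<mu>" and e: "e \<in> cut E N" "\<chi> e \<noteq> 0" for N e
  proof -
    have e': "e \<in> supp E F'" using supp e by blast
    then obtain M' where M': "matching_in_face V E F' M'" "e \<in> M'" using supp_iff_matching[OF G F'] by blast
    have eF: "e \<in> supp E F" using e' supp_mono[OF sub] by blast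
    note fm = face_matching[OF G F eF]
    have "M' \<inter> edges_inside E N = ?M e \<inter> edges_inside E N"
      by (rule contractible_unique[OF con[OF N] e(1) matching_in_face_mono[OF sub M'(1)] fm(1) M'(2) fm(2)])
    then show ?thesis using M' by blast
  qed
  show zero: "?y f = 0" if f: "f \<notin> supp E F'" for f
  proof (cases "\<exists>N\<in>contraction_nodes L \<mu>. f \<subseteq> N")
    case False
    then show ?thesis using lift_outside[OF False] supp f by metis
  next
    case True
    define N where "N = (SOME N. N \<in> contraction_nodes L \<mu> \<and> f \<subseteq> N)"
    have N: "N \<in> contraction_nodes L \<mu>" "f \<subseteq> N" unfolding N_def using someI_ex[of "\<lambda>N. N \<in> contraction_nodes L \<mu> \<and> f \<subseteq> N"] True by blast+
    have "\<chi> e * indicator (?M e) f = 0" if e: "e \<in> cut E N" for e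
    proof (cases "\<chi> e = 0")
      case False
      then obtain M' where M': "matching_in_face V E F' M'" "M' \<inter> edges_inside E N = ?M e \<inter> edges_inside E N"
        using key[OF N(1) e] by blast
      have eF: "e \<in> supp E F" using supp[OF False] supp_mono[OF sub] by blast
      have "f \<notin> M'" using M' f supp_iff_matching[OF G F'] by blast
      moreover have "?M e \<subseteq> E" using face_matching[OF G F eF] by (auto simp: matching_in_face_def perfect_matching_def)
      ultimately have "f \<notin> ?M e" using M'(2) N by (auto simp: edges_inside_def)
      then show ?thesis by simp
    qed simp
    then have "(\<Sum>e\<in>cut E N. \<chi> e * indicator (?M e) f) = 0" by (intro sum.neutral) blast
    then show ?thesis using True by (simp add: lift_def N_def)
  qed
  \<comment> \<open>The face \<open>F'\<close> may have more tight sets than \<open>F\<close>, so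
    \<open>L\<close> has to be enlarged to become maximal.\<close>
  obtain L' where L': "L \<subseteq> L'" "maximal_laminar_subset V (tight V E F') L'"
    using exists_maximal_laminar[OF fin(1) L(1) Lt] by blast
  have lam': "laminar V L'" "L' \<subseteq> tight V E F'" using L' by (auto simp: maximal_laminar_subset_def)
  have "(\<Sum>f\<in>cut E S. ?y f) = 0" if S: "S \<in> L'" for S
  proof (cases "\<exists>N\<in>contraction_nodes L \<mu>. S \<subseteq> N")
    case True
    then obtain N where N: "N \<in> contraction_nodes L \<mu>" "S \<subseteq> N" by blast
    have St: "S \<in> tight V E F'" using S lam' by blast
    have Nt: "N \<in> tight V E F'" using nodeL[OF N(1)] Lt by blast
    have split: "cut E S = (cut E S \<inter> edges_inside E N) \<union> (cut E S \<inter> cut E N)"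
    proof -
      have "f \<in> edges_inside E N \<or> f \<in> cut E N" if f: "f \<in> cut E S" for f
      proof -
        have "f \<inter> S \<noteq> {}" using f by (auto simp: cut_def)
        then obtain v where "v \<in> f" "v \<in> N" using N by blast
        then show ?thesis using edge_meets[OF G, of f v N] f cut_subset by blast
      qed
      then show ?thesis by blast
    qed
    have disj: "edges_inside E N \<inter> cut E N = {}"
      using cut_not_inside_node[OF G L(1) N(1)] N(1) by (auto simp: edges_inside_def)
    have fc: "finite (cut E S)" "finite (cut E N)" using fin by auto
    have "(\<Sum>f\<in>cut E S. ?y f) = (\<Sum>f\<in>cut E S \<inter> edges_inside E N. ?y f) + (\<Sum>f\<in>cut E S \<inter> cut E N. ?y f)"
      by (subst split, rule sum.union_disjoint) (use fc disj in auto)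
    also have "(\<Sum>f\<in>cut E S \<inter> edges_inside E N. ?y f) = (\<Sum>f\<in>cut E S \<inter> edges_inside E N. \<Sum>e\<in>cut E N. \<chi> e * indicator (?M e) f)"
      using lift_inside[OF G L(1) N(1)] by (intro sum.cong) (auto simp: edges_inside_def)
    also have "\<dots> = (\<Sum>e\<in>cut E N. \<Sum>f\<in>cut E S \<inter> edges_inside E N. \<chi> e * indicator (?M e) f)" by (rule sum.swap)
    also have "(\<Sum>f\<in>cut E S \<inter> cut E N. ?y f) = (\<Sum>f\<in>cut E S \<inter> cut E N. \<chi> f)"
      using cut_not_inside_node[OF G L(1) N(1)] by (intro sum.cong) (auto intro!: lift_outside)
    also have "\<dots> = (\<Sum>e\<in>cut E N. \<chi> e * indicator (cut E S) e)"
      using sum_indicator_mult[OF fc(2), of "cut E S" \<chi>] by (simp add: mult.commute Int_commute)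
    finally have "(\<Sum>f\<in>cut E S. ?y f) = (\<Sum>e\<in>cut E N. \<chi> e * ((\<Sum>f\<in>cut E S \<inter> edges_inside E N. indicator (?M e) f) + indicator (cut E S) e))"
      by (simp add: sum.distrib[symmetric] algebra_simps sum_distrib_left)
    also have "\<dots> = (\<Sum>e\<in>cut E N. \<chi> e)"
    proof (rule sum.cong[OF refl])
      fix e assume e: "e \<in> cut E N"
      show "\<chi> e * ((\<Sum>f\<in>cut E S \<inter> edges_inside E N. indicator (?M e) f) + indicator (cut E S) e) = \<chi> e"
      proof (cases "\<chi> e = 0")
        case False
        obtain M' where M': "matching_in_face V E F' M'" "e \<in> M'" "M' \<inter> edges_inside E N = ?M e \<inter> edges_inside E N"
          using key[OF N(1) e False] by blast
        obtain g where g: "M' \<inter> cut E S = {g}" using tight_matching[OF G St M'(1)] by blast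
        obtain h where h: "M' \<inter> cut E N = {h}" using tight_matching[OF G Nt M'(1)] by blast
        have he: "M' \<inter> cut E N = {e}" using h e M'(2) by blast
        have fi: "finite (cut E S \<inter> edges_inside E N)" using fc by blast
        have "(\<Sum>f\<in>cut E S \<inter> edges_inside E N. indicator (?M e) f :: int) = int (card (cut E S \<inter> edges_inside E N \<inter> ?M e))"
          using fi by (simp add: indicator_def)
        also have "cut E S \<inter> edges_inside E N \<inter> ?M e = {g} \<inter> edges_inside E N" using M'(3) g by blast
        finally have s: "(\<Sum>f\<in>cut E S \<inter> edges_inside E N. indicator (?M e) f :: int) = int (card ({g} \<inter> edges_inside E N))" .
        \<comment> \<open>The one edge \<open>g\<close> of the matching in the cut of
          \<open>S\<close> is either counted inside \<open>N\<close> or is \<open>e\<close> itself,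
          never both.\<close>
        show ?thesis
        proof (cases "g \<in> edges_inside E N")
          case True
          then have "e \<notin> cut E S" using g he M'(2) disj by blast
          then show ?thesis using True s by simp
        next
          case F: False
          then have "g \<in> cut E N" using g split by blast
          then have "g = e" using g he by blast
          then have "e \<in> cut E S" using g by blast
          then show ?thesis using F s by simp
        qed
      qed simp
    qed
    also have "\<dots> = 0" using resp[OF Nt, of "{N}"] N by simp
    finally show ?thesis .
  next
    case False
    have St: "S \<in> tight V E F'" using S lam' by blast
    have SV: "S \<subseteq> V" using St by (simp add: tight_def)
    define \<N> where "\<N> = {N \<in> contraction_nodes L \<mu>. N \<inter> S \<noteq> {}}"
    have inS: "N \<subseteq> S" if "N \<in> \<N>" for N
    proof -
      have N: "N \<in> contraction_nodes L \<mu>" "N \<inter> S \<noteq> {}" using that by (auto simp: \<N>_def)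
      have "N \<in> L'" using nodeL[OF N(1)] L' by blast
      then show ?thesis using laminar_comparable[OF lam'(1) _ S, of N] N False by blast
    qed
    have "S = \<Union>\<N>"
    proof
      show "S \<subseteq> \<Union>\<N>" using contraction_node_of_vertex[OF fin(1) L(1) _ \<mu>] SV by (fastforce simp: \<N>_def)
    qed (use inS in blast)
    then have z: "(\<Sum>e\<in>cut E S. \<chi> e) = 0" using St by (intro resp[of _ \<N>]) (auto simp: \<N>_def)
    have "?y f = \<chi> f" if f: "f \<in> cut E S" for f
    proof (rule lift_outside, rule notI)
      assume "\<exists>N\<in>contraction_nodes L \<mu>. f \<subseteq> N"
      then obtain N where N: "N \<in> contraction_nodes L \<mu>" "f \<subseteq> N" by blast
      have "f \<inter> S \<noteq> {}" using f by (auto simp: cut_def)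
      then have "N \<subseteq> S" using N by (intro inS) (auto simp: \<N>_def)
      then have "f \<inter> S = f" using N by blast
      then show False using f G by (auto simp: cut_def simple_graph_def)
    qed
    then show ?thesis using z by simp
  qed
  then show "(\<Sum>f\<in>cut E S. ?y f) = 0" if "S \<in> tight V E F'" for S
    using laminar_span[OF G F' L'(2), of ?y S] zero that by blast
qed

lemma no_respecting_circuit:
  assumes G: "simple_graph V E" and F: "is_face V E F"
    and L: "laminar V L" "L \<subseteq> tight V E F" and \<mu>: "1 \<le> \<mu>"
    and con: "\<And>N. N \<in> contraction_nodes L \<mu> \<Longrightarrow> contractible V E F N"
    and iso: "\<And>\<chi>. \<chi> \<in> circuit_vecs (contraction E F L \<mu>) r \<Longrightarrow> (\<Sum>e\<in>E. w e * lift V E F L \<mu> \<chi> e) \<noteq> 0"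
    and c: "alternating_circuit (contraction E (Min_face E F w) L \<mu>) vs es"
    and resp: "respects_face V E (contraction E (Min_face E F w) L \<mu>) (Min_face E F w) es"
  shows "r < walk_weight (contraction E (Min_face E F w) L \<mu>) vs"
proof (rule ccontr)
  let ?F = "Min_face E F w" and ?H = "contraction E F L \<mu>" and ?H' = "contraction E (Min_face E F w) L \<mu>"
  note fin = simple_graph_finite[OF G]
  note F' = Min_face_is_face[OF G F, of w]
  assume "\<not> ?thesis"
  then have wt: "walk_weight ?H vs \<le> r" by (simp add: walk_weight_def contraction_def)
  have "edges ?H' \<subseteq> edges ?H" using supp_mono[OF Min_face_subset[of E F w], of E] by (auto simp: contraction_def)
  moreover have "nodes ?H' = nodes ?H" "ends ?H' = ends ?H" by (simp_all add: contraction_def)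
  ultimately have "alternating_circuit ?H vs es" using c unfolding alternating_circuit_def cyclic_walk_def by auto
  then have "alt_vec es \<in> circuit_vecs ?H r" using wt by (auto simp: circuit_vecs_def)
  from iso[OF this] have nz: "(\<Sum>e\<in>E. w e * lift V E F L \<mu> (alt_vec es) e) \<noteq> 0" .
  have sp: "e \<in> supp E ?F" if "alt_vec es e \<noteq> 0" for e using that resp by (auto simp: respects_face_def)
  have rs: "(\<Sum>e\<in>cut E S. alt_vec es e) = 0"
    if S: "S \<in> tight V E ?F" "\<N> \<subseteq> contraction_nodes L \<mu>" "S = \<Union>\<N>" for S \<N>
  proof -
    have "\<exists>\<N>\<subseteq>nodes ?H'. S = \<Union>\<N>" using S by (auto simp: contraction_def)
    then have "(\<Sum>e\<in>E. alt_vec es e * indicator (cut E S) e) = 0" using resp S by (simp add: respects_face_def)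
    then show ?thesis
      using sum_indicator_mult[OF fin(2), of "cut E S" "alt_vec es"] cut_subset[of E S]
      by (simp add: mult.commute Int_absorb1)
  qed
  note orth = lift_orthogonal[where \<chi> = "alt_vec es", OF G F F' Min_face_subset L \<mu> con sp rs]
  have "(\<Sum>e\<in>E. w e * lift V E F L \<mu> (alt_vec es) e) = 0"
    by (rule Min_face_orthogonal[OF G F]) (rule orth; assumption)+
  then show False using nz by blast
qed

section \<open>Contractibility of consecutive intervals\<close>

text \<open>Alternating between two fixed-point-free involutions works like following two matchings
  through a component of their symmetric difference. Every step can be undone, so the first
  repetition must be a return to the start, and by an even number of steps.\<close>

lemma alternating_orbit:
  assumes fin: "finite A" and s1: "\<And>u. u \<in> A \<Longrightarrow> s1 u \<in> A \<and> s1 u \<noteq> u \<and> s1 (s1 u) = u"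
    and s2: "\<And>u. u \<in> A \<Longrightarrow> s2 u \<in> A \<and> s2 u \<noteq> u \<and> s2 (s2 u) = u" and a: "a \<in> A"
  obtains u :: "nat \<Rightarrow> 'a" and m where "0 < m" "even m" "u m = u 0" "inj_on u {..<m}" "\<And>k. u k \<in> A"
    "\<And>k. u (Suc k) = (if even k then s1 (u k) else s2 (u k))"
    "\<And>v. v \<in> u ` {..<m} \<Longrightarrow> s1 v \<in> u ` {..<m} \<and> s2 v \<in> u ` {..<m}"
proof -
  define u where "u = rec_nat a (\<lambda>k v. if even k then s1 v else s2 v)"
  have u0: "u 0 = a" and uS: "u (Suc k) = (if even k then s1 (u k) else s2 (u k))" for k by (simp_all add: u_def)
  have uA: "u k \<in> A" for k by (induction k) (use u0 uS a s1 s2 in auto)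
  have bk: "(if even k then s1 (u (Suc k)) else s2 (u (Suc k))) = u k" for k using uS[of k] s1 s2 uA[of k] by auto
  have ne: "u (Suc k) \<noteq> u k" for k using uS[of k] s1 s2 uA[of k] by auto
  have "\<exists>j. \<exists>i<j. u i = u j"
  proof (rule ccontr)
    assume "\<not> ?thesis"
    then have "inj u" by (metis injI linorder_neqE_nat)
    moreover have "range u \<subseteq> A" using uA by blast
    ultimately show False using fin by (meson finite_imageD finite_subset infinite_UNIV_nat)
  qed
  then obtain j where j: "\<exists>i<j. u i = u j" and least: "\<And>k. k < j \<Longrightarrow> \<not> (\<exists>i<k. u i = u k)"
    using exists_least_iff[of "\<lambda>j. \<exists>i<j. u i = u j"] by metis
  obtain i where i: "i < j" "u i = u j" using j by blast
  obtain p where p: "j = Suc p" using i by (cases j) auto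
  have dist: "k = k'" if "u k = u k'" "k < j" "k' < j" for k k'
    using least[of k] least[of k'] that by (metis linorder_neqE_nat)
  have ip: "i \<noteq> p" using i p ne[of p] by metis
  have bp: "(if even p then s1 (u i) else s2 (u i)) = u p" using bk[of p] unfolding p[symmetric] i(2)[symmetric] .
  \<comment> \<open>If \<open>u i\<close> were reached again through the involution by which it was
    left, \<open>u p\<close> would equal \<open>u (Suc i)\<close>, which forces
    \<open>p = Suc i\<close> and contradicts the parities.\<close>
  have fwd: "even p \<noteq> even i"
  proof
    assume "even p = even i"
    then have "u (Suc i) = u p" using bp uS[of i] by (auto split: if_splits)
    then have "Suc i = p" using dist[of "Suc i" p] i p ip by simp
    then show False using \<open>even p = even i\<close> by auto
  qed
  \<comment> \<open>If \<open>u i\<close> had a predecessor, the same involution would lead from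
    \<open>u i\<close> back to it and to \<open>u p\<close>, an earlier repetition.\<close>
  have i0: "i = 0"
  proof (rule ccontr)
    assume "i \<noteq> 0"
    then obtain q where q: "i = Suc q" by (cases i) auto
    have "even p = even q" using fwd q by auto
    then have "u p = u q" using bp bk[of q] q by (auto split: if_splits)
    then show False using dist[of p q] i p q by simp
  qed
  have ev: "even j" using fwd i0 p by simp
  have um: "u j = u 0" using i i0 by simp
  have inj: "inj_on u {..<j}" using dist by (auto intro: inj_onI)
  have mem: "u k \<in> u ` {..<j}" if "k \<le> j" for k
    using that um p by (cases "k = j") auto
  have closed: "s1 v \<in> u ` {..<j} \<and> s2 v \<in> u ` {..<j}" if v: "v \<in> u ` {..<j}" for v
  proof -
    obtain k where k: "v = u k" "k < j" using v by blast
    define q where "q = (if k = 0 then p else k - 1)"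
    have q: "u (Suc q) = v" "even q \<noteq> even k" "q < j" using k um p ev by (auto simp: q_def)
    have "(if even k then s1 v else s2 v) \<in> u ` {..<j}" using mem[of "Suc k"] uS[of k] k by (auto split: if_splits)
    moreover have "(if even q then s1 v else s2 v) \<in> u ` {..<j}" using bk[of q] q(1,3) mem[of q] by (auto split: if_splits)
    ultimately show ?thesis using q(2) by (auto split: if_splits)
  qed
  show ?thesis using that[of j u] i ev um inj uA uS closed by auto
qed

text \<open>Think of \<open>g\<close> as the edge joining a node to its partner under
  \<open>s\<close>. Of the two partners exactly one sits at an index of parity \<open>p\<close>, so
  these indices count each edge of the orbit once.\<close>

lemma orbit_sum:
  fixes g :: "'a \<Rightarrow> 'b"
  assumes m: "0 < m" "even m" "u m = u 0" "inj_on u {..<m}"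
    and s: "\<And>k. even k = p \<Longrightarrow> s (u k) = u (Suc k)" and gs: "\<And>k. g (s (u k)) = g (u k)"
    and g: "\<And>k j. g (u k) = g (u j) \<Longrightarrow> u j = u k \<or> u j = s (u k)"
  shows "(\<Sum>t<m. if even t = p then indicator {g (u t)} f else 0) = (indicator (g ` u ` {..<m}) f :: int)"
proof (cases "f \<in> g ` u ` {..<m}")
  case False
  then have "(\<Sum>t<m. if even t = p then indicator {g (u t)} f else 0) = (0::int)"
    by (intro sum.neutral) (auto simp: indicator_def)
  then show ?thesis using False by simp
next
  case True
  then obtain k where k: "k < m" "f = g (u k)" by blast
  obtain j where j: "j < m" "even j = p" "f = g (u j)"
  proof (cases "even k = p")
    case True
    then show ?thesis using k that by blast
  next
    case False
    define j where "j = (if k = 0 then m - 1 else k - 1)"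
    have "u (Suc j) = u k" "even j = p" "j < m" using k m False by (auto simp: j_def)
    then show ?thesis using that[of j] s[of j] gs[of j] k by simp
  qed
  have uniq: "t = j" if t: "t < m" "even t = p" "g (u t) = f" for t
  proof -
    have "u t = u j \<or> u t = u (Suc j)" using g[of j t] t j s[of j] by auto
    then show ?thesis
    proof
      assume "u t = u (Suc j)"
      then have "t = (if Suc j = m then 0 else Suc j)"
        using m t j by (intro inj_onD[OF m(4)]) auto
      then show ?thesis using t(2) j(2) m(2) by (auto split: if_splits)
    qed (use inj_onD[OF m(4)] t j in auto)
  qed
  have "(\<Sum>t<m. if even t = p then indicator {g (u t)} f else 0) = (\<Sum>t<m. if t = j then 1 else (0::int))"
    using uniq j by (intro sum.cong) (auto simp: indicator_def)
  then show ?thesis using True j by simp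
qed

text \<open>For \<open>A = {}\<close> and tight \<open>C\<close> this yields contractibility of
  \<open>C\<close>, since a tight cut contains just one edge of each matching.\<close>

definition interval_contractible ::
  "'v set \<Rightarrow> 'v set set \<Rightarrow> ('v set \<Rightarrow> real) set \<Rightarrow> 'v set \<Rightarrow> 'v set \<Rightarrow> bool" where
  "interval_contractible V E F A C \<longleftrightarrow> (\<forall>M N. matching_in_face V E F M \<longrightarrow> matching_in_face V E F N \<longrightarrow>
     M \<inter> cut E A = N \<inter> cut E A \<longrightarrow> M \<inter> cut E C = N \<inter> cut E C \<longrightarrow>
     M \<inter> edges_inside E (C - A) = N \<inter> edges_inside E (C - A))"

lemma interval_contractible_mono:
  "F' \<subseteq> F \<Longrightarrow> interval_contractible V E F A C \<Longrightarrow> interval_contractible V E F' A C"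
  using matching_in_face_mono unfolding interval_contractible_def by metis

text \<open>One step through the symmetric difference of \<open>M\<close> and \<open>N\<close>: they
  agree on the cut of \<open>D\<close>, so an edge in which they differ cannot leave
  \<open>D\<close>, and it leads to another node at which they differ.\<close>

lemma cut_matching_edge:
  assumes G: "simple_graph V E" and L: "laminar V L" "L \<subseteq> tight V E F" and l: "1 \<le> l"
    and M: "matching_in_face V E F M" and N: "matching_in_face V E F N"
    and D: "\<And>S. S \<in> contraction_nodes L l \<Longrightarrow> S \<inter> D \<noteq> {} \<Longrightarrow> S \<subseteq> D" and DV: "D \<subseteq> V"
    and agree: "M \<inter> cut E D = N \<inter> cut E D"
    and S: "S \<in> contraction_nodes L l" "S \<subseteq> D" "M \<inter> cut E S \<noteq> N \<inter> cut E S"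
  obtains e S' where "M \<inter> cut E S = {e}" "e \<notin> N" "e \<subseteq> D" "S' \<in> contraction_nodes L l" "S' \<subseteq> D" "S' \<noteq> S"
    "M \<inter> cut E S' = {e}" "M \<inter> cut E S' \<noteq> N \<inter> cut E S'" "e \<subseteq> S \<union> S'"
    "{T \<in> contraction_nodes L l. e \<inter> T \<noteq> {}} = {S, S'}"
proof -
  note fin = simple_graph_finite[OF G]
  have tight: "T \<in> tight V E F" if "T \<in> contraction_nodes L l" for T
    using that L by (auto simp: contraction_nodes_def)
  obtain e where e: "M \<inter> cut E S = {e}" using tight_matching[OF G tight[OF S(1)] M] by blast
  obtain f where f: "N \<inter> cut E S = {f}" using tight_matching[OF G tight[OF S(1)] N] by blast
  have eS: "e \<in> cut E S" "e \<in> M" using e by blast+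
  have eN: "e \<notin> N"
  proof
    assume "e \<in> N"
    then have "e \<in> N \<inter> cut E S" using eS by simp
    then have "e = f" unfolding f by simp
    then show False using e f S(3) by simp
  qed
  have eE: "e \<in> E" using eS cut_subset by blast
  obtain a b where ab: "e = {a, b}" "a \<noteq> b" "a \<in> S" "b \<notin> S" "b \<in> V" using cut_edge[OF G eS(1)] by metis
  have "e \<notin> cut E D" using eN eS agree by blast
  then have bD: "b \<in> D" using ab S(2) eE by (auto simp: pair_mem_cut)
  obtain S' where S': "S' \<in> contraction_nodes L l" "b \<in> S'"
    using contraction_node_of_vertex[OF fin(1) L(1) ab(5) l] by blast
  have SD: "S' \<subseteq> D" using D[OF S'(1)] S' bD by blast
  have ne: "S' \<noteq> S" using S' ab by blast
  have "a \<notin> S'" using contraction_node_unique[OF L(1) S(1) S'(1) ab(3)] ne by blast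
  then have "e \<in> cut E S'" using ab S' eE by (simp add: pair_mem_cut)
  moreover obtain g where "M \<inter> cut E S' = {g}" using tight_matching[OF G tight[OF S'(1)] M] by blast
  ultimately have MS': "M \<inter> cut E S' = {e}" using eS by blast
  have "e \<subseteq> D" using ab S(2) bD by blast
  moreover have "{T \<in> contraction_nodes L l. e \<inter> T \<noteq> {}} = {S, S'}"
    using contraction_ends[OF L(1) S(1) S'(1) ab(3) S'(2)] ab by simp
  moreover have "M \<inter> cut E S' \<noteq> N \<inter> cut E S'" using MS' eN by auto
  moreover have "e \<subseteq> S \<union> S'" using ab S' by blast
  ultimately show ?thesis using that[OF e eN _ S'(1) SD ne MS'] by simp
qed

text \<open>Suppose \<open>M\<close> and \<open>N\<close> agree at the ends but differ inside.
  Following their edges alternately from a node where they differ closes up to a circuit. Its nodes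
  are disjoint subsets of \<open>C\<close>, so it weighs at most \<open>2 * l\<close>, and its lift
  is the difference of \<open>M\<close> and \<open>N\<close> on the union \<open>U\<close> of its
  nodes. No edge of \<open>M\<close> or \<open>N\<close> leaves \<open>U\<close>, so by minimality
  swapping inside \<open>U\<close> costs nothing, although the lift has nonzero weight.\<close>

lemma base_interval_contractible:
  assumes G: "simple_graph V E" and F: "is_face V E F" and L: "laminar V L" "L \<subseteq> tight V E F" and l: "1 \<le> l"
    and con: "\<And>N. N \<in> contraction_nodes L l \<Longrightarrow> contractible V E F N"
    and iso: "\<And>\<chi>. \<chi> \<in> circuit_vecs (contraction E F L l) (2 * l) \<Longrightarrow> (\<Sum>e\<in>E. w e * lift V E F L l \<chi> e) \<noteq> 0"
    and C: "C \<in> L" "card C \<le> 2 * l" "l < card C" and A: "A = {} \<or> A \<in> L \<and> l < card A" "A \<subset> C"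
    and between: "\<And>B. B \<in> L \<Longrightarrow> l < card B \<Longrightarrow> A \<subset> B \<Longrightarrow> B \<subseteq> C \<Longrightarrow> B = C"
  shows "interval_contractible V E (Min_face E F w) A C"
  unfolding interval_contractible_def
proof (intro allI impI, rule ccontr)
  fix M N
  let ?F = "Min_face E F w" and ?H = "contraction E F L l" and ?D = "C - A" and ?nodes = "contraction_nodes L l"
  assume M: "matching_in_face V E ?F M" and N: "matching_in_face V E ?F N"
    and agA: "M \<inter> cut E A = N \<inter> cut E A" and agC: "M \<inter> cut E C = N \<inter> cut E C"
    and diff: "M \<inter> edges_inside E ?D \<noteq> N \<inter> edges_inside E ?D"
  note fin = simple_graph_finite[OF G]
  have MF: "matching_in_face V E F M" and NF: "matching_in_face V E F N"
    using M N matching_in_face_mono[OF Min_face_subset] by blast+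
  have ME: "M \<subseteq> E" "N \<subseteq> E" using MF NF by (auto simp: matching_in_face_def perfect_matching_def)
  have CV: "C \<subseteq> V" using C L by (auto simp: laminar_def)
  have finC: "finite C" using CV fin finite_subset by blast
  have finS: "finite S" if "S \<in> L" for S using that L(1) fin(1) by (meson PowD finite_subset laminar_def subsetD)
  have nodeL: "S \<in> L" "card S \<le> l" if "S \<in> ?nodes" for S using that by (auto simp: contraction_nodes_def)
  \<comment> \<open>Nodes have size at most \<open>l\<close> and cannot contain \<open>A\<close> or
    \<open>C\<close>; by laminarity the interval splits no node.\<close>
  have D: "S \<subseteq> ?D" if S: "S \<in> ?nodes" "S \<inter> ?D \<noteq> {}" for S
  proof -
    obtain v where v: "v \<in> S" "v \<in> C" "v \<notin> A" using S by blast
    have "\<not> C \<subseteq> S" using card_mono[OF finS[OF nodeL(1)[OF S(1)]], of C] nodeL(2)[OF S(1)] C by linarith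
    then have SC: "S \<subseteq> C" using laminar_comparable[OF L(1) nodeL(1)[OF S(1)] C(1) v(1,2)] by blast
    have "S \<inter> A = {}"
    proof (rule ccontr)
      assume "S \<inter> A \<noteq> {}"
      then obtain u where u: "u \<in> S" "u \<in> A" by blast
      then have AL: "A \<in> L" "l < card A" using A by auto
      have "\<not> A \<subseteq> S" using card_mono[OF finS[OF nodeL(1)[OF S(1)]], of A] nodeL(2)[OF S(1)] AL by linarith
      then have "S \<subseteq> A" using laminar_comparable[OF L(1) nodeL(1)[OF S(1)] AL(1) u] by blast
      then show False using v by blast
    qed
    then show ?thesis using SC by blast
  qed
  have DV: "?D \<subseteq> V" using CV by blast
  have agD: "M \<inter> cut E ?D = N \<inter> cut E ?D" by (rule matchings_agree_cut_Diff[OF G agA agC])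
  define Act where "Act = {S \<in> ?nodes. S \<subseteq> ?D \<and> M \<inter> cut E S \<noteq> N \<inter> cut E S}"
  have finAct: "finite Act"
  proof (rule finite_subset)
    show "Act \<subseteq> Pow V" using DV by (auto simp: Act_def)
  qed (use fin in simp)
  \<comment> \<open>Contractible nodes entered by the same edge look alike inside, so a difference
    must show at the cut of some node.\<close>
  have "Act \<noteq> {}"
  proof
    assume none: "Act = {}"
    have "f \<in> M \<longleftrightarrow> f \<in> N" if f: "f \<in> edges_inside E ?D" for f
    proof -
      have fE: "f \<in> E" "f \<subseteq> ?D" using f by (auto simp: edges_inside_def)
      obtain a b where ab: "f = {a, b}" "a \<noteq> b" "a \<in> V" using simple_graph_edge[OF G fE(1)] by metis
      obtain S where S: "S \<in> ?nodes" "a \<in> S" using contraction_node_of_vertex[OF fin(1) L(1) ab(3) l] by blast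
      have SD: "S \<subseteq> ?D" using D[OF S(1)] S ab fE by blast
      have eq: "M \<inter> cut E S = N \<inter> cut E S" using none S SD by (auto simp: Act_def)
      have "f \<in> cut E S \<or> f \<in> edges_inside E S" using edge_meets[OF G fE(1), of a S] ab S by blast
      then show ?thesis
      proof
        assume "f \<in> edges_inside E S"
        moreover obtain e where e: "M \<inter> cut E S = {e}"
          using tight_matching[OF G _ MF, of S] nodeL[OF S(1)] L by blast
        then have e': "e \<in> cut E S" "e \<in> M" "e \<in> N" using eq by blast+
        have "M \<inter> edges_inside E S = N \<inter> edges_inside E S"
          by (rule contractible_unique[OF con[OF S(1)] e'(1) MF NF e'(2,3)])
        ultimately show ?thesis by blast
      qed (use eq in blast)
    qed
    then show False using diff by blast
  qed
  then obtain S0 where S0: "S0 \<in> Act" by blast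
  define e1 where "e1 S = the_elem (M \<inter> cut E S)" for S
  define e2 where "e2 S = the_elem (N \<inter> cut E S)" for S
  have ex1: "\<exists>S'. M \<inter> cut E S = {e1 S} \<and> e1 S \<notin> N \<and> e1 S \<subseteq> ?D \<and> S' \<in> Act \<and> S' \<noteq> S \<and> M \<inter> cut E S' = {e1 S}
    \<and> e1 S \<subseteq> S \<union> S' \<and> {T \<in> ?nodes. e1 S \<inter> T \<noteq> {}} = {S, S'}" if S: "S \<in> Act" for S
  proof -
    have S': "S \<in> ?nodes" "S \<subseteq> ?D" "M \<inter> cut E S \<noteq> N \<inter> cut E S" using S by (auto simp: Act_def)
    obtain e S' where *: "M \<inter> cut E S = {e}" "e \<notin> N" "e \<subseteq> ?D" "S' \<in> ?nodes" "S' \<subseteq> ?D" "S' \<noteq> S"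
      "M \<inter> cut E S' = {e}" "M \<inter> cut E S' \<noteq> N \<inter> cut E S'" "e \<subseteq> S \<union> S'" "{T \<in> ?nodes. e \<inter> T \<noteq> {}} = {S, S'}"
      by (rule cut_matching_edge[OF G L l MF NF D DV agD S'])
    have "e1 S = e" using *(1) by (simp add: e1_def)
    then show ?thesis using * by (intro exI[of _ S']) (auto simp: Act_def)
  qed
  have ex2: "\<exists>S'. N \<inter> cut E S = {e2 S} \<and> e2 S \<notin> M \<and> e2 S \<subseteq> ?D \<and> S' \<in> Act \<and> S' \<noteq> S \<and> N \<inter> cut E S' = {e2 S}
    \<and> e2 S \<subseteq> S \<union> S' \<and> {T \<in> ?nodes. e2 S \<inter> T \<noteq> {}} = {S, S'}" if S: "S \<in> Act" for S
  proof -
    have S': "S \<in> ?nodes" "S \<subseteq> ?D" "N \<inter> cut E S \<noteq> M \<inter> cut E S" using S by (auto simp: Act_def)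
    obtain e S' where *: "N \<inter> cut E S = {e}" "e \<notin> M" "e \<subseteq> ?D" "S' \<in> ?nodes" "S' \<subseteq> ?D" "S' \<noteq> S"
      "N \<inter> cut E S' = {e}" "N \<inter> cut E S' \<noteq> M \<inter> cut E S'" "e \<subseteq> S \<union> S'" "{T \<in> ?nodes. e \<inter> T \<noteq> {}} = {S, S'}"
      by (rule cut_matching_edge[OF G L l NF MF D DV agD[symmetric] S'])
    have "e2 S = e" using *(1) by (simp add: e2_def)
    then show ?thesis using * by (intro exI[of _ S']) (auto simp: Act_def)
  qed
  \<comment> \<open>\<open>s1\<close> and \<open>s2\<close> lead to the node at the other end of the
    \<open>M\<close>-edge and of the \<open>N\<close>-edge.\<close>
  from bchoice[OF ballI[OF ex1]] obtain s1 where s1': "\<forall>S\<in>Act. M \<inter> cut E S = {e1 S} \<and> e1 S \<notin> N \<and> e1 S \<subseteq> ?D \<and> s1 S \<in> Act \<and> s1 S \<noteq> S \<and>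
    M \<inter> cut E (s1 S) = {e1 S} \<and> e1 S \<subseteq> S \<union> s1 S \<and> {T \<in> ?nodes. e1 S \<inter> T \<noteq> {}} = {S, s1 S}" ..
  have s1: "M \<inter> cut E S = {e1 S}" "e1 S \<notin> N" "e1 S \<subseteq> ?D" "s1 S \<in> Act" "s1 S \<noteq> S" "M \<inter> cut E (s1 S) = {e1 S}"
    "e1 S \<subseteq> S \<union> s1 S" "{T \<in> ?nodes. e1 S \<inter> T \<noteq> {}} = {S, s1 S}" if "S \<in> Act" for S
    using bspec[OF s1' that] by simp_all
  from bchoice[OF ballI[OF ex2]] obtain s2 where s2': "\<forall>S\<in>Act. N \<inter> cut E S = {e2 S} \<and> e2 S \<notin> M \<and> e2 S \<subseteq> ?D \<and> s2 S \<in> Act \<and> s2 S \<noteq> S \<and>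
    N \<inter> cut E (s2 S) = {e2 S} \<and> e2 S \<subseteq> S \<union> s2 S \<and> {T \<in> ?nodes. e2 S \<inter> T \<noteq> {}} = {S, s2 S}" ..
  have s2: "N \<inter> cut E S = {e2 S}" "e2 S \<notin> M" "e2 S \<subseteq> ?D" "s2 S \<in> Act" "s2 S \<noteq> S" "N \<inter> cut E (s2 S) = {e2 S}"
    "e2 S \<subseteq> S \<union> s2 S" "{T \<in> ?nodes. e2 S \<inter> T \<noteq> {}} = {S, s2 S}" if "S \<in> Act" for S
    using bspec[OF s2' that] by simp_all
  have e1s: "e1 (s1 S) = e1 S" if "S \<in> Act" for S using s1(6)[OF that] by (simp add: e1_def)
  have e2s: "e2 (s2 S) = e2 S" if "S \<in> Act" for S using s2(6)[OF that] by (simp add: e2_def)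
  have inv1: "s1 (s1 S) = S" if "S \<in> Act" for S
  proof -
    have "{S, s1 S} = {s1 S, s1 (s1 S)}" using s1(8)[OF that] s1(8)[OF s1(4)[OF that]] e1s[OF that] by simp
    then show ?thesis using s1(5)[OF that] by (auto simp: doubleton_eq_iff)
  qed
  have inv2: "s2 (s2 S) = S" if "S \<in> Act" for S
  proof -
    have "{S, s2 S} = {s2 S, s2 (s2 S)}" using s2(8)[OF that] s2(8)[OF s2(4)[OF that]] e2s[OF that] by simp
    then show ?thesis using s2(5)[OF that] by (auto simp: doubleton_eq_iff)
  qed
  have i1: "s1 S \<in> Act \<and> s1 S \<noteq> S \<and> s1 (s1 S) = S" if "S \<in> Act" for S using s1(4,5)[OF that] inv1[OF that] by simp
  have i2: "s2 S \<in> Act \<and> s2 S \<noteq> S \<and> s2 (s2 S) = S" if "S \<in> Act" for S using s2(4,5)[OF that] inv2[OF that] by simp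
  obtain u :: "nat \<Rightarrow> 'a set" and m where u: "0 < m" "even m" "u m = u 0" "inj_on u {..<m}" "\<And>k. u k \<in> Act"
    "\<And>k. u (Suc k) = (if even k then s1 (u k) else s2 (u k))"
    "\<And>v. v \<in> u ` {..<m} \<Longrightarrow> s1 v \<in> u ` {..<m} \<and> s2 v \<in> u ` {..<m}"
    by (rule alternating_orbit[OF finAct i1 i2 S0]) (assumption | rule that)+
  define K where "K = u ` {..<m}"
  define U where "U = \<Union>K"
  have KAct: "S \<in> Act" if "S \<in> K" for S using that u(5) by (auto simp: K_def)
  have Knode: "S \<in> ?nodes" "S \<subseteq> ?D" if "S \<in> K" for S using KAct[OF that] by (auto simp: Act_def)
  have K1: "s1 S \<in> K" and K2: "s2 S \<in> K" if "S \<in> K" for S using u(7) that by (auto simp: K_def)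
  define c where "c k = (if even k then e1 (u k) else e2 (u k))" for k
  \<comment> \<open>An edge inside the interval crosses no set \<open>T\<close> larger than
    \<open>l\<close>. By laminarity such a \<open>T\<close> would lie strictly between
    \<open>A\<close> and \<open>C\<close>, or be disjoint from \<open>A\<close>, and then
    \<open>T \<union> A\<close> would have more than \<open>2 * l\<close> elements inside
    \<open>C\<close>.\<close>
  have edgeH: "e \<in> edges ?H" if S: "S \<in> ?nodes" and e: "e \<in> cut E S" "e \<subseteq> ?D" "e \<in> supp E F" for e S
  proof -
    have "e \<notin> cut E T" if T: "T \<in> L" "card T > l" for T
    proof
      assume eT: "e \<in> cut E T"
      obtain a b where ab: "e = {a, b}" "a \<in> T" "b \<notin> T" using cut_edge[OF G eT] by metis
      have aD: "a \<in> C" "a \<notin> A" "b \<in> C" using e(2) ab by auto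
      have TC: "T \<subseteq> C" using laminar_comparable[OF L(1) T(1) C(1) ab(2) aD(1)] ab aD by blast
      have "\<not> A \<subset> T" using between[OF T(1,2) _ TC] ab aD by blast
      then have nA: "\<not> A \<subseteq> T" using ab aD by blast
      then have AL: "A \<in> L" "l < card A" using A(1) by auto
      show False
      proof (cases "T \<inter> A = {}")
        case True
        have "card (T \<union> A) = card T + card A" using True finS[OF T(1)] finS[OF AL(1)] by (rule card_Un_disjoint[rotated 2])
        moreover have "card (T \<union> A) \<le> card C" using TC A(2) finC by (intro card_mono) auto
        ultimately show False using T AL C by linarith
      next
        case False
        then obtain v where v: "v \<in> T" "v \<in> A" by blast
        show False using laminar_comparable[OF L(1) T(1) AL(1) v] nA ab aD by blast
      qed
    qed
    then show ?thesis using e(3) cut_not_inside_node[OF G L(1) S e(1)] by (auto simp: contraction_def)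
  qed
  have supM: "e \<in> supp E F" if "e \<in> M" for e using supp_iff_matching[OF G F] MF that by blast
  have supN: "e \<in> supp E F" if "e \<in> N" for e using supp_iff_matching[OF G F] NF that by blast
  have e1M: "e1 S \<in> M" "e1 S \<in> cut E S" if "S \<in> Act" for S using s1(1)[OF that] by blast+
  have e2N: "e2 S \<in> N" "e2 S \<in> cut E S" if "S \<in> Act" for S using s2(1)[OF that] by blast+
  have actn: "S \<in> ?nodes" if "S \<in> Act" for S using that by (simp add: Act_def)
  have cw: "cyclic_walk ?H (map u [0..<m]) (map c [0..<m])"
  proof (rule cyclic_walk_map[OF u(3)])
    fix t
    have S: "u t \<in> Act" by (rule u(5))
    have "u t \<in> nodes ?H" using actn[OF S] by (simp add: contraction_def)
    moreover have "c t \<in> edges ?H"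
      using edgeH[OF actn[OF S] e1M(2)[OF S] s1(3)[OF S] supM[OF e1M(1)[OF S]]]
        edgeH[OF actn[OF S] e2N(2)[OF S] s2(3)[OF S] supN[OF e2N(1)[OF S]]] by (simp add: c_def)
    moreover have "ends ?H (c t) = {u t, u (Suc t)}"
      using s1(8)[OF S] s2(8)[OF S] u(6)[of t] by (simp add: c_def contraction_def)
    ultimately show "u t \<in> nodes ?H \<and> c t \<in> edges ?H \<and> ends ?H (c t) = {u t, u (Suc t)}" by blast
  qed
  have wt: "walk_weight ?H (map u [0..<m]) \<le> 2 * l"
  proof -
    have "(\<Sum>t<m. card (u t)) = card (\<Union>t\<in>{..<m}. u t)"
    proof (rule card_UN_disjoint[symmetric])
      show "\<forall>t\<in>{..<m}. finite (u t)" using finS nodeL(1) actn u(5) by blast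
      show "\<forall>i\<in>{..<m}. \<forall>j\<in>{..<m}. i \<noteq> j \<longrightarrow> u i \<inter> u j = {}"
      proof (intro ballI impI)
        fix i j assume ij: "i \<in> {..<m}" "j \<in> {..<m}" "i \<noteq> j"
        then have "u i \<noteq> u j" using u(4) by (auto dest: inj_onD)
        then show "u i \<inter> u j = {}" using contraction_node_unique[OF L(1) actn[OF u(5)] actn[OF u(5)], of _ i j] by blast
      qed
    qed simp
    also have "\<dots> \<le> card C"
    proof (rule card_mono[OF finC])
      show "(\<Union>t\<in>{..<m}. u t) \<subseteq> C" using u(5) by (auto simp: Act_def)
    qed
    finally show ?thesis using C(2) unfolding walk_weight_map by (simp add: contraction_def)
  qed
  define \<chi> where "\<chi> = alt_vec (map c [0..<m])"
  have \<chi>: "\<chi> f = indicator (e1 ` K) f - indicator (e2 ` K) f" for f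
  proof -
    have "\<chi> f = (\<Sum>t<m. (if even t then indicator {e1 (u t)} f else 0) - (if even t = False then indicator {e2 (u t)} f else 0))"
      unfolding \<chi>_def alt_vec_map by (rule sum.cong) (auto simp: c_def)
    also have "\<dots> = (\<Sum>t<m. if even t = True then indicator {e1 (u t)} f else 0) - (\<Sum>t<m. if even t = False then indicator {e2 (u t)} f else 0)"
      by (simp add: sum_subtractf)
    also have "(\<Sum>t<m. if even t = True then indicator {e1 (u t)} f else 0 :: int) = indicator (e1 ` u ` {..<m}) f"
    proof (rule orbit_sum[OF u(1-4), of _ s1])
      show "s1 (u k) = u (Suc k)" if "even k = True" for k using u(6)[of k] that by simp
      show "e1 (s1 (u k)) = e1 (u k)" for k by (rule e1s[OF u(5)])
      show "u j = u k \<or> u j = s1 (u k)" if "e1 (u k) = e1 (u j)" for k j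
        using s1(8)[OF u(5)[of k]] s1(8)[OF u(5)[of j]] that by (auto simp: doubleton_eq_iff)
    qed
    also have "(\<Sum>t<m. if even t = False then indicator {e2 (u t)} f else 0 :: int) = indicator (e2 ` u ` {..<m}) f"
    proof (rule orbit_sum[OF u(1-4), of _ s2])
      show "s2 (u k) = u (Suc k)" if "even k = False" for k using u(6)[of k] that by simp
      show "e2 (s2 (u k)) = e2 (u k)" for k by (rule e2s[OF u(5)])
      show "u j = u k \<or> u j = s2 (u k)" if "e2 (u k) = e2 (u j)" for k j
        using s2(8)[OF u(5)[of k]] s2(8)[OF u(5)[of j]] that by (auto simp: doubleton_eq_iff)
    qed
    finally show ?thesis by (simp add: K_def)
  qed
  have "\<chi> \<in> circuit_vecs ?H (2 * l)"
  proof -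
    have u0: "u 0 \<in> K" using u(1) by (auto simp: K_def)
    have "e1 (u 0) \<notin> e2 ` K"
    proof
      assume "e1 (u 0) \<in> e2 ` K"
      then obtain S where S: "S \<in> K" "e1 (u 0) = e2 S" by blast
      then show False using s1(2)[OF u(5), of 0] e2N(1)[OF KAct[OF S(1)]] by simp
    qed
    then have "\<chi> (e1 (u 0)) = 1" using u0 by (simp add: \<chi>)
    then have "\<chi> \<noteq> (\<lambda>e. 0)" by auto
    then have "alternating_circuit ?H (map u [0..<m]) (map c [0..<m])"
      using cw u(2) unfolding alternating_circuit_def \<chi>_def by simp
    then show ?thesis using wt unfolding circuit_vecs_def \<chi>_def by blast
  qed
  from iso[OF this] have nz: "(\<Sum>e\<in>E. w e * lift V E F L l \<chi> e) \<noteq> 0" .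
  have inK: "S \<in> K" if S: "S \<in> ?nodes" "a \<in> S" and aU: "a \<in> U" for S a
  proof -
    obtain T where "T \<in> K" "a \<in> T" using aU by (auto simp: U_def)
    then show ?thesis using contraction_node_unique[OF L(1) S(1) Knode(1)[of T] S(2)] by simp
  qed
  have e1U: "e1 S \<subseteq> U" if S: "S \<in> K" for S using s1(7)[OF KAct[OF S]] K1[OF S] S by (auto simp: U_def)
  have e2U: "e2 S \<subseteq> U" if S: "S \<in> K" for S using s2(7)[OF KAct[OF S]] K2[OF S] S by (auto simp: U_def)
  \<comment> \<open>Inside a node of the circuit the lift follows \<open>M\<close> with sign plus
    and \<open>N\<close> with sign minus; inside any other node it vanishes, because no edge of the
    circuit meets that node.\<close>
  have lift: "lift V E F L l \<chi> f = indicator (M \<inter> edges_inside E U) f - indicator (N \<inter> edges_inside E U) f" if f: "f \<in> E" for f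
  proof -
    obtain a b where ab: "f = {a, b}" "a \<noteq> b" using simple_graph_edge[OF G f] by metis
    show ?thesis
    proof (cases "\<exists>S\<in>?nodes. f \<subseteq> S")
      case True
      then obtain S where S: "S \<in> ?nodes" "f \<subseteq> S" by blast
      note li = lift_inside[OF G L(1) S(1) f S(2), of F \<chi>]
      show ?thesis
      proof (cases "S \<in> K")
        case SK: True
        have SA: "S \<in> Act" using KAct[OF SK] .
        have E1: "e \<in> e1 ` K \<longleftrightarrow> e = e1 S" if e: "e \<in> cut E S" for e
        proof
          assume "e \<in> e1 ` K"
          then have "e \<in> M \<inter> cut E S" using e1M(1)[OF KAct] e by auto
          then show "e = e1 S" using s1(1)[OF SA] by simp
        qed (use SK in blast)
        have E2: "e \<in> e2 ` K \<longleftrightarrow> e = e2 S" if e: "e \<in> cut E S" for e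
        proof
          assume "e \<in> e2 ` K"
          then have "e \<in> N \<inter> cut E S" using e2N(1)[OF KAct] e by auto
          then show "e = e2 S" using s2(1)[OF SA] by simp
        qed (use SK in blast)
        have "lift V E F L l \<chi> f = (\<Sum>e\<in>cut E S. (if e = e1 S then indicator (face_matching V E F e) f else 0) - (if e = e2 S then indicator (face_matching V E F e) f else 0))"
          unfolding li \<chi> by (rule sum.cong) (auto simp: indicator_def E1 E2)
        also have "\<dots> = indicator (face_matching V E F (e1 S)) f - indicator (face_matching V E F (e2 S)) f"
          using e1M(2)[OF SA] e2N(2)[OF SA] fin by (simp add: sum_subtractf)
        also have "f \<in> face_matching V E F (e1 S) \<longleftrightarrow> f \<in> M"
        proof -
          note fm = face_matching[OF G F supM[OF e1M(1)[OF SA]]]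
          have "face_matching V E F (e1 S) \<inter> edges_inside E S = M \<inter> edges_inside E S"
            by (rule contractible_unique[OF con[OF S(1)] e1M(2)[OF SA] fm(1) MF fm(2) e1M(1)[OF SA]])
          then show ?thesis using f S(2) by (auto simp: edges_inside_def)
        qed
        then have "indicator (face_matching V E F (e1 S)) f = (indicator M f :: int)" by (simp add: indicator_def)
        also have "f \<in> face_matching V E F (e2 S) \<longleftrightarrow> f \<in> N"
        proof -
          note fm = face_matching[OF G F supN[OF e2N(1)[OF SA]]]
          have "face_matching V E F (e2 S) \<inter> edges_inside E S = N \<inter> edges_inside E S"
            by (rule contractible_unique[OF con[OF S(1)] e2N(2)[OF SA] fm(1) NF fm(2) e2N(1)[OF SA]])
          then show ?thesis using f S(2) by (auto simp: edges_inside_def)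
        qed
        then have "indicator (face_matching V E F (e2 S)) f = (indicator N f :: int)" by (simp add: indicator_def)
        finally have "lift V E F L l \<chi> f = indicator M f - indicator N f" .
        moreover have "f \<in> edges_inside E U" using f S(2) SK by (auto simp: edges_inside_def U_def)
        ultimately show ?thesis by (simp add: indicator_def)
      next
        case SK: False
        have "\<chi> e = 0" if e: "e \<in> cut E S" for e
        proof -
          have "e \<inter> S \<noteq> {}" using e by (auto simp: cut_def)
          then obtain v where v: "v \<in> e" "v \<in> S" by blast
          have "v \<notin> U" using inK[OF S(1) v(2)] SK by blast
          then have "\<not> e \<subseteq> U" using v by blast
          then have "e \<notin> e1 ` K" "e \<notin> e2 ` K" using e1U e2U by auto
          then show ?thesis by (simp add: \<chi>)
        qed
        then have "lift V E F L l \<chi> f = 0" unfolding li by simp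
        moreover have "f \<notin> edges_inside E U" using inK[OF S(1), of a] SK S(2) ab by (auto simp: edges_inside_def)
        ultimately show ?thesis by simp
      qed
    next
      case False
      have cutS: "f \<in> cut E S" if "S \<in> ?nodes" "a \<in> S" for S
        using edge_meets[OF G f, of a S] that False ab by (auto simp: edges_inside_def)
      have 1: "f \<in> e1 ` K \<longleftrightarrow> f \<in> M \<inter> edges_inside E U"
      proof
        assume "f \<in> e1 ` K"
        then show "f \<in> M \<inter> edges_inside E U" using e1M(1)[OF KAct] e1U f by (auto simp: edges_inside_def)
      next
        assume fM: "f \<in> M \<inter> edges_inside E U"
        then obtain S where S: "S \<in> K" "a \<in> S" using ab by (auto simp: edges_inside_def U_def)
        have "f \<in> M \<inter> cut E S" using fM cutS[OF Knode(1)[OF S(1)] S(2)] by blast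
        then have "f = e1 S" using s1(1)[OF KAct[OF S(1)]] by simp
        then show "f \<in> e1 ` K" using S(1) by blast
      qed
      have 2: "f \<in> e2 ` K \<longleftrightarrow> f \<in> N \<inter> edges_inside E U"
      proof
        assume "f \<in> e2 ` K"
        then show "f \<in> N \<inter> edges_inside E U" using e2N(1)[OF KAct] e2U f by (auto simp: edges_inside_def)
      next
        assume fN: "f \<in> N \<inter> edges_inside E U"
        then obtain S where S: "S \<in> K" "a \<in> S" using ab by (auto simp: edges_inside_def U_def)
        have "f \<in> N \<inter> cut E S" using fN cutS[OF Knode(1)[OF S(1)] S(2)] by blast
        then have "f = e2 S" using s2(1)[OF KAct[OF S(1)]] by simp
        then show "f \<in> e2 ` K" using S(1) by blast
      qed
      show ?thesis unfolding lift_outside[OF False] \<chi> using 1 2 by (simp add: indicator_def)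
    qed
  qed
  have noU: "f \<notin> cut E U" if f: "f \<in> M \<or> f \<in> N" for f
  proof
    assume fU: "f \<in> cut E U"
    have fE: "f \<in> E" using fU cut_subset by blast
    obtain a b where ab: "f = {a, b}" "a \<in> U" "b \<notin> U" using cut_edge[OF G fU] by metis
    obtain S where S: "S \<in> K" "a \<in> S" using ab(2) by (auto simp: U_def)
    have "\<not> f \<subseteq> S" using S(1) ab by (auto simp: U_def)
    then have fS: "f \<in> cut E S" using edge_meets[OF G fE, of a S] S ab by (auto simp: edges_inside_def)
    have "f = e1 S \<or> f = e2 S" using f fS s1(1)[OF KAct[OF S(1)]] s2(1)[OF KAct[OF S(1)]] by blast
    then show False using e1U[OF S(1)] e2U[OF S(1)] ab by blast
  qed
  then have agU: "M \<inter> cut E U = N \<inter> cut E U" by blast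
  have "(\<Sum>e\<in>E. w e * lift V E F L l \<chi> e) = 0"
    using Min_face_swap_vec[OF G F M N agU] by (simp add: lift)
  then show False using nz by blast
qed

section \<open>Doubling the length of contractible intervals\<close>

text \<open>An edge inside the large interval lies in one of the halves or crosses \<open>B\<close>,
  so agreement on the cut of \<open>B\<close> reduces the claim to the two halves.\<close>

lemma interval_contractible_join:
  assumes G: "simple_graph V E" and AB: "A \<subseteq> B" "B \<subseteq> C"
    and I1: "interval_contractible V E F A B" and I2: "interval_contractible V E F B C"
    and M: "matching_in_face V E F M" and N: "matching_in_face V E F N"
    and a: "M \<inter> cut E A = N \<inter> cut E A" and b: "M \<inter> cut E B = N \<inter> cut E B" and c: "M \<inter> cut E C = N \<inter> cut E C"
  shows "M \<inter> edges_inside E (C - A) = N \<inter> edges_inside E (C - A)"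
proof -
  have 1: "M \<inter> edges_inside E (B - A) = N \<inter> edges_inside E (B - A)"
    using I1 M N a b unfolding interval_contractible_def by blast
  have 2: "M \<inter> edges_inside E (C - B) = N \<inter> edges_inside E (C - B)"
    using I2 M N b c unfolding interval_contractible_def by blast
  have "f \<in> M \<longleftrightarrow> f \<in> N" if f: "f \<in> edges_inside E (C - A)" for f
  proof -
    have fE: "f \<in> E" "f \<subseteq> C - A" using f by (auto simp: edges_inside_def)
    obtain p q where pq: "f = {p, q}" "p \<noteq> q" using simple_graph_edge[OF G fE(1)] by metis
    have "f \<in> cut E B \<or> f \<in> edges_inside E (B - A) \<or> f \<in> edges_inside E (C - B)"
      using fE pq by (auto simp: pair_mem_cut edges_inside_def)
    then show ?thesis using 1 2 b by blast
  qed
  then show ?thesis by blast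
qed

text \<open>A nonempty member is determined by one of its elements and its size, since members
  sharing an element are comparable. The additional one accounts for the empty set.\<close>

lemma card_laminar_le:
  assumes fin: "finite V" and L: "laminar V L"
  shows "finite L" "card L \<le> card V ^ 2 + 1"
proof -
  show finL: "finite L" using L fin by (meson finite_Pow_iff finite_subset laminar_def)
  define \<phi> where "\<phi> S = (SOME v. v \<in> S, card S)" for S :: "'a set"
  have some: "(SOME v. v \<in> S) \<in> S" if "S \<noteq> {}" for S :: "'a set" using that some_in_eq by blast
  have sub: "S \<subseteq> V" if "S \<in> L" for S using that L by (auto simp: laminar_def)
  have "inj_on \<phi> (L - {{}})"
  proof (rule inj_onI)
    fix S T assume S: "S \<in> L - {{}}" and T: "T \<in> L - {{}}" and eq: "\<phi> S = \<phi> T"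
    have v: "(SOME v. v \<in> S) \<in> S" "(SOME v. v \<in> S) \<in> T" and c: "card S = card T"
      using S T eq some[of S] some[of T] by (auto simp: \<phi>_def)
    have "S \<subseteq> T \<or> T \<subseteq> S" using laminar_comparable[OF L _ _ v] S T by blast
    moreover have "finite S" "finite T" using sub S T fin finite_subset by blast+
    ultimately show "S = T" using c card_subset_eq by metis
  qed
  moreover have "\<phi> ` (L - {{}}) \<subseteq> V \<times> {1..card V}"
  proof (rule image_subsetI)
    fix S assume S: "S \<in> L - {{}}"
    have "finite S" using sub S fin finite_subset by blast
    then have "1 \<le> card S" using S by (simp add: Suc_le_eq card_gt_0_iff)
    moreover have "card S \<le> card V" using sub S fin card_mono by blast
    ultimately show "\<phi> S \<in> V \<times> {1..card V}" using some[of S] sub S by (auto simp: \<phi>_def)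
  qed
  ultimately have "card (L - {{}}) \<le> card (V \<times> {1..card V})" using fin by (intro card_inj_on_le) auto
  then have "card (L - {{}}) \<le> card V ^ 2" by (simp add: power2_eq_square card_cartesian_product)
  moreover have "card L \<le> card (insert {} (L - {{}}))" using finL by (intro card_mono) auto
  moreover have "card (insert {} (L - {{}})) = Suc (card (L - {{}}))" using finL by (intro card_insert_disjoint) auto
  ultimately show "card L \<le> card V ^ 2 + 1" by linarith
qed

text \<open>The difference of two matchings inside \<open>C - A\<close> is determined by seven data:
  the three sets, the common edges at the two ends, and the two edges in the middle. This leaves at
  most \<open>n ^ 17\<close> vectors, and a weight function that is nonzero on all of them
  contradicts swapping in the minimising face.\<close>

lemma double_interval_contractible:
  assumes G: "simple_graph V E" and n: "card V = n" "2304 \<le> n" and num: "bij_betw num E {1..card E}"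
    and F: "is_face V E F" and L: "laminar V L" "L \<subseteq> tight V E F"
  shows "\<exists>w\<in>weights n num. \<forall>A\<in>insert {} L. \<forall>B\<in>insert {} L. \<forall>C\<in>insert {} L. A \<subseteq> B \<longrightarrow> B \<subseteq> C \<longrightarrow>
    interval_contractible V E F A B \<longrightarrow> interval_contractible V E F B C \<longrightarrow>
    interval_contractible V E (Min_face E F w) A C"
proof -
  note fin = simple_graph_finite[OF G]
  let ?L = "insert {} L"
  \<comment> \<open>The possible traces of a matching on a tight cut; the empty trace belongs to the
    empty set.\<close>
  let ?X = "insert {} ((\<lambda>e. {e}) ` E)"
  define R where "R y \<tau> \<longleftrightarrow> (case \<tau> of (A, B, C, a, c, b1, b2) \<Rightarrow> A \<subseteq> B \<and> B \<subseteq> C \<and>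
      interval_contractible V E F A B \<and> interval_contractible V E F B C \<and>
      (\<exists>M N. matching_in_face V E F M \<and> matching_in_face V E F N \<and>
        M \<inter> cut E A = a \<and> N \<inter> cut E A = a \<and> M \<inter> cut E C = c \<and> N \<inter> cut E C = c \<and>
        M \<inter> cut E B = b1 \<and> N \<inter> cut E B = b2 \<and> M \<inter> edges_inside E (C - A) \<noteq> N \<inter> edges_inside E (C - A) \<and>
        y = (\<lambda>e. indicator (M \<inter> edges_inside E (C - A)) e - indicator (N \<inter> edges_inside E (C - A)) e)))"
    for y :: "'a set \<Rightarrow> int" and \<tau>
  define T where "T = ?L \<times> ?L \<times> ?L \<times> ?X \<times> ?X \<times> ?X \<times> ?X"
  define Y where "Y = {y. \<exists>\<tau>\<in>T. R y \<tau>}"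
  have uniq: "y = y'" if R1: "R y \<tau>" and R2: "R y' \<tau>" for y y' \<tau>
  proof -
    obtain A B C a c b1 b2 where \<tau>: "\<tau> = (A, B, C, a, c, b1, b2)" by (metis prod_cases7)
    have sub: "A \<subseteq> B" "B \<subseteq> C" and ic: "interval_contractible V E F A B" "interval_contractible V E F B C"
      using R1 by (auto simp: R_def \<tau>)
    obtain M N where 1: "matching_in_face V E F M" "matching_in_face V E F N"
      "M \<inter> cut E A = a" "N \<inter> cut E A = a" "M \<inter> cut E C = c" "N \<inter> cut E C = c" "M \<inter> cut E B = b1" "N \<inter> cut E B = b2"
      "y = (\<lambda>e. indicator (M \<inter> edges_inside E (C - A)) e - indicator (N \<inter> edges_inside E (C - A)) e)"
      using R1 by (auto simp: R_def \<tau>)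
    obtain M' N' where 2: "matching_in_face V E F M'" "matching_in_face V E F N'"
      "M' \<inter> cut E A = a" "N' \<inter> cut E A = a" "M' \<inter> cut E C = c" "N' \<inter> cut E C = c" "M' \<inter> cut E B = b1" "N' \<inter> cut E B = b2"
      "y' = (\<lambda>e. indicator (M' \<inter> edges_inside E (C - A)) e - indicator (N' \<inter> edges_inside E (C - A)) e)"
      using R2 by (auto simp: R_def \<tau>)
    have "M \<inter> edges_inside E (C - A) = M' \<inter> edges_inside E (C - A)"
      by (rule interval_contractible_join[OF G sub ic 1(1) 2(1)]) (use 1 2 in simp_all)
    moreover have "N \<inter> edges_inside E (C - A) = N' \<inter> edges_inside E (C - A)"
      by (rule interval_contractible_join[OF G sub ic 1(2) 2(2)]) (use 1 2 in simp_all)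
    ultimately show ?thesis using 1(9) 2(9) by simp
  qed
  have finT: "finite T" unfolding T_def using fin card_laminar_le(1)[OF fin(1) L(1)] by simp
  have cardL: "card ?L \<le> n ^ 3"
  proof -
    have "card ?L \<le> card L + 1" using card_laminar_le(1)[OF fin(1) L(1)] by (simp add: card_insert_if)
    also have "\<dots> \<le> n ^ 2 + 2" using card_laminar_le(2)[OF fin(1) L(1)] n by simp
    also have "\<dots> \<le> n ^ 2 + n ^ 2" using mult_le_mono[of 2 n 1 n] n by (simp add: power2_eq_square)
    also have "\<dots> = 2 * n ^ 2" by simp
    also have "\<dots> \<le> n * n ^ 2" using n by (intro mult_right_mono) auto
    finally show ?thesis by (simp add: power3_eq_cube power2_eq_square)
  qed
  have cardX: "card ?X \<le> n ^ 2"
  proof -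
    have "card ?X \<le> card ((\<lambda>e. {e}) ` E) + 1" using fin by (simp add: card_insert_if)
    also have "\<dots> \<le> card E + 1" using card_image_le[OF fin(2)] by simp
    also have "\<dots> \<le> n ^ 2"
    proof -
      have "2 * card E \<le> n ^ 2" using simple_graph_card_edges[OF G] n by simp
      moreover have "2 * 1 \<le> n * n" using n by (intro mult_mono) auto
      ultimately show ?thesis by (simp add: power2_eq_square)
    qed
    finally show ?thesis .
  qed
  have "card T = card ?L ^ 3 * card ?X ^ 4"
    unfolding T_def by (simp only: card_cartesian_product power3_eq_cube power4_eq_xxxx mult.assoc)
  also have "\<dots> \<le> (n ^ 3) ^ 3 * (n ^ 2) ^ 4" using cardL cardX by (intro mult_mono power_mono) auto
  also have "\<dots> = n ^ 17" by (simp flip: power_mult power_add)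
  finally have cardT: "card T \<le> n ^ 17" .
  define \<sigma> where "\<sigma> y = (SOME \<tau>. \<tau> \<in> T \<and> R y \<tau>)" for y
  have \<sigma>: "\<sigma> y \<in> T \<and> R y (\<sigma> y)" if "y \<in> Y" for y
  proof -
    have "\<exists>\<tau>. \<tau> \<in> T \<and> R y \<tau>" using that unfolding Y_def by blast
    from someI_ex[OF this] show ?thesis unfolding \<sigma>_def .
  qed
  have inj: "inj_on \<sigma> Y"
  proof (rule inj_onI)
    fix y y' assume "y \<in> Y" "y' \<in> Y" "\<sigma> y = \<sigma> y'"
    then show "y = y'" using uniq[of y "\<sigma> y" y'] \<sigma>[of y] \<sigma>[of y'] by simp
  qed
  have im: "\<sigma> ` Y \<subseteq> T" using \<sigma> by blast
  have finY: "finite Y" using inj im finT by (meson finite_imageD finite_subset)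
  have cardY: "card Y \<le> n ^ 17" using card_inj_on_le[OF inj im finT] cardT by simp
  have props: "(\<exists>e\<in>E. y e \<noteq> 0) \<and> (\<forall>e. \<bar>y e\<bar> \<le> 4 * int n ^ 2)" if y: "y \<in> Y" for y
  proof -
    obtain A C M N where *: "M \<inter> edges_inside E (C - A) \<noteq> N \<inter> edges_inside E (C - A)"
      "y = (\<lambda>e. indicator (M \<inter> edges_inside E (C - A)) e - indicator (N \<inter> edges_inside E (C - A)) e)"
    proof -
      obtain \<tau> where \<tau>: "R y \<tau>" using y unfolding Y_def by blast
      obtain A B C a c b1 b2 where "\<tau> = (A, B, C, a, c, b1, b2)" by (metis prod_cases7)
      then show ?thesis using \<tau> that[of _ C A] unfolding R_def by auto
    qed
    obtain f where f: "(f \<in> M) \<noteq> (f \<in> N)" "f \<in> edges_inside E (C - A)" using *(1) by blast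
    then have "f \<in> E" "y f \<noteq> 0" unfolding *(2) by (auto simp: edges_inside_def indicator_def)
    moreover have "\<bar>y e\<bar> \<le> 4 * int n ^ 2" for e
    proof -
      have "\<bar>y e\<bar> \<le> 1" unfolding *(2) by (auto simp: indicator_def)
      moreover have "1 \<le> int n ^ 2" using n by simp
      ultimately show ?thesis by linarith
    qed
    ultimately show ?thesis by blast
  qed
  have cE: "card E \<le> n ^ 2" using simple_graph_card_edges[OF G] n by simp
  have "\<exists>w\<in>weights n num. \<forall>y\<in>Y. (\<Sum>e\<in>E. w e * y e) \<noteq> 0"
    by (rule exists_isolating_weight[OF _ fin(2) cE num finY cardY]) (use n props in auto)
  then obtain w where w: "w \<in> weights n num" and iso: "\<And>y. y \<in> Y \<Longrightarrow> (\<Sum>e\<in>E. w e * y e) \<noteq> 0" by blast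
  have "interval_contractible V E (Min_face E F w) A C"
    if A: "A \<in> ?L" and B: "B \<in> ?L" and C: "C \<in> ?L" and sub: "A \<subseteq> B" "B \<subseteq> C"
      and ic: "interval_contractible V E F A B" "interval_contractible V E F B C" for A B C
    unfolding interval_contractible_def
  proof (intro allI impI, rule ccontr)
    fix M N
    let ?F = "Min_face E F w" and ?D = "C - A"
    assume M: "matching_in_face V E ?F M" and N: "matching_in_face V E ?F N"
      and agA: "M \<inter> cut E A = N \<inter> cut E A" and agC: "M \<inter> cut E C = N \<inter> cut E C"
      and diff: "M \<inter> edges_inside E ?D \<noteq> N \<inter> edges_inside E ?D"
    have MF: "matching_in_face V E F M" and NF: "matching_in_face V E F N"
      using M N matching_in_face_mono[OF Min_face_subset] by blast+
    have ME: "M \<subseteq> E" "N \<subseteq> E" using MF NF by (auto simp: matching_in_face_def perfect_matching_def)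
    have X: "K \<inter> cut E S \<in> ?X" if K: "matching_in_face V E F K" "S \<in> ?L" for K S
    proof (cases "S = {}")
      case False
      then have "S \<in> tight V E F" using K L by blast
      then obtain e where e: "K \<inter> cut E S = {e}" using tight_matching[OF G _ K(1)] by blast
      then have "e \<in> E" using cut_subset[of E S] by blast
      then show ?thesis using e by auto
    qed simp
    define y :: "'a set \<Rightarrow> int" where "y e = indicator (M \<inter> edges_inside E ?D) e - indicator (N \<inter> edges_inside E ?D) e" for e
    have "R y (A, B, C, M \<inter> cut E A, M \<inter> cut E C, M \<inter> cut E B, N \<inter> cut E B)"
      unfolding R_def prod.case using sub ic MF NF agA[symmetric] agC[symmetric] diff
      by (intro conjI exI[of _ M] exI[of _ N]) (simp_all add: y_def fun_eq_iff)
    moreover have "(A, B, C, M \<inter> cut E A, M \<inter> cut E C, M \<inter> cut E B, N \<inter> cut E B) \<in> T"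
      unfolding T_def by (intro SigmaI A B C X MF NF)
    ultimately have "y \<in> Y" unfolding Y_def by blast
    then have nz: "(\<Sum>e\<in>E. w e * y e) \<noteq> 0" by (rule iso)
    have agD: "M \<inter> cut E ?D = N \<inter> cut E ?D" by (rule matchings_agree_cut_Diff[OF G agA agC])
    have "(\<Sum>e\<in>E. w e * y e) = 0" using Min_face_swap_vec[OF G F M N agD] by (simp add: y_def)
    then show False using nz by blast
  qed
  then show ?thesis using w by (intro bexI[of _ w]) blast+
qed

section \<open>Halving chains of large sets\<close>

lemma exists_rank_element:
  fixes X :: "nat set"
  assumes "finite X" "1 \<le> k" "k \<le> card X"
  shows "\<exists>b\<in>X. card {x \<in> X. x \<le> b} = k"
  using assms
proof (induction "card X" arbitrary: X)
  case 0
  then show ?case by simp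
next
  case (Suc m)
  define M where "M = Max X"
  have ne: "X \<noteq> {}" using Suc by auto
  have M: "M \<in> X" "\<And>x. x \<in> X \<Longrightarrow> x \<le> M" using Suc.prems(1) ne by (auto simp: M_def)
  show ?case
  proof (cases "k = card X")
    case True
    have "{x \<in> X. x \<le> M} = X" using M by blast
    then show ?thesis using True M by (intro bexI[of _ M]) auto
  next
    case False
    have c: "m = card (X - {M})" using Suc M by simp
    from Suc.hyps(1)[OF c] Suc False c obtain b where b: "b \<in> X - {M}" "card {x \<in> X - {M}. x \<le> b} = k"
      by (metis card_Diff_singleton M(1) Suc_leI diff_Suc_1 finite_Diff le_neq_implies_less less_Suc_eq_le)
    have "\<not> M \<le> b" using M(2)[of b] b by auto
    then have "{x \<in> X - {M}. x \<le> b} = {x \<in> X. x \<le> b}" by auto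
    then show ?thesis using b by auto
  qed
qed

text \<open>\<open>C\<close> is included and \<open>A\<close> is not, so cutting at a member gives
  two disjoint parts, and the chain of a pair of consecutive sets has one element.\<close>

definition big_chain :: "'v set set \<Rightarrow> nat \<Rightarrow> 'v set \<Rightarrow> 'v set \<Rightarrow> 'v set set" where
  "big_chain L l A C = {B \<in> L. l < card B \<and> A \<subset> B \<and> B \<subseteq> C}"

definition chain_contractible ::
  "'v set \<Rightarrow> 'v set set \<Rightarrow> ('v set \<Rightarrow> real) set \<Rightarrow> 'v set set \<Rightarrow> nat \<Rightarrow> nat \<Rightarrow> bool" where
  "chain_contractible V E F L l k \<longleftrightarrow> (\<forall>A C. C \<in> L \<longrightarrow> card C \<le> 2 * l \<longrightarrow> l < card C \<longrightarrow>
     (A = {} \<or> A \<in> L \<and> l < card A) \<longrightarrow> A \<subset> C \<longrightarrow> card (big_chain L l A C) \<le> k \<longrightarrow>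
     interval_contractible V E F A C)"

text \<open>Two disjoint members would have more than \<open>2 * l\<close> elements together, too
  many for \<open>C\<close>.\<close>

lemma big_chain_linear:
  assumes fin: "finite V" and L: "laminar V L" and C: "card C \<le> 2 * l" "C \<in> L"
    and B: "B \<in> big_chain L l A C" "B' \<in> big_chain L l A C"
  shows "B \<subseteq> B' \<or> B' \<subseteq> B"
proof -
  have b: "B \<in> L" "B' \<in> L" "l < card B" "l < card B'" "B \<subseteq> C" "B' \<subseteq> C" using B by (auto simp: big_chain_def)
  have sub: "C \<subseteq> V" using C L by (auto simp: laminar_def)
  then have f: "finite C" using fin finite_subset by blast
  have "B \<inter> B' \<noteq> {}"
  proof
    assume "B \<inter> B' = {}"
    then have "card (B \<union> B') = card B + card B'" using b f finite_subset by (intro card_Un_disjoint) blast+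
    moreover have "card (B \<union> B') \<le> card C" using b f by (intro card_mono) auto
    ultimately show False using b C by linarith
  qed
  then show ?thesis using laminar_comparable[OF L b(1,2)] by blast
qed

text \<open>The chain is cut at its \<open>k\<close>-th smallest member \<open>B\<close>: the part
  up to \<open>B\<close> has \<open>k\<close> members and the rest at most \<open>k\<close>.\<close>

lemma chain_contractible_double:
  assumes G: "simple_graph V E" and n: "card V = n" "2304 \<le> n" and num: "bij_betw num E {1..card E}"
    and F: "is_face V E F" and L: "laminar V L" "L \<subseteq> tight V E F" and k: "1 \<le> k"
    and ch: "chain_contractible V E F L l k"
  shows "\<exists>w\<in>weights n num. chain_contractible V E (Min_face E F w) L l (2 * k)"
proof -
  note fin = simple_graph_finite[OF G]
  from double_interval_contractible[OF G n num F L] obtain w where w: "w \<in> weights n num"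
    and dbl': "\<forall>A\<in>insert {} L. \<forall>B\<in>insert {} L. \<forall>C\<in>insert {} L. A \<subseteq> B \<longrightarrow> B \<subseteq> C \<longrightarrow>
      interval_contractible V E F A B \<longrightarrow> interval_contractible V E F B C \<longrightarrow>
      interval_contractible V E (Min_face E F w) A C" by (rule bexE)
  note dbl = dbl'[rule_format]
  have "chain_contractible V E (Min_face E F w) L l (2 * k)"
    unfolding chain_contractible_def
  proof (intro allI impI)
    fix A C assume C: "C \<in> L" "card C \<le> 2 * l" "l < card C" and A: "A = {} \<or> A \<in> L \<and> l < card A" "A \<subset> C"
      and card: "card (big_chain L l A C) \<le> 2 * k"
    let ?B = "big_chain L l A C"
    have finL: "finite L" using card_laminar_le(1)[OF fin(1) L(1)] .
    have finB: "finite ?B" using finL by (simp add: big_chain_def)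
    show "interval_contractible V E (Min_face E F w) A C"
    proof (cases "card ?B \<le> k")
      case True
      then have "interval_contractible V E F A C" using ch C A unfolding chain_contractible_def by blast
      then show ?thesis using interval_contractible_mono[OF Min_face_subset] by blast
    next
      case False
      have fs: "finite B" if "B \<in> L" for B using that L(1) fin(1) by (meson PowD finite_subset laminar_def subsetD)
      \<comment> \<open>In a chain, inclusion is comparison of sizes, so the \<open>k\<close>-th
        member can be found among the cardinalities.\<close>
      have lin: "B \<subseteq> B' \<longleftrightarrow> card B \<le> card B'" if "B \<in> ?B" "B' \<in> ?B" for B B'
      proof
        have f: "finite B" "finite B'" using that fs by (auto simp: big_chain_def)
        show "card B \<le> card B'" if "B \<subseteq> B'" using that f card_mono by blast
        assume le: "card B \<le> card B'"
        show "B \<subseteq> B'"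
        proof (rule ccontr)
          assume "\<not> B \<subseteq> B'"
          then have "B' \<subset> B" using big_chain_linear[OF fin(1) L(1) C(2,1) that] by blast
          then have "card B' < card B" by (rule psubset_card_mono[OF f(1)])
          then show False using le by simp
        qed
      qed
      have injc: "inj_on card ?B"
      proof (rule inj_onI)
        fix B B' assume "B \<in> ?B" "B' \<in> ?B" "card B = card B'"
        then show "B = B'" using lin[of B B'] lin[of B' B] by simp
      qed
      have "card (card ` ?B) = card ?B" using card_image[OF injc] .
      then obtain b where b: "b \<in> card ` ?B" "card {x \<in> card ` ?B. x \<le> b} = k"
        using exists_rank_element[of "card ` ?B" k] finB k False by auto
      obtain B where B: "B \<in> ?B" "b = card B" using b(1) by blast
      have BL: "B \<in> L" "l < card B" "A \<subset> B" "B \<subseteq> C" using B by (auto simp: big_chain_def)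
      have low: "big_chain L l A B = {B' \<in> ?B. card B' \<le> card B}"
      proof (rule set_eqI)
        fix B'
        show "B' \<in> big_chain L l A B \<longleftrightarrow> B' \<in> {B' \<in> ?B. card B' \<le> card B}"
          using lin[of B' B] B(1) BL(4) fs[OF BL(1)] card_mono[of B B'] by (auto simp: big_chain_def)
      qed
      have "{x \<in> card ` ?B. x \<le> b} = card ` {B' \<in> ?B. card B' \<le> card B}" using B(2) by auto
      then have "card (card ` {B' \<in> ?B. card B' \<le> card B}) = k" using b(2) by simp
      moreover have "inj_on card {B' \<in> ?B. card B' \<le> card B}" using injc by (rule inj_on_subset) auto
      ultimately have clow: "card (big_chain L l A B) = k" unfolding low by (simp add: card_image)
      have subs: "big_chain L l A B \<union> big_chain L l B C \<subseteq> ?B" using BL by (auto simp: big_chain_def)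
      have "big_chain L l A B \<inter> big_chain L l B C = {}" by (auto simp: big_chain_def)
      then have "card (big_chain L l A B) + card (big_chain L l B C) \<le> card ?B"
        using card_mono[OF finB subs] finL by (subst (asm) card_Un_disjoint) (auto simp: big_chain_def)
      then have chigh: "card (big_chain L l B C) \<le> k" using clow card by simp
      have "B \<noteq> C"
      proof
        assume BC: "B = C"
        then have "big_chain L l A B = ?B" by simp
        then show False using clow False by simp
      qed
      then have BC: "B \<subset> C" using BL by blast
      have cB: "card B \<le> 2 * l" using card_mono[OF fs[OF C(1)] BL(4)] C(2) by simp
      have "interval_contractible V E F A B"
        by (rule ch[unfolded chain_contractible_def, rule_format, OF BL(1) cB BL(2) A(1) BL(3)]) (use clow in simp)
      moreover have "interval_contractible V E F B C"
        by (rule ch[unfolded chain_contractible_def, rule_format, OF C _ BC chigh]) (use BL in simp)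
      ultimately show ?thesis using A BL C by (intro dbl[of A B C]) auto
    qed
  qed
  then show ?thesis using w by blast
qed

section \<open>Combining the weight functions\<close>

lemma contractible_mono:
  assumes "F' \<subseteq> F" "contractible V E F S"
  shows "contractible V E F' S"
  unfolding contractible_def
proof (intro conjI ballI notI)
  have "S \<in> tight V E F" using assms(2) by (simp add: contractible_def)
  then show "S \<in> tight V E F'" using tight_antimono[OF assms(1)] by blast
  fix e assume e: "e \<in> cut E S"
    and "\<exists>M N. matching_in_face V E F' M \<and> matching_in_face V E F' N \<and>
        e \<in> M \<and> e \<in> N \<and> M \<inter> edges_inside E S \<noteq> N \<inter> edges_inside E S"
  then obtain M N where M: "matching_in_face V E F' M" "e \<in> M" and N: "matching_in_face V E F' N" "e \<in> N"
    and diff: "M \<inter> edges_inside E S \<noteq> N \<inter> edges_inside E S" by blast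
  show False
    using contractible_unique[OF assms(2) e matching_in_face_mono[OF assms(1) M(1)]
        matching_in_face_mono[OF assms(1) N(1)] M(2) N(2)] diff by simp
qed

lemma interval_contractible_imp_contractible:
  assumes G: "simple_graph V E" and S: "S \<in> tight V E F" and ic: "interval_contractible V E F {} S"
  shows "contractible V E F S"
  unfolding contractible_def
proof (intro conjI ballI notI S)
  fix e assume e: "e \<in> cut E S"
    and "\<exists>M N. matching_in_face V E F M \<and> matching_in_face V E F N \<and>
        e \<in> M \<and> e \<in> N \<and> M \<inter> edges_inside E S \<noteq> N \<inter> edges_inside E S"
  then obtain M N where M: "matching_in_face V E F M" "e \<in> M" and N: "matching_in_face V E F N" "e \<in> N"
    and diff: "M \<inter> edges_inside E S \<noteq> N \<inter> edges_inside E S" by blast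
  obtain a where a: "M \<inter> cut E S = {a}" using tight_matching[OF G S M(1)] by blast
  obtain b where b: "N \<inter> cut E S = {b}" using tight_matching[OF G S N(1)] by blast
  have "e \<in> M \<inter> cut E S" "e \<in> N \<inter> cut E S" using e M N by auto
  then have eq: "M \<inter> cut E S = N \<inter> cut E S" unfolding a b by simp
  have "M \<inter> edges_inside E (S - {}) = N \<inter> edges_inside E (S - {})"
    by (rule ic[unfolded interval_contractible_def, rule_format, OF M(1) N(1) _ eq]) simp
  then show False using diff by simp
qed

text \<open>Distinct members have distinct odd sizes above one, so halving the sizes is injective
  into \<open>{1..card V div 2}\<close>. The factor of two gained here saves one doubling.\<close>

lemma card_big_chain_le:
  assumes fin: "finite V" and L: "laminar V L" "\<And>S. S \<in> L \<Longrightarrow> odd (card S)" and C: "card C \<le> 2 * l" "C \<in> L" and l: "1 \<le> l"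
  shows "card (big_chain L l A C) \<le> card V div 2"
proof -
  let ?B = "big_chain L l A C"
  have fs: "finite B" "card B \<le> card V" if "B \<in> L" for B
    using that L(1) fin by (auto simp: laminar_def intro: finite_subset card_mono)
  have "inj_on (\<lambda>B. card B div 2) ?B"
  proof (rule inj_onI)
    fix B B' assume B: "B \<in> ?B" "B' \<in> ?B" "card B div 2 = card B' div 2"
    have BL: "B \<in> L" "B' \<in> L" using B by (auto simp: big_chain_def)
    have "odd (card B)" "odd (card B')" using L(2) BL by blast+
    then have "card B = card B'" using B(3) by (metis odd_two_times_div_two_succ)
    moreover have "B \<subseteq> B' \<or> B' \<subseteq> B" by (rule big_chain_linear[OF fin L(1) C B(1,2)])
    ultimately show "B = B'" using fs(1) BL card_subset_eq by metis
  qed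
  moreover have "(\<lambda>B. card B div 2) ` ?B \<subseteq> {1..card V div 2}"
  proof (rule image_subsetI)
    fix B assume B: "B \<in> ?B"
    then have "B \<in> L" "2 \<le> card B" using l by (auto simp: big_chain_def)
    then show "card B div 2 \<in> {1..card V div 2}" using fs(2)[of B] by (auto intro: div_le_mono)
  qed
  ultimately have "card ?B \<le> card {1..card V div 2}" by (intro card_inj_on_le) auto
  then show ?thesis by simp
qed

lemma le_two_power_ceiling_log:
  assumes "1 \<le> n"
  shows "n \<le> 2 ^ nat \<lceil>log 2 (real n)\<rceil>"
proof -
  have "real n = 2 powr (log 2 (real n))" using assms by simp
  also have "\<dots> \<le> 2 powr (real (nat \<lceil>log 2 (real n)\<rceil>))" by (intro powr_mono real_nat_ceiling_ge) auto
  also have "\<dots> = real (2 ^ nat \<lceil>log 2 (real n)\<rceil>)" by (simp add: powr_realpow)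
  finally show ?thesis by linarith
qed

text \<open>After the initial weight \<open>w\<close>, the list \<open>ws\<close> holds one weight
  per doubling, so chains of length \<open>2 ^ j\<close> cost \<open>j + 1\<close> weights.\<close>

lemma exists_contractible_weight:
  assumes G: "simple_graph V E" and n: "card V = n" "2304 \<le> n" and num: "bij_betw num E {1..card E}"
    and F: "is_face V E F" and L: "laminar V L" "L \<subseteq> tight V E F" and l: "1 \<le> l" "l \<le> n"
    and con: "\<And>S. S \<in> L \<Longrightarrow> card S \<le> l \<Longrightarrow> contractible V E F S"
    and none: "\<And>vs es. alternating_circuit (contraction E F L l) vs es \<Longrightarrow> l < walk_weight (contraction E F L l) vs"
  shows "\<exists>w ws. w \<in> weights n num \<and> set ws \<subseteq> weights n num \<and> length ws = j \<and>
    chain_contractible V E (Min_face E F (foldl (weight_comp n) w ws)) L l (2 ^ j)"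
proof (induction j)
  case 0
  from isolate_circuits[OF G n num L l(2) none] obtain w where w: "w \<in> weights n num"
    and iso: "\<forall>\<chi>\<in>circuit_vecs (contraction E F L l) (2 * l). (\<Sum>e\<in>E. w e * lift V E F L l \<chi> e) \<noteq> 0" by (rule bexE)
  have conN: "contractible V E F N" if "N \<in> contraction_nodes L l" for N using that con by (simp add: contraction_nodes_def)
  have "chain_contractible V E (Min_face E F w) L l 1"
    unfolding chain_contractible_def
  proof (intro allI impI)
    fix A C assume C: "C \<in> L" "card C \<le> 2 * l" "l < card C" and A: "A = {} \<or> A \<in> L \<and> l < card A" "A \<subset> C"
      and card: "card (big_chain L l A C) \<le> 1"
    have finB: "finite (big_chain L l A C)"
      using card_laminar_le(1)[OF simple_graph_finite(1)[OF G] L(1)] by (simp add: big_chain_def)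
    have CB: "C \<in> big_chain L l A C" using C A by (simp add: big_chain_def)
    show "interval_contractible V E (Min_face E F w) A C"
    proof (rule base_interval_contractible[OF G F L l(1) conN _ C A])
      show "B = C" if "B \<in> L" "l < card B" "A \<subset> B" "B \<subseteq> C" for B
      proof -
        have "B \<in> big_chain L l A C" using that by (simp add: big_chain_def)
        then show ?thesis using card CB card_le_Suc0_iff_eq[OF finB] by simp
      qed
    qed (assumption | rule bspec[OF iso])+
  qed
  then show ?case using w by (intro exI[of _ w] exI[of _ "[]"]) simp
next
  case (Suc j)
  then obtain w ws where w: "w \<in> weights n num" "set ws \<subseteq> weights n num" "length ws = j"
    and ch: "chain_contractible V E (Min_face E F (foldl (weight_comp n) w ws)) L l (2 ^ j)" by blast
  let ?F = "Min_face E F (foldl (weight_comp n) w ws)"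
  have F1: "is_face V E ?F" by (rule Min_face_is_face[OF G F])
  have L1: "L \<subseteq> tight V E ?F" using L(2) tight_antimono[OF Min_face_subset] by blast
  from chain_contractible_double[OF G n num F1 L(1) L1 _ ch] obtain w' where w': "w' \<in> weights n num"
    and ch': "chain_contractible V E (Min_face E ?F w') L l (2 * 2 ^ j)" by auto
  have "Min_face E ?F w' = Min_face E F (foldl (weight_comp n) w (ws @ [w']))"
    using Min_face_weight_comp[OF G F n(1) _ w'] n by simp
  then show ?case using w w' ch' by (intro exI[of _ w] exI[of _ "ws @ [w']"]) simp
qed

theorem theorem5p6:
  "\<exists>n\<^sub>0::nat. \<forall>(V :: 'v set) (E :: 'v set set) (num :: 'v set \<Rightarrow> nat) (l :: nat)
       (F_in :: ('v set \<Rightarrow> real) set) (L_in :: 'v set set).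
     simple_graph V E \<longrightarrow> card V \<ge> n\<^sub>0 \<longrightarrow> bij_betw num E {1..card E} \<longrightarrow>
     1 \<le> l \<longrightarrow> l \<le> card V \<longrightarrow> good V E l F_in L_in \<longrightarrow>
     (\<exists>w_out \<in> weights_pow (card V) num (nat \<lceil>log 2 (real (card V))\<rceil> + 1).
        let F_out = Min_face E F_in w_out; H = contraction E F_out L_in (2 * l) in
          is_face V E F_out \<and>
          (\<forall>S\<in>L_in. card S \<le> 2 * l \<longrightarrow> contractible V E F_out S) \<and>
          \<not> (\<exists>vs es. alternating_circuit H vs es \<and> respects_face V E H F_out es \<and>
                    walk_weight H vs \<le> 2 * l))"
proof (intro exI[of _ 2304] allI impI)
  fix V :: "'v set" and E :: "'v set set" and num :: "'v set \<Rightarrow> nat" and l :: nat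
    and F :: "('v set \<Rightarrow> real) set" and L :: "'v set set"
  assume G: "simple_graph V E" and n: "2304 \<le> card V" and num: "bij_betw num E {1..card E}"
    and l: "1 \<le> l" "l \<le> card V" and good: "good V E l F L"
  note fin = simple_graph_finite[OF G]
  define m where "m = card V"
  have m: "card V = m" "2304 \<le> m" using n by (auto simp: m_def)
  have lm: "l \<le> m" using l by (simp add: m_def)
  have F: "is_face V E F" and L: "laminar V L" "L \<subseteq> tight V E F"
    and con: "\<And>S. S \<in> L \<Longrightarrow> card S \<le> l \<Longrightarrow> contractible V E F S"
    using good by (auto simp: good_def face_laminar_pair_def)
  have none: "l < walk_weight (contraction E F L l) vs" if "alternating_circuit (contraction E F L l) vs es" for vs es
    using good that unfolding good_def by (meson not_le)
  define q where "q = nat \<lceil>log 2 (real m)\<rceil>"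
  have mq: "m \<le> 2 ^ q" unfolding q_def using m by (intro le_two_power_ceiling_log) simp
  \<comment> \<open>There are \<open>p = q - 1\<close> doublings. With the first and the last weight
    this makes \<open>q + 1\<close> in total, and \<open>2 ^ p\<close> is at least m / 2, the bound
    on the length of a chain.\<close>
  obtain p where p: "q = Suc p" using mq m by (cases q) auto
  have "\<exists>w ws. w \<in> weights m num \<and> set ws \<subseteq> weights m num \<and> length ws = p \<and>
    chain_contractible V E (Min_face E F (foldl (weight_comp m) w ws)) L l (2 ^ p)"
    by (rule exists_contractible_weight[OF G m num F L l(1) lm con none])
  then obtain w ws where w: "w \<in> weights m num" "set ws \<subseteq> weights m num" "length ws = p"
    and ch: "chain_contractible V E (Min_face E F (foldl (weight_comp m) w ws)) L l (2 ^ p)" by blast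
  define F1 where "F1 = Min_face E F (foldl (weight_comp m) w ws)"
  have F1: "is_face V E F1" unfolding F1_def by (rule Min_face_is_face[OF G F])
  have sub1: "F1 \<subseteq> F" unfolding F1_def by (rule Min_face_subset)
  have L1: "L \<subseteq> tight V E F1" using L(2) tight_antimono[OF sub1] by blast
  have con1: "contractible V E F1 S" if S: "S \<in> L" "card S \<le> 2 * l" for S
  proof (cases "card S \<le> l")
    case True
    then show ?thesis using contractible_mono[OF sub1 con[OF S(1)]] by blast
  next
    case False
    then have lS: "l < card S" by simp
    have odd: "odd (card S)" if "S \<in> L" for S using that L(2) by (auto simp: tight_def)
    have "card (big_chain L l {} S) \<le> m div 2"
      using card_big_chain_le[OF fin(1) L(1) odd S(2,1) l(1)] m by simp
    also have "\<dots> \<le> 2 ^ p" using mq p by simp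
    finally have "card (big_chain L l {} S) \<le> 2 ^ p" .
    moreover have "{} \<subset> S" using lS by auto
    ultimately have "interval_contractible V E F1 {} S"
      using lS S ch[folded F1_def, unfolded chain_contractible_def, rule_format, of S "{}"] by auto
    then show ?thesis using interval_contractible_imp_contractible[OF G] S L1 by blast
  qed
  \<comment> \<open>This makes the counting bound available a second time, for circuits of weight at
    most \<open>2 * l\<close> in the coarser contraction.\<close>
  have none1: "l < walk_weight (contraction E F1 L (2 * l)) vs"
    if "alternating_circuit (contraction E F1 L (2 * l)) vs es" for vs es
    by (rule no_light_circuit_coarser[OF G L(1) l(1) supp_mono[OF sub1] none that])
  from isolate_circuits[OF G m num L(1) L1 lm none1] obtain w' where w': "w' \<in> weights m num"
    and iso: "\<forall>\<chi>\<in>circuit_vecs (contraction E F1 L (2 * l)) (2 * l). (\<Sum>e\<in>E. w' e * lift V E F1 L (2 * l) \<chi> e) \<noteq> 0"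
    by (rule bexE)
  define w_out where "w_out = foldl (weight_comp m) w (ws @ [w'])"
  define F_out where "F_out = Min_face E F w_out"
  have Fo: "F_out = Min_face E F1 w'"
    unfolding F_out_def w_out_def F1_def using Min_face_weight_comp[OF G F m(1) _ w'] m by simp
  have wo: "w_out \<in> weights_pow m num (q + 1)"
    unfolding weights_pow_def w_out_def using w w' p by (intro CollectI exI[of _ w] exI[of _ "ws @ [w']"]) simp
  have face: "is_face V E F_out" unfolding Fo by (rule Min_face_is_face[OF G F1])
  have cont: "contractible V E F_out S" if "S \<in> L" "card S \<le> 2 * l" for S
    unfolding Fo using contractible_mono[OF Min_face_subset con1[OF that]] .
  have circ: "2 * l < walk_weight (contraction E F_out L (2 * l)) vs"
    if "alternating_circuit (contraction E F_out L (2 * l)) vs es"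
      "respects_face V E (contraction E F_out L (2 * l)) F_out es" for vs es
    using that unfolding Fo
  proof (rule no_respecting_circuit[OF G F1 L(1) L1, rotated 3])
    show "1 \<le> 2 * l" using l by simp
    show "contractible V E F1 N" if "N \<in> contraction_nodes L (2 * l)" for N
      using that by (intro con1) (auto simp: contraction_nodes_def)
  qed (assumption | rule bspec[OF iso])+
  show "\<exists>w_out \<in> weights_pow (card V) num (nat \<lceil>log 2 (real (card V))\<rceil> + 1).
        let F_out = Min_face E F w_out; H = contraction E F_out L (2 * l) in
          is_face V E F_out \<and>
          (\<forall>S\<in>L. card S \<le> 2 * l \<longrightarrow> contractible V E F_out S) \<and>
          \<not> (\<exists>vs es. alternating_circuit H vs es \<and> respects_face V E H F_out es \<and>
                    walk_weight H vs \<le> 2 * l)"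
    unfolding Let_def
  proof (rule bexI[of _ w_out], intro conjI ballI impI notI)
    show "w_out \<in> weights_pow (card V) num (nat \<lceil>log 2 (real (card V))\<rceil> + 1)"
      using wo by (simp add: q_def m_def)
    show "is_face V E (Min_face E F w_out)" using face by (simp add: F_out_def)
    show "contractible V E (Min_face E F w_out) S" if "S \<in> L" "card S \<le> 2 * l" for S
      using cont[OF that] by (simp add: F_out_def)
    assume "\<exists>vs es. alternating_circuit (contraction E (Min_face E F w_out) L (2 * l)) vs es \<and>
      respects_face V E (contraction E (Min_face E F w_out) L (2 * l)) (Min_face E F w_out) es \<and>
      walk_weight (contraction E (Min_face E F w_out) L (2 * l)) vs \<le> 2 * l"
    then obtain vs es where "alternating_circuit (contraction E F_out L (2 * l)) vs es"
      "respects_face V E (contraction E F_out L (2 * l)) F_out es"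
      "walk_weight (contraction E F_out L (2 * l)) vs \<le> 2 * l" unfolding F_out_def[symmetric] by blast
    then show False using circ[of vs es] by simp
  qed
qed

end
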